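(* Let $T$ be a digraph with vertices $u_1,\dots,u_t$, $t\ge 2$, let $H_1,\dots,H_t$ be digraphs where $H_i$ has $n_i$ vertices, and let $Q=T[H_1,\dots,H_t]$. Then $Q$ has a good decomposition if at least one of the following holds: (a) $T$ is a 2-arc-strong semicomplete digraph, $H_1,\dots,H_t$ are arbitrary digraphs, and $Q$ is not isomorphic to $S_4$; (b) $T$ has a Hamiltonian cycle and one of the following holds: $t$ is even and $n_i\ge 2$ for every $i$; or $t$ is odd and $n_i\ge 3$ for every $i$ except for one index $i$ for which $n_i\ge 2$; or $t$ is odd, $n_i\ge 2$ for every $i$, and at least two distinct digraphs $H_i$ have arcs; (c) $T$ and all $H_i$ are strong digraphs of order at least 2.
   Context: All digraphs are finite, without loops or parallel arcs; cycles and paths are directed. A digraph is strong if for every ordered pair of distinct vertices $x,y$ there is a directed path from $x$ to $y$. A digraph $D$ is $k$-arc-strong if $D-X$ is strong for every set $X$ of at most $k-1$ arcs. A digraph is semicomplete if there is at least one arc between every pair of distinct vertices. A digraph $D=(V,A)$ has a good decomposition if $A$ contains two disjoint sets $A_1,A_2$ with both $(V,A_1)$ and $(V,A_2)$ strong. $S_4$ denotes the digraph obtained from the complete digraph on four vertices (all arcs in both directions) by deleting the arcs of a directed cycle of length four. Composition: if $T$ has vertices $u_1,\dots,u_t$ and $H_i$ has vertices $u_{i,1},\dots,u_{i,n_i}$, then $T[H_1,\dots,H_t]$ has vertex set $\{u_{i,j}: 1\le i\le t,1\le j\le n_i\}$ and arc set $\bigcup_{i=1}^t A(H_i)\cup\{u_{i,j}u_{p,q}: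 u_iu_p\in A(T), 1\le j\le n_i,1\le q\le n_p\}$. *)

theory Defs
  imports "Graph_Theory.Graph_Theory"
begin

text \<open>
  A finite digraph without loops or parallel arcs is a \<open>pair_digraph\<close> of the
  \<open>Graph_Theory\<close> library, and "strong" is its \<open>strongly_connected\<close> (which additionally
  excludes the null digraph).
\<close>

definition arc_strong :: "nat \<Rightarrow> 'a pair_pre_digraph \<Rightarrow> bool" where
  "arc_strong k D \<longleftrightarrow>
     (\<forall>X \<subseteq> parcs D. card X < k \<longrightarrow>
        strongly_connected (with_proj \<lparr>pverts = pverts D, parcs = parcs D - X\<rparr>))"

definition semicomplete :: "'a pair_pre_digraph \<Rightarrow> bool" where
  "semicomplete D \<longleftrightarrow>
     (\<forall>u \<in> pverts D. \<forall>v \<in> pverts D. u \<noteq> v \<longrightarrow> (u, v) \<in> parcs D \<or> (v, u) \<in> parcs D)"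

text \<open>
  \<open>pre_digraph.cycle\<close> represents a cycle by its list of arcs. On a closed walk every vertex
  is the tail of some arc, so the image under \<open>fst\<close> is the vertex set of the cycle.
\<close>

definition hamiltonian :: "'a pair_pre_digraph \<Rightarrow> bool" where
  "hamiltonian D \<longleftrightarrow>
     (\<exists>p. pre_digraph.cycle (with_proj D) p \<and> fst ` set p = pverts D)"

definition good_decomposition :: "'a pair_pre_digraph \<Rightarrow> bool" where
  "good_decomposition D \<longleftrightarrow>
     (\<exists>A\<^sub>1 A\<^sub>2. A\<^sub>1 \<subseteq> parcs D \<and> A\<^sub>2 \<subseteq> parcs D \<and> A\<^sub>1 \<inter> A\<^sub>2 = {} \<and>
        strongly_connected (with_proj \<lparr>pverts = pverts D, parcs = A\<^sub>1\<rparr>) \<and>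
        strongly_connected (with_proj \<lparr>pverts = pverts D, parcs = A\<^sub>2\<rparr>))"

definition S4 :: "nat pair_pre_digraph" where
  "S4 = \<lparr>pverts = {0, 1, 2, 3},
         parcs = {(i, j). i \<in> {0, 1, 2, 3} \<and> j \<in> {0, 1, 2, 3} \<and> i \<noteq> j}
                 - {(0, 1), (1, 2), (2, 3), (3, 0)}\<rparr>"

text \<open>
  The family \<open>H\<close> is indexed by the vertices of \<open>T\<close>. The vertices of the copy of \<open>H u\<close> are
  tagged with \<open>u\<close>, so the copies are disjoint even if the digraphs \<open>H u\<close> share vertices.
\<close>

definition composition ::
    "'a pair_pre_digraph \<Rightarrow> ('a \<Rightarrow> 'b pair_pre_digraph) \<Rightarrow> ('a \<times> 'b) pair_pre_digraph" where
  "composition T H =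
     \<lparr>pverts = (SIGMA u : pverts T. pverts (H u)),
      parcs = {((u, x), (u, y)) | u x y. u \<in> pverts T \<and> (x, y) \<in> parcs (H u)}
              \<union> {((u, x), (v, y)) | u v x y.
                   (u, v) \<in> parcs T \<and> x \<in> pverts (H u) \<and> y \<in> pverts (H v)}\<rparr>"

end

theory Submission
  imports Defs
begin

text \<open>
  Part (a) rests on the theorem that a 2-arc-strong semicomplete digraph other than \<open>S\<^sub>4\<close> has a
  good decomposition, proved by induction on the order. If some cut with two vertices on both sides has
  only two arcs, or if deleting a vertex leaves a digraph with no arcs from one part to
  the other, the decomposition is glued from arc-disjoint spanning branchings of the two sides; these
  are read off good decompositions of the smaller digraphs in which the other side is contracted, so
  Edmonds' branching theorem is not needed. Deleting arcs while keeping 2-arc-strength then leaves a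
  tournament. The one of order 5 consists of two Hamiltonian cycles. For order at least 6, a vertex may
  be deleted or replaced by a shortcut arc as long as the rest stays 2-arc-strong, so in a
  counterexample every vertex p separates two sets Y and X with at most one arc from Y to X. Such
  splits are trivial (Y or X a singleton) only next to vertices of out-degree or in-degree 2, of which
  there is at most one each, and a vertex chosen inside a nontrivial split with Y minimal can have only
  trivial ones, which is contradictory.

  The copy of T picked by one vertex in each H i carries the decomposition of T, and all further
  vertices are attached by two in-arcs and two out-arcs. In part (b) two copies of the Hamiltonian cycle
  are recombined level by level into cycles; for odd t one of the halves falls into two cycles, which are joined
  by arcs inside the H i or by detours through third vertices. In part (c) the arcs inside the H i
  together with one copy of T form one half, and the remaining arcs between different H i the other.
\<close>

text \<open>Contracting one side of a cut to a vertex \<open>p\<close> raises two problems: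
  \<open>p\<close> need not be adjacent to everything, and the result may be S4, about which the
  induction hypothesis is silent. Both disappear once all arcs into \<open>p\<close> are added. An
  out-branching from \<open>p\<close> can do without them, so they are dropped again afterwards, and
  S4 has no vertex that is entered from all others. The contracted side is named after one of its
  own vertices, so everything stays within one vertex type.

  The bounds 5 and 6 have different origins. Gluing along a cut of two arcs takes a third vertex on
  one side to share out the backward arcs, hence order 5. From order 6 on, the digraph without one
  vertex has at least five vertices and cannot be S4.

  In part (b) the obstacle is parity: the two halves swap the copies on complementary sets of
  levels, a half is a single cycle exactly when its number of swaps is odd, and for odd t the two
  numbers cannot both be odd.\<close>

definition leaving :: "'a rel \<Rightarrow> 'a set \<Rightarrow> 'a rel" where
  "leaving A Z = {(a, b). (a, b) \<in> A \<and> a \<in> Z \<and> b \<notin> Z}"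

definition strong_on :: "'a set \<Rightarrow> 'a rel \<Rightarrow> bool" where
  "strong_on V R \<longleftrightarrow> (\<forall>u \<in> V. \<forall>v \<in> V. (u, v) \<in> R\<^sup>*)"

definition good :: "'a set \<Rightarrow> 'a rel \<Rightarrow> bool" where
  "good V A \<longleftrightarrow> (\<exists>A1 A2. A1 \<subseteq> A \<inter> V \<times> V \<and> A2 \<subseteq> A \<inter> V \<times> V \<and> A1 \<inter> A2 = {} \<and>
     strong_on V A1 \<and> strong_on V A2)"

text \<open>Quantifying over one arc \<open>e\<close> expresses "at least two leaving arcs" without
  cardinalities. Vertex sets with at most one element satisfy this vacuously.\<close>

definition two_arc_strong :: "'a set \<Rightarrow> 'a rel \<Rightarrow> bool" where
  "two_arc_strong V A \<longleftrightarrow> (\<forall>Z e. Z \<subset> V \<longrightarrow> Z \<noteq> {} \<longrightarrow> \<not> leaving (A \<inter> V \<times> V) Z \<subseteq> {e})"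

definition semicomp :: "'a set \<Rightarrow> 'a rel \<Rightarrow> bool" where
  "semicomp V A \<longleftrightarrow> finite V \<and> irrefl A \<and> A \<subseteq> V \<times> V \<and>
     (\<forall>u \<in> V. \<forall>v \<in> V. u \<noteq> v \<longrightarrow> (u, v) \<in> A \<or> (v, u) \<in> A)"

text \<open>The absent arcs are those of the cycle \<open>a\<close>, \<open>b\<close>,
  \<open>c\<close>, \<open>d\<close>, \<open>a\<close>.\<close>

definition is_S4 :: "'a set \<Rightarrow> 'a rel \<Rightarrow> bool" where
  "is_S4 V A \<longleftrightarrow> (\<exists>a b c d. distinct [a, b, c, d] \<and> V = {a, b, c, d} \<and>
     A = {(a, c), (c, a), (b, d), (d, b), (b, a), (c, b), (d, c), (a, d)})"

text \<open>The induction hypothesis in a form that lemmas can assume. The \<open>itself\<close>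
  argument fixes the vertex type, which \<open>k\<close> alone would leave undetermined.\<close>

definition decomposable_upto :: "'a itself \<Rightarrow> nat \<Rightarrow> bool" where
  "decomposable_upto _ k \<longleftrightarrow> (\<forall>(V :: 'a set) A. card V \<le> k \<longrightarrow> semicomp V A \<longrightarrow>
     two_arc_strong V A \<longrightarrow> \<not> is_S4 V A \<longrightarrow> good V A)"

lemma semicompD:
  assumes "semicomp V A"
  shows "finite V" "irrefl A" "A \<subseteq> V \<times> V" "u \<in> V \<Longrightarrow> v \<in> V \<Longrightarrow> u \<noteq> v \<Longrightarrow> (u, v) \<in> A \<or> (v, u) \<in> A"
  using assms unfolding semicomp_def by blast+

lemma strong_onI:
  assumes "\<And>v. v \<in> V \<Longrightarrow> (p, v) \<in> R\<^sup>*" "\<And>v. v \<in> V \<Longrightarrow> (v, p) \<in> R\<^sup>*"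
  shows "strong_on V R"
  unfolding strong_on_def using assms rtrancl_trans by metis

lemma rtrancl_subset_mono:
  assumes "R \<subseteq> S\<^sup>*" "(u, v) \<in> R\<^sup>*"
  shows "(u, v) \<in> S\<^sup>*"
  using assms rtrancl_subset_rtrancl by blast

lemma rtrancl_mono_mem: "(u, v) \<in> R\<^sup>* \<Longrightarrow> R \<subseteq> S \<Longrightarrow> (u, v) \<in> S\<^sup>*"
  using rtrancl_mono by blast

lemma goodI:
  assumes "A1 \<subseteq> A" "A1 \<subseteq> V \<times> V" "A2 \<subseteq> A" "A2 \<subseteq> V \<times> V" "A1 \<inter> A2 = {}" "strong_on V A1" "strong_on V A2"
  shows "good V A"
  using assms unfolding good_def by (intro exI[of _ A1] exI[of _ A2]) simp

lemma goodE:
  assumes "good V A"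
  obtains A1 A2 where "A1 \<subseteq> A" "A1 \<subseteq> V \<times> V" "A2 \<subseteq> A" "A2 \<subseteq> V \<times> V" "A1 \<inter> A2 = {}"
    "strong_on V A1" "strong_on V A2"
  using assms unfolding good_def le_inf_iff by (elim exE conjE) (rule that)

lemma good_mono: "good V A \<Longrightarrow> A \<subseteq> B \<Longrightarrow> good V B"
  unfolding good_def by (meson inf_mono order_refl order_trans)

section \<open>Extending a decomposition by further vertices\<close>

text \<open>Every vertex outside \<open>U\<close> hands one of its two in-arcs and one of its two
  out-arcs to each half. All these arcs are joined to \<open>U\<close>, so the new vertices do not
  depend on one another.\<close>

lemma good_attach:
  assumes g: "good U A" and UV: "U \<subseteq> V"
    and i: "\<And>v. v \<in> V - U \<Longrightarrow> \<exists>x \<in> U. \<exists>y \<in> U. x \<noteq> y \<and> (x, v) \<in> A \<and> (y, v) \<in> A"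
    and o: "\<And>v. v \<in> V - U \<Longrightarrow> \<exists>x \<in> U. \<exists>y \<in> U. x \<noteq> y \<and> (v, x) \<in> A \<and> (v, y) \<in> A"
  shows "good V A"
proof (cases "U = {}")
  case True
  then have "V - U = {}" using i by blast
  then show ?thesis using g UV True by auto
next
  case False
  obtain A1 A2 where A12: "A1 \<subseteq> A" "A1 \<subseteq> U \<times> U" "A2 \<subseteq> A" "A2 \<subseteq> U \<times> U" "A1 \<inter> A2 = {}"
    "strong_on U A1" "strong_on U A2" using g by (rule goodE)
  obtain i1 i2 where ii: "\<And>v. v \<in> V - U \<Longrightarrow> i1 v \<in> U \<and> i2 v \<in> U \<and> i1 v \<noteq> i2 v \<and> (i1 v, v) \<in> A \<and> (i2 v, v) \<in> A"
    using i by metis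
  obtain o1 o2 where oo: "\<And>v. v \<in> V - U \<Longrightarrow> o1 v \<in> U \<and> o2 v \<in> U \<and> o1 v \<noteq> o2 v \<and> (v, o1 v) \<in> A \<and> (v, o2 v) \<in> A"
    using o by metis
  define N where "N = (\<lambda>(f :: 'a \<Rightarrow> 'a) g. {(f v, v) | v. v \<in> V - U} \<union> {(v, g v) | v. v \<in> V - U})"
  have st: "strong_on V (B \<union> N f g)"
    if B: "strong_on U B" and fg: "\<And>v. v \<in> V - U \<Longrightarrow> f v \<in> U \<and> g v \<in> U" for B f g
  proof -
    obtain p where p: "p \<in> U" using False by blast
    have U: "(u, v) \<in> (B \<union> N f g)\<^sup>*" if "u \<in> U" "v \<in> U" for u v
      using B that unfolding strong_on_def by (blast intro: rtrancl_mono_mem)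
    show ?thesis
    proof (rule strong_onI[where p = p])
      fix v assume v: "v \<in> V"
      show "(p, v) \<in> (B \<union> N f g)\<^sup>*"
      proof (cases "v \<in> U")
        case False
        then have "(f v, v) \<in> B \<union> N f g" using v by (auto simp: N_def)
        then show ?thesis using U[OF p, of "f v"] fg[of v] v False by (auto intro: rtrancl_into_rtrancl)
      qed (use U p in auto)
      show "(v, p) \<in> (B \<union> N f g)\<^sup>*"
      proof (cases "v \<in> U")
        case False
        then have "(v, g v) \<in> B \<union> N f g" using v by (auto simp: N_def)
        then show ?thesis using U[OF _ p, of "g v"] fg[of v] v False
          by (auto intro: converse_rtrancl_into_rtrancl)
      qed (use U p in auto)
    qed
  qed
  have "strong_on V (A1 \<union> N i1 o1)" by (rule st) (use A12 ii oo in simp_all)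
  moreover have "strong_on V (A2 \<union> N i2 o2)" by (rule st) (use A12 ii oo in simp_all)
  moreover have "A1 \<union> N i1 o1 \<subseteq> A" "A2 \<union> N i2 o2 \<subseteq> A"
    using A12(1,3) ii oo unfolding N_def by auto
  moreover have "A1 \<union> N i1 o1 \<subseteq> V \<times> V" "A2 \<union> N i2 o2 \<subseteq> V \<times> V"
    using A12(2,4) UV ii oo unfolding N_def by auto
  moreover have "(A1 \<union> N i1 o1) \<inter> (A2 \<union> N i2 o2) = {}"
  proof -
    have "A1 \<inter> N i2 o2 = {}" "N i1 o1 \<inter> A2 = {}" using A12(2,4) unfolding N_def by auto
    moreover have "N i1 o1 \<inter> N i2 o2 = {}"
      unfolding N_def using ii oo by (auto dest!: ii oo)
    ultimately show ?thesis using A12(5) by auto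
  qed
  ultimately show ?thesis by (intro goodI)
qed

text \<open>Only one half can contain the shortcut \<open>(w, y)\<close>; there it is replaced by
  the path through \<open>p\<close>. The other half visits \<open>p\<close> from \<open>z\<close>
  and goes on to \<open>u\<close>; \<open>z \<noteq> w\<close> and \<open>u \<noteq> y\<close> keep
  the halves disjoint.\<close>

lemma good_split:
  assumes g: "good (V - {p}) (insert (w, y) (A \<inter> (V - {p}) \<times> (V - {p})))"
    and V: "w \<in> V" "p \<in> V" "y \<in> V" "z \<in> V" "u \<in> V" and ne: "w \<noteq> p" "y \<noteq> p" "z \<noteq> p" "u \<noteq> p"
    and A: "(w, p) \<in> A" "(p, y) \<in> A" "(z, p) \<in> A" "(p, u) \<in> A" "z \<noteq> w" "u \<noteq> y"
  shows "good V A"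
proof -
  let ?A = "insert (w, y) (A \<inter> (V - {p}) \<times> (V - {p}))"
  \<comment> \<open>The halves are interchangeable, so the shortcut may be assumed absent from
    \<open>B2\<close>.\<close>
  obtain B1 B2 where B: "B1 \<subseteq> ?A" "B2 \<subseteq> ?A" "B1 \<inter> B2 = {}"
    "strong_on (V - {p}) B1" "strong_on (V - {p}) B2" and B2: "(w, y) \<notin> B2"
  proof -
    obtain C1 C2 where C: "C1 \<subseteq> ?A" "C2 \<subseteq> ?A" "C1 \<inter> C2 = {}"
      "strong_on (V - {p}) C1" "strong_on (V - {p}) C2" using g by (rule goodE)
    show ?thesis
    proof (cases "(w, y) \<in> C2")
      case True
      then have "(w, y) \<notin> C1" using C(3) by auto
      then show ?thesis using that[of C2 C1] C by (simp add: Int_commute)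
    qed (use that[of C1 C2] C in simp)
  qed
  let ?C1 = "(B1 - {(w, y)}) \<union> {(w, p), (p, y)}" and ?C2 = "B2 \<union> {(z, p), (p, u)}"
  have sub: "B1 \<subseteq> ?C1\<^sup>*" by (auto intro: rtrancl_into_rtrancl)
  have "strong_on V ?C1"
  proof (rule strong_onI[where p = w])
    fix v assume v: "v \<in> V"
    show "(w, v) \<in> ?C1\<^sup>*" using v B(4) V ne sub
      by (cases "v = p") (auto simp: strong_on_def intro: rtrancl_subset_mono)
    have "(y, w) \<in> ?C1\<^sup>*" using B(4) V ne sub by (auto simp: strong_on_def intro: rtrancl_subset_mono)
    then have "(p, w) \<in> ?C1\<^sup>*" by (auto intro: converse_rtrancl_into_rtrancl)
    then show "(v, w) \<in> ?C1\<^sup>*" using v B(4) V ne sub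
      by (cases "v = p") (auto simp: strong_on_def intro: rtrancl_subset_mono)
  qed
  moreover have "strong_on V ?C2"
  proof (rule strong_onI[where p = z])
    fix v assume v: "v \<in> V"
    show "(z, v) \<in> ?C2\<^sup>*" using v B(5) V ne
      by (cases "v = p") (auto simp: strong_on_def intro: rtrancl_mono_mem)
    have "(u, z) \<in> ?C2\<^sup>*" using B(5) V ne by (auto simp: strong_on_def intro: rtrancl_mono_mem)
    then have "(p, z) \<in> ?C2\<^sup>*" by (auto intro: converse_rtrancl_into_rtrancl)
    then show "(v, z) \<in> ?C2\<^sup>*" using v B(5) V ne
      by (cases "v = p") (auto simp: strong_on_def intro: rtrancl_mono_mem)
  qed
  moreover have "?C1 \<subseteq> A" "?C2 \<subseteq> A" using B(1,2) B2 A by auto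
  moreover have "?C1 \<subseteq> V \<times> V" "?C2 \<subseteq> V \<times> V" using B(1,2) V by auto
  moreover have "?C1 \<inter> ?C2 = {}" using B(1-3) A(5,6) ne by auto
  ultimately show ?thesis by (intro goodI)
qed

lemma strong_on_converse: "strong_on V (R\<inverse>) \<longleftrightarrow> strong_on V R"
  by (auto simp: strong_on_def rtrancl_converse)

lemma good_converse_imp:
  assumes "good V A"
  shows "good V (A\<inverse>)"
proof -
  obtain A1 A2 where A: "A1 \<subseteq> A" "A1 \<subseteq> V \<times> V" "A2 \<subseteq> A" "A2 \<subseteq> V \<times> V" "A1 \<inter> A2 = {}"
    "strong_on V A1" "strong_on V A2" using assms by (rule goodE)
  have "A1\<inverse> \<inter> A2\<inverse> = {}" using A(5) by auto
  moreover have "A1\<inverse> \<subseteq> A\<inverse>" "A2\<inverse> \<subseteq> A\<inverse>" "A1\<inverse> \<subseteq> V \<times> V" "A2\<inverse> \<subseteq> V \<times> V" using A(1-4) by auto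
  ultimately show ?thesis using A(6,7) by (intro goodI[of "A1\<inverse>" _ _ "A2\<inverse>"]) (simp_all add: strong_on_converse)
qed

lemma good_converse: "good V (A\<inverse>) \<longleftrightarrow> good V A"
  using good_converse_imp[of V A] good_converse_imp[of V "A\<inverse>"] by auto

lemma semicomp_converse: "semicomp V (A\<inverse>) \<longleftrightarrow> semicomp V A"
  unfolding semicomp_def irrefl_def by auto

lemma leaving_converse: "A \<subseteq> V \<times> V \<Longrightarrow> Z \<subseteq> V \<Longrightarrow> leaving (A\<inverse>) Z = (leaving A (V - Z))\<inverse>"
  unfolding leaving_def by auto

lemma two_arc_strong_converse:
  assumes "two_arc_strong V A"
  shows "two_arc_strong V (A\<inverse>)"
  unfolding two_arc_strong_def
proof (intro allI impI notI)
  fix Z and e :: "'a \<times> 'a" assume Z: "Z \<subset> V" "Z \<noteq> {}" and sub: "leaving (A\<inverse> \<inter> V \<times> V) Z \<subseteq> {e}"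
  have "leaving (A \<inter> V \<times> V) (V - Z) \<subseteq> {prod.swap e}"
    using sub Z by (cases e) (auto simp: leaving_def)
  then show False using assms Z unfolding two_arc_strong_def by (metis Diff_eq_empty_iff Diff_subset double_diff psubsetE psubsetI subset_refl)
qed

lemma decomposable_upto_mono: "decomposable_upto TYPE('a) m \<Longrightarrow> k \<le> m \<Longrightarrow> decomposable_upto TYPE('a) k"
  unfolding decomposable_upto_def by (meson order_trans)

text \<open>In S4 each vertex lacks the in-arc from its predecessor on the deleted cycle.\<close>

lemma not_is_S4_if_dominated:
  assumes "p \<in> V" "\<And>x. x \<in> V \<Longrightarrow> x \<noteq> p \<Longrightarrow> (x, p) \<in> A"
  shows "\<not> is_S4 V A"
proof
  assume "is_S4 V A"
  then obtain a b c d where "V = {a, b, c, d}" and d: "distinct [a, b, c, d]"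
    and A: "A = {(a, c), (c, a), (b, d), (d, b), (b, a), (c, b), (d, c), (a, d)}"
    unfolding is_S4_def by blast
  then consider "p = a" "(d, p) \<in> A" | "p = b" "(a, p) \<in> A" | "p = c" "(b, p) \<in> A" | "p = d" "(c, p) \<in> A"
    using assms by auto
  then show False by cases (use d in \<open>auto simp: A\<close>)
qed

text \<open>A walk from \<open>p\<close> may be cut at its last visit to \<open>p\<close>.\<close>

lemma rtrancl_avoid_source:
  assumes "(p, x) \<in> R\<^sup>*"
  shows "(p, x) \<in> {(a, b) \<in> R. b \<noteq> p}\<^sup>*"
  using assms
proof induction
  case (step y z)
  then show ?case by (cases "z = p") (auto intro: rtrancl_into_rtrancl)
qed simp

lemma two_arc_strongD:
  assumes "two_arc_strong V A" "Z \<subset> V" "Z \<noteq> {}"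
  obtains a b where "(a, b) \<in> A" "a \<in> Z" "b \<in> V - Z" "(a, b) \<noteq> e"
proof -
  have "\<not> leaving (A \<inter> V \<times> V) Z \<subseteq> {e}" using assms unfolding two_arc_strong_def by blast
  then obtain f where "f \<in> leaving (A \<inter> V \<times> V) Z" "f \<noteq> e" by blast
  then show ?thesis using that by (cases f) (auto simp: leaving_def)
qed

lemma two_arc_strongI:
  assumes "\<And>Z e. Z \<subset> V \<Longrightarrow> Z \<noteq> {} \<Longrightarrow> \<exists>a b. (a, b) \<in> A \<and> a \<in> Z \<and> b \<in> V - Z \<and> (a, b) \<noteq> e"
  shows "two_arc_strong V A"
  unfolding two_arc_strong_def
proof (intro allI impI notI)
  fix Z and e :: "'a \<times> 'a" assume Z: "Z \<subset> V" "Z \<noteq> {}" and sub: "leaving (A \<inter> V \<times> V) Z \<subseteq> {e}"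
  obtain a b where ab: "(a, b) \<in> A" "a \<in> Z" "b \<in> V - Z" "(a, b) \<noteq> e" using assms[OF Z] by blast
  then have "(a, b) \<in> leaving (A \<inter> V \<times> V) Z" using Z by (auto simp: leaving_def)
  then show False using sub ab by blast
qed

section \<open>Arc-disjoint branchings\<close>

definition two_branchings :: "'a rel \<Rightarrow> 'a \<Rightarrow> 'a set \<Rightarrow> bool" where
  "two_branchings A p X \<longleftrightarrow> (\<exists>J1 J2. J1 \<subseteq> A \<and> J2 \<subseteq> A \<and> J1 \<subseteq> insert p X \<times> X \<and>
     J2 \<subseteq> insert p X \<times> X \<and> J1 \<inter> J2 = {} \<and> X \<subseteq> J1\<^sup>* `` {p} \<and> X \<subseteq> J2\<^sup>* `` {p})"

lemma two_branchingsE: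
  assumes "two_branchings A p X"
  obtains J1 J2 where "J1 \<subseteq> A" "J2 \<subseteq> A" "J1 \<subseteq> insert p X \<times> X" "J2 \<subseteq> insert p X \<times> X" "J1 \<inter> J2 = {}"
    "X \<subseteq> J1\<^sup>* `` {p}" "X \<subseteq> J2\<^sup>* `` {p}"
  using assms unfolding two_branchings_def by (elim exE conjE) (rule that)

text \<open>With all arcs from \<open>X\<close> to \<open>p\<close> added, the digraph is
  semicomplete and not S4, and each half of a good decomposition contains a branching from
  \<open>p\<close>. The added arcs yield 2-arc-strength unless some vertex of \<open>X\<close> has
  no out-neighbour in \<open>X\<close>; such a vertex is peeled off first.\<close>

lemma two_out_branchings:
  fixes A :: "'a rel"
  assumes "finite X" "p \<notin> X" "irrefl A"
    and "\<And>u v. u \<in> X \<Longrightarrow> v \<in> X \<Longrightarrow> u \<noteq> v \<Longrightarrow> (u, v) \<in> A \<or> (v, u) \<in> A"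
    and "\<And>Z e. Z \<subseteq> X \<Longrightarrow> Z \<noteq> {} \<Longrightarrow> \<exists>a b. (a, b) \<in> A \<and> a \<in> insert p X - Z \<and> b \<in> Z \<and> (a, b) \<noteq> e"
    and "decomposable_upto TYPE('a) (card X + 1)"
  shows "two_branchings A p X"
  using assms
proof (induction "card X" arbitrary: X rule: less_induct)
  case less
  note fin = less.prems(1) and p = less.prems(2) and irr = less.prems(3) and sc = less.prems(4)
    and ct = less.prems(5) and dec = less.prems(6)
  show ?case
  proof (cases "\<exists>z \<in> X. \<forall>x \<in> X. (z, x) \<notin> A")
    case True
    then obtain z where z: "z \<in> X" "\<And>x. x \<in> X \<Longrightarrow> (z, x) \<notin> A" by blast
    let ?X = "X - {z}"
    have lt: "card ?X < card X" using z(1) fin by (meson card_Diff1_less)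
    have "two_branchings A p ?X"
    proof (rule less.hyps[OF lt])
      show "decomposable_upto TYPE('a) (card ?X + 1)" by (rule decomposable_upto_mono[OF dec]) (use lt in simp)
      fix Z and e :: "'a \<times> 'a" assume Z: "Z \<subseteq> ?X" "Z \<noteq> {}"
      have "Z \<subseteq> X" using Z by auto
      from ct[OF this Z(2), of e] obtain a b where
        ab: "(a, b) \<in> A" "a \<in> insert p X - Z" "b \<in> Z" "(a, b) \<noteq> e" by blast
      then have "a \<noteq> z" using z(2) Z(1) by auto
      then show "\<exists>a b. (a, b) \<in> A \<and> a \<in> insert p ?X - Z \<and> b \<in> Z \<and> (a, b) \<noteq> e" using ab by blast
    qed (use fin p irr sc in auto)
    then obtain J1 J2 where J: "J1 \<subseteq> A" "J2 \<subseteq> A" "J1 \<subseteq> insert p ?X \<times> ?X" "J2 \<subseteq> insert p ?X \<times> ?X" "J1 \<inter> J2 = {}"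
      and r': "?X \<subseteq> J1\<^sup>* `` {p}" "?X \<subseteq> J2\<^sup>* `` {p}" by (rule two_branchingsE)
    have r: "\<And>x. x \<in> ?X \<Longrightarrow> (p, x) \<in> J1\<^sup>*" "\<And>x. x \<in> ?X \<Longrightarrow> (p, x) \<in> J2\<^sup>*" using r' by auto
    \<comment> \<open>Without arcs into \<open>X\<close>, \<open>z\<close> is a leaf of both
      branchings and takes one of two different in-neighbours in each.\<close>
    obtain a where a: "(a, z) \<in> A" "a \<in> insert p ?X" using ct[of "{z}" "(z, z)"] z(1) by auto
    obtain c where c: "(c, z) \<in> A" "c \<in> insert p ?X" "c \<noteq> a" using ct[of "{z}" "(a, z)"] z(1) by auto
    let ?J1 = "insert (a, z) J1" and ?J2 = "insert (c, z) J2"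
    have "(p, x) \<in> ?J1\<^sup>*" if "x \<in> X" for x
    proof (cases "x = z")
      case True
      have "(p, a) \<in> J1\<^sup>*" using a r(1) by auto
      then have "(p, a) \<in> ?J1\<^sup>*" by (rule rtrancl_mono_mem) blast
      then show ?thesis using True by (auto intro: rtrancl_into_rtrancl)
    qed (use that r(1) in \<open>auto intro: rtrancl_mono_mem\<close>)
    moreover have "(p, x) \<in> ?J2\<^sup>*" if "x \<in> X" for x
    proof (cases "x = z")
      case True
      have "(p, c) \<in> J2\<^sup>*" using c r(2) by auto
      then have "(p, c) \<in> ?J2\<^sup>*" by (rule rtrancl_mono_mem) blast
      then show ?thesis using True by (auto intro: rtrancl_into_rtrancl)
    qed (use that r(2) in \<open>auto intro: rtrancl_mono_mem\<close>)
    moreover have "?J1 \<inter> ?J2 = {}" using J(3-5) c(3) by auto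
    moreover have "?J1 \<subseteq> insert p X \<times> X" "?J2 \<subseteq> insert p X \<times> X" using J(3,4) a c z(1) by auto
    ultimately show ?thesis using J(1,2) a(1) c(1) unfolding two_branchings_def
      by (intro exI[of _ ?J1] exI[of _ ?J2]) auto
  next
    case False
    let ?V = "insert p X" and ?D = "(A \<inter> insert p X \<times> X) \<union> X \<times> {p}"
    have "semicomp ?V ?D" unfolding semicomp_def using fin p irr sc by (auto simp: irrefl_def)
    moreover have "two_arc_strong ?V ?D"
    proof (rule two_arc_strongI)
      fix Z and e :: "'a \<times> 'a" assume Z: "Z \<subset> ?V" "Z \<noteq> {}"
      show "\<exists>a b. (a, b) \<in> ?D \<and> a \<in> Z \<and> b \<in> ?V - Z \<and> (a, b) \<noteq> e"
      proof (cases "p \<in> Z")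
        case True
        have "?V - Z \<subseteq> X" "?V - Z \<noteq> {}" using True Z by auto
        then obtain a b where "(a, b) \<in> A" "a \<in> ?V - (?V - Z)" "b \<in> ?V - Z" "(a, b) \<noteq> e"
          using ct[of "?V - Z" e] by blast
        then show ?thesis using True by (intro exI[of _ a] exI[of _ b]) auto
      next
        case pZ: False
        \<comment> \<open>The arc \<open>(z, p)\<close> leaves \<open>Z\<close>. If it is the
          excluded one, the out-neighbour \<open>x\<close> of \<open>z\<close> gives another:
          \<open>(x, p)\<close> when \<open>x\<close> is in \<open>Z\<close>, and
          \<open>(z, x)\<close> otherwise.\<close>
        obtain z where z: "z \<in> Z" using Z by blast
        have zX: "z \<in> X" "Z \<subseteq> X" using z Z pZ by auto
        obtain x where x: "x \<in> X" "(z, x) \<in> A" using zX False by blast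
        have "x \<noteq> z" using x irr by (auto simp: irrefl_def)
        show ?thesis
        proof (cases "(z, p) = e")
          case True
          show ?thesis
          proof (cases "x \<in> Z")
            case True
            then show ?thesis using \<open>x \<noteq> z\<close> \<open>(z, p) = e\<close> zX pZ by (intro exI[of _ x] exI[of _ p]) auto
          next
            case False
            then show ?thesis using True x zX z p by (intro exI[of _ z] exI[of _ x]) auto
          qed
        qed (use z zX pZ in blast)
      qed
    qed
    moreover have "\<not> is_S4 ?V ?D" by (rule not_is_S4_if_dominated[of p]) auto
    moreover have "card ?V \<le> card X + 1" using fin p by simp
    ultimately have "good ?V ?D" using dec unfolding decomposable_upto_def by blast
    then obtain A1 A2 where B: "A1 \<subseteq> ?D" "A1 \<subseteq> ?V \<times> ?V" "A2 \<subseteq> ?D" "A2 \<subseteq> ?V \<times> ?V" "A1 \<inter> A2 = {}"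
      "strong_on ?V A1" "strong_on ?V A2" by (rule goodE)
    let ?J1 = "{(a, b) \<in> A1. b \<noteq> p}" and ?J2 = "{(a, b) \<in> A2. b \<noteq> p}"
    have "?J1 \<subseteq> A" "?J2 \<subseteq> A" "?J1 \<subseteq> ?V \<times> X" "?J2 \<subseteq> ?V \<times> X" "?J1 \<inter> ?J2 = {}"
      using B(1,3,5) by auto
    moreover have "(p, x) \<in> ?J1\<^sup>*" "(p, x) \<in> ?J2\<^sup>*" if "x \<in> X" for x
      by (rule rtrancl_avoid_source; use B(6,7) that in \<open>auto simp: strong_on_def\<close>)+
    ultimately show ?thesis unfolding two_branchings_def by (intro exI[of _ ?J1] exI[of _ ?J2]) auto
  qed
qed

text \<open>Each half runs in a circle from \<open>X\<close> to \<open>Y\<close> to \<open>p\<close>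
  to \<open>X\<close>: an in-branching of \<open>Y\<close> into \<open>p\<close>, an out-branching
  from \<open>p\<close> over \<open>X\<close>, and a share of the arcs from \<open>X\<close> to
  \<open>Y\<close>, all of which are present by semicompleteness. As nothing goes from
  \<open>Y\<close> to \<open>X\<close>, arcs entering a subset of \<open>X\<close> from outside come
  from \<open>X\<close> or \<open>p\<close>, so the cut condition is inherited.\<close>

lemma good_cut_vertex:
  fixes A :: "'a rel"
  assumes sc: "semicomp V A" and ts: "two_arc_strong V A" and dec: "decomposable_upto TYPE('a) (card V - 1)"
    and V: "V = insert p (Y \<union> X)" "p \<notin> Y" "p \<notin> X" "Y \<inter> X = {}"
    and y: "y1 \<in> Y" "y2 \<in> Y" "y1 \<noteq> y2" and x: "x1 \<in> X" "x2 \<in> X" "x1 \<noteq> x2"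
    and none: "\<And>y x. y \<in> Y \<Longrightarrow> x \<in> X \<Longrightarrow> (y, x) \<notin> A"
  shows "good V A"
proof -
  have fin: "finite V" "finite X" "finite Y" and irr: "irrefl A" and AV: "A \<subseteq> V \<times> V"
    using sc V unfolding semicomp_def by auto
  note adj = semicompD(4)[OF sc]
  have bk: "(v, u) \<in> A" if "u \<in> Y" "v \<in> X" for u v
    using adj[of u v] none[of u v] that V by auto
  have cV: "card V = card X + card Y + 1" using fin V by (subst V(1)) (simp add: card_Un_disjoint Int_commute)
  have "card X > 0" "card Y > 0" using fin x y card_gt_0_iff by blast+
  then have cX: "card X + 1 \<le> card V - 1" "card Y + 1 \<le> card V - 1" using cV by auto
  have "two_branchings A p X"
  proof (rule two_out_branchings[OF fin(2) V(3) irr])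
    show "decomposable_upto TYPE('a) (card X + 1)" by (rule decomposable_upto_mono[OF dec cX(1)])
    fix Z and e :: "'a \<times> 'a" assume Z: "Z \<subseteq> X" "Z \<noteq> {}"
    have "V - Z \<subset> V" "V - Z \<noteq> {}" using Z V by auto
    then obtain a b where ab: "(a, b) \<in> A" "a \<in> V - Z" "b \<in> V - (V - Z)" "(a, b) \<noteq> e"
      by (rule two_arc_strongD[OF ts])
    then have "b \<in> Z" "a \<notin> Y" using none Z by auto
    then show "\<exists>a b. (a, b) \<in> A \<and> a \<in> insert p X - Z \<and> b \<in> Z \<and> (a, b) \<noteq> e" using ab V by auto
  qed (use adj V in auto)
  then obtain J1 J2 where J: "J1 \<subseteq> A" "J2 \<subseteq> A" "J1 \<subseteq> insert p X \<times> X" "J2 \<subseteq> insert p X \<times> X" "J1 \<inter> J2 = {}"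
    and rJ': "X \<subseteq> J1\<^sup>* `` {p}" "X \<subseteq> J2\<^sup>* `` {p}" by (rule two_branchingsE)
  have rJ: "\<And>x. x \<in> X \<Longrightarrow> (p, x) \<in> J1\<^sup>*" "\<And>x. x \<in> X \<Longrightarrow> (p, x) \<in> J2\<^sup>*" using rJ' by auto
  have "two_branchings (A\<inverse>) p Y"
  proof (rule two_out_branchings[OF fin(3) V(2)])
    show "irrefl (A\<inverse>)" using irr by (auto simp: irrefl_def)
    show "decomposable_upto TYPE('a) (card Y + 1)" by (rule decomposable_upto_mono[OF dec cX(2)])
    fix Z and e :: "'a \<times> 'a" assume Z: "Z \<subseteq> Y" "Z \<noteq> {}"
    have "Z \<subset> V" using Z V by auto
    then obtain a b where ab: "(a, b) \<in> A" "a \<in> Z" "b \<in> V - Z" "(a, b) \<noteq> prod.swap e"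
      using two_arc_strongD[OF ts _ Z(2)] by metis
    then have "b \<notin> X" "(b, a) \<noteq> e" using none Z by auto
    then show "\<exists>a b. (a, b) \<in> A\<inverse> \<and> a \<in> insert p Y - Z \<and> b \<in> Z \<and> (a, b) \<noteq> e" using ab V by auto
  qed (use adj V in auto)
  then obtain I1 I2 where I: "I1 \<subseteq> A\<inverse>" "I2 \<subseteq> A\<inverse>" "I1 \<subseteq> insert p Y \<times> Y" "I2 \<subseteq> insert p Y \<times> Y" "I1 \<inter> I2 = {}"
    and rI': "Y \<subseteq> I1\<^sup>* `` {p}" "Y \<subseteq> I2\<^sup>* `` {p}" by (rule two_branchingsE)
  have rI: "\<And>x. x \<in> Y \<Longrightarrow> (p, x) \<in> I1\<^sup>*" "\<And>x. x \<in> Y \<Longrightarrow> (p, x) \<in> I2\<^sup>*" using rI' by auto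
  \<comment> \<open>The arcs from \<open>X\<close> to \<open>Y\<close> are divided by the parity of
    the tests \<open>x = x1\<close> and \<open>y = y1\<close>. With two vertices on either side,
    every row and every column meets both classes.\<close>
  define K where "K = (\<lambda>c. {(x, y). x \<in> X \<and> y \<in> Y \<and> ((x = x1) \<noteq> (y = y1)) = c})"
  have Kout: "\<exists>y \<in> Y. (x', y) \<in> K c" if "x' \<in> X" for x' c
    using that y by (cases "x' = x1"; cases c) (auto simp: K_def)
  have Kin: "\<exists>x \<in> X. (x, y') \<in> K c" if "y' \<in> Y" for y' c
    using that x by (cases "y' = y1"; cases c) (auto simp: K_def)
  have strong: "strong_on V (J \<union> I\<inverse> \<union> K c)"
    if rJ: "\<And>x. x \<in> X \<Longrightarrow> (p, x) \<in> J\<^sup>*" and rI: "\<And>x. x \<in> Y \<Longrightarrow> (p, x) \<in> I\<^sup>*" for J I c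
  proof (rule strong_onI[where p = p])
    let ?R = "J \<union> I\<inverse> \<union> K c"
    have pX: "(p, x) \<in> ?R\<^sup>*" if "x \<in> X" for x by (rule rtrancl_mono_mem[OF rJ[OF that]]) blast
    have Yp: "(y, p) \<in> ?R\<^sup>*" if "y \<in> Y" for y
    proof -
      have "(y, p) \<in> (I\<inverse>)\<^sup>*" using rI[OF that] by (simp add: rtrancl_converse)
      then show ?thesis by (rule rtrancl_mono_mem) blast
    qed
    fix v assume "v \<in> V"
    then consider "v = p" | "v \<in> X" | "v \<in> Y" using V(1) by blast
    then have "(p, v) \<in> ?R\<^sup>* \<and> (v, p) \<in> ?R\<^sup>*"
    proof cases
      case 2
      then obtain y where "y \<in> Y" "(v, y) \<in> ?R" using Kout[of v c] by blast
      then show ?thesis using pX[OF 2] Yp by (meson converse_rtrancl_into_rtrancl)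
    next
      case 3
      then obtain x where "x \<in> X" "(x, v) \<in> ?R" using Kin[of v c] by blast
      then show ?thesis using Yp[OF 3] pX by (meson rtrancl_into_rtrancl)
    qed simp
    then show "(p, v) \<in> ?R\<^sup>*" "(v, p) \<in> ?R\<^sup>*" by auto
  qed
  let ?A1 = "J1 \<union> I1\<inverse> \<union> K True" and ?A2 = "J2 \<union> I2\<inverse> \<union> K False"
  have KA: "K c \<subseteq> A" for c unfolding K_def using bk by auto
  show ?thesis
  proof (rule goodI)
    show "strong_on V ?A1" "strong_on V ?A2" using strong rJ rI by blast+
    show sub: "?A1 \<subseteq> A" "?A2 \<subseteq> A" using J I KA by auto
    show "?A1 \<subseteq> V \<times> V" "?A2 \<subseteq> V \<times> V" using sub AV by auto
    have JK: "J1 \<inter> K c = {}" "J2 \<inter> K c = {}" "I1\<inverse> \<inter> K c = {}" "I2\<inverse> \<inter> K c = {}" for c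
      using J(3,4) I(3,4) V unfolding K_def by auto
    have "J1 \<subseteq> V \<times> X" "J2 \<subseteq> V \<times> X" "I1\<inverse> \<subseteq> Y \<times> insert p Y" "I2\<inverse> \<subseteq> Y \<times> insert p Y" "X \<inter> insert p Y = {}"
      using J(3,4) I(3,4) V by auto
    then have "J1 \<inter> I2\<inverse> = {}" "J2 \<inter> I1\<inverse> = {}" by blast+
    moreover have "I1\<inverse> \<inter> I2\<inverse> = {}" using I(5) by auto
    moreover have "K True \<inter> K False = {}" unfolding K_def by auto
    ultimately show "?A1 \<inter> ?A2 = {}" using J(5) JK by (auto simp: Int_Un_distrib Int_Un_distrib2 Int_commute)
  qed
qed

lemma rtrancl_from_unique_successor:
  assumes "(p, x) \<in> R\<^sup>*" "x \<noteq> p" "\<And>b. (p, b) \<in> R \<Longrightarrow> b = y" "\<And>a. (a, p) \<notin> R"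
  shows "(y, x) \<in> {(a, b) \<in> R. a \<noteq> p \<and> b \<noteq> p}\<^sup>*"
  using assms(1,2)
proof induction
  case (step u v)
  then show ?case using assms(3,4) by (cases "u = p") (auto intro: rtrancl_into_rtrancl)
qed simp

text \<open>The contracted side becomes a root \<open>p\<close> with just two arcs, to
  \<open>y1\<close> and \<open>y2\<close>. Both branchings have to leave \<open>p\<close>, so each
  owns exactly one of these arcs, and deleting \<open>p\<close> leaves branchings rooted at
  \<open>y1\<close> and \<open>y2\<close>.\<close>

lemma two_branchings_two_roots:
  fixes A :: "'a rel"
  assumes fin: "finite X" and p: "p \<notin> X" and irr: "irrefl A"
    and adj: "\<And>u v. u \<in> X \<Longrightarrow> v \<in> X \<Longrightarrow> u \<noteq> v \<Longrightarrow> (u, v) \<in> A \<or> (v, u) \<in> A"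
    and y: "y1 \<in> X" "y2 \<in> X" "y1 \<noteq> y2"
    and ct: "\<And>Z e. Z \<subseteq> X \<Longrightarrow> Z \<noteq> {} \<Longrightarrow>
      \<exists>a b. ((a, b) \<in> A \<and> a \<in> X - Z \<or> a = p \<and> (b = y1 \<or> b = y2)) \<and> b \<in> Z \<and> (a, b) \<noteq> e"
    and dec: "decomposable_upto TYPE('a) (card X + 1)"
  obtains J1 J2 where "J1 \<subseteq> A" "J2 \<subseteq> A" "J1 \<subseteq> X \<times> X" "J2 \<subseteq> X \<times> X" "J1 \<inter> J2 = {}"
    "X \<subseteq> J1\<^sup>* `` {y1}" "X \<subseteq> J2\<^sup>* `` {y2}"
proof -
  note witness = that
  let ?D = "(A \<inter> X \<times> X) \<union> {(p, y1), (p, y2)}"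
  have "two_branchings ?D p X"
  proof (rule two_out_branchings[OF fin p])
    show "irrefl ?D" using irr p y by (auto simp: irrefl_def)
    fix Z and e :: "'a \<times> 'a" assume Z: "Z \<subseteq> X" "Z \<noteq> {}"
    obtain a b where ab: "(a, b) \<in> A \<and> a \<in> X - Z \<or> a = p \<and> (b = y1 \<or> b = y2)" "b \<in> Z" "(a, b) \<noteq> e"
      using ct[OF Z, of e] by blast
    then show "\<exists>a b. (a, b) \<in> ?D \<and> a \<in> insert p X - Z \<and> b \<in> Z \<and> (a, b) \<noteq> e"
      using Z p by (intro exI[of _ a] exI[of _ b]) auto
  qed (use adj dec in auto)
  then obtain K1 K2 where K: "K1 \<subseteq> ?D" "K2 \<subseteq> ?D" "K1 \<subseteq> insert p X \<times> X" "K2 \<subseteq> insert p X \<times> X" "K1 \<inter> K2 = {}"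
    and r: "X \<subseteq> K1\<^sup>* `` {p}" "X \<subseteq> K2\<^sup>* `` {p}" by (rule two_branchingsE)
  have ex: "(p, y1) \<in> K \<or> (p, y2) \<in> K" if "K \<subseteq> ?D" "X \<subseteq> K\<^sup>* `` {p}" for K
  proof -
    have "(p, y1) \<in> K\<^sup>*" "y1 \<noteq> p" using that y p by auto
    then obtain b where "(p, b) \<in> K" by (metis converse_rtranclE)
    then show ?thesis using that(1) p by auto
  qed
  have root: "X \<subseteq> (K \<inter> X \<times> X)\<^sup>* `` {y}"
    if "K \<subseteq> ?D" "K \<subseteq> insert p X \<times> X" "X \<subseteq> K\<^sup>* `` {p}" "\<And>b. (p, b) \<in> K \<Longrightarrow> b = y" for K y
  proof
    fix x assume x: "x \<in> X"
    have "(y, x) \<in> {(a, b) \<in> K. a \<noteq> p \<and> b \<noteq> p}\<^sup>*"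
      by (rule rtrancl_from_unique_successor) (use that x p in auto)
    then have "(y, x) \<in> (K \<inter> X \<times> X)\<^sup>*" by (rule rtrancl_mono_mem) (use that(2) in auto)
    then show "x \<in> (K \<inter> X \<times> X)\<^sup>* `` {y}" by simp
  qed
  have fin: thesis if L: "L1 \<subseteq> ?D" "L2 \<subseteq> ?D" "L1 \<subseteq> insert p X \<times> X" "L2 \<subseteq> insert p X \<times> X" "L1 \<inter> L2 = {}"
    "X \<subseteq> L1\<^sup>* `` {p}" "X \<subseteq> L2\<^sup>* `` {p}" and y12: "(p, y1) \<in> L1" "(p, y2) \<in> L2" for L1 L2
  proof -
    have "b = y1" if "(p, b) \<in> L1" for b using that L y12 p by auto
    moreover have "b = y2" if "(p, b) \<in> L2" for b using that L y12 p by auto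
    ultimately have "X \<subseteq> (L1 \<inter> X \<times> X)\<^sup>* `` {y1}" "X \<subseteq> (L2 \<inter> X \<times> X)\<^sup>* `` {y2}" using root L by simp_all
    then show thesis by (rule witness[rotated 5]) (use L p in auto)
  qed
  show thesis
  proof (cases "(p, y1) \<in> K1")
    case True
    then have "(p, y2) \<in> K2" using ex[OF K(2) r(2)] K(5) by auto
    then show thesis using fin[of K1 K2] K r True by simp
  next
    case False
    then have "(p, y2) \<in> K1" using ex[OF K(1) r(1)] by auto
    then have "(p, y1) \<in> K2" using ex[OF K(2) r(2)] K(5) by auto
    then show thesis using fin[of K2 K1] K r \<open>(p, y2) \<in> K1\<close> by (simp add: Int_commute)
  qed
qed

text \<open>The first half gathers \<open>S\<close> into \<open>x1\<close>, crosses by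
  \<open>(x1, y1)\<close>, spreads over \<open>S'\<close> and returns along \<open>K1\<close>; the
  second does the same with index 2. The reversals of the two crossing arcs may be absent, so
  \<open>K1\<close> and \<open>K2\<close> avoid them.\<close>

lemma good_glue:
  assumes V: "V = S \<union> S'" "S \<inter> S' = {}" and AV: "A \<subseteq> V \<times> V"
    and J: "J1 \<subseteq> A" "J2 \<subseteq> A" "J1 \<subseteq> S \<times> S" "J2 \<subseteq> S \<times> S" "J1 \<inter> J2 = {}"
    and rJ: "\<And>x. x \<in> S \<Longrightarrow> (x, x1) \<in> J1\<^sup>*" "\<And>x. x \<in> S \<Longrightarrow> (x, x2) \<in> J2\<^sup>*"
    and G: "G1 \<subseteq> A" "G2 \<subseteq> A" "G1 \<subseteq> S' \<times> S'" "G2 \<subseteq> S' \<times> S'" "G1 \<inter> G2 = {}"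
    and rG: "\<And>y. y \<in> S' \<Longrightarrow> (y1, y) \<in> G1\<^sup>*" "\<And>y. y \<in> S' \<Longrightarrow> (y2, y) \<in> G2\<^sup>*"
    and x: "x1 \<in> S" "x2 \<in> S" "x1 \<noteq> x2" and y: "y1 \<in> S'" "y2 \<in> S'" "y1 \<noteq> y2"
    and xy: "(x1, y1) \<in> A" "(x2, y2) \<in> A" and z0: "z0 \<in> S'" "z0 \<noteq> y1" "z0 \<noteq> y2"
    and bk: "\<And>y x. y \<in> S' \<Longrightarrow> x \<in> S \<Longrightarrow> (y, x) \<noteq> (y1, x1) \<Longrightarrow> (y, x) \<noteq> (y2, x2) \<Longrightarrow> (y, x) \<in> A"
  shows "good V A"
proof -
  \<comment> \<open>The root \<open>y1\<close> of the first half sends no arc of \<open>K1\<close>,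
    and \<open>y2\<close> none of \<open>K2\<close>. In the first half \<open>y2\<close> serves all
    of \<open>S\<close> except \<open>x2\<close>, in the second \<open>y1\<close> serves all except
    \<open>x1\<close>; the two remaining in-arcs come from \<open>z0\<close>.\<close>
  define K1 where "K1 = {(y, v). y \<in> S' \<and> v \<in> S \<and> y \<noteq> y1 \<and> (if y = y2 then v \<noteq> x2 else v \<noteq> x1)}"
  define K2 where "K2 = {(y, v). y \<in> S' \<and> v \<in> S \<and> y \<noteq> y2 \<and> (if y = y1 then v \<noteq> x1 else v = x1)}"
  have K: "K1 \<subseteq> A" "K2 \<subseteq> A" "K1 \<subseteq> S' \<times> S" "K2 \<subseteq> S' \<times> S" "K1 \<inter> K2 = {}"
    unfolding K1_def K2_def using bk y by (auto split: if_splits)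
  have strong: "strong_on V (J \<union> G \<union> K \<union> {(a, r)})"
    if rJ: "\<And>x. x \<in> S \<Longrightarrow> (x, a) \<in> J\<^sup>*" and rG: "\<And>y. y \<in> S' \<Longrightarrow> (r, y) \<in> G\<^sup>*"
      and Ko: "\<And>y. y \<in> S' \<Longrightarrow> y \<noteq> r \<Longrightarrow> \<exists>x \<in> S. (y, x) \<in> K" and Ki: "\<And>x. x \<in> S \<Longrightarrow> \<exists>y \<in> S'. (y, x) \<in> K"
      and r: "r \<in> S'" for J G K a r
  proof (rule strong_onI[where p = r])
    let ?R = "J \<union> G \<union> K \<union> {(a, r)}"
    have out: "(r, y) \<in> ?R\<^sup>*" if "y \<in> S'" for y by (rule rtrancl_mono_mem[OF rG[OF that]]) blast
    have Sr: "(x, r) \<in> ?R\<^sup>*" if "x \<in> S" for x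
      by (rule rtrancl_into_rtrancl[OF rtrancl_mono_mem[OF rJ[OF that]]]) auto
    fix v assume "v \<in> V"
    then consider "v \<in> S" | "v = r" | "v \<in> S'" "v \<noteq> r" using V by auto
    then have "(r, v) \<in> ?R\<^sup>* \<and> (v, r) \<in> ?R\<^sup>*"
    proof cases
      case 1
      then obtain y where "y \<in> S'" "(y, v) \<in> ?R" using Ki by blast
      then show ?thesis using out Sr[OF 1] by (meson rtrancl_into_rtrancl)
    next
      case 3
      then obtain x where "x \<in> S" "(v, x) \<in> ?R" using Ko by blast
      then show ?thesis using out[OF 3(1)] Sr by (meson converse_rtrancl_into_rtrancl)
    qed simp
    then show "(r, v) \<in> ?R\<^sup>*" "(v, r) \<in> ?R\<^sup>*" by auto
  qed
  let ?A1 = "J1 \<union> G1 \<union> K1 \<union> {(x1, y1)}" and ?A2 = "J2 \<union> G2 \<union> K2 \<union> {(x2, y2)}"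
  show ?thesis
  proof (rule goodI)
    show sub: "?A1 \<subseteq> A" "?A2 \<subseteq> A" using J G K xy by auto
    show "?A1 \<subseteq> V \<times> V" "?A2 \<subseteq> V \<times> V" using sub AV by auto
    show "strong_on V ?A1"
    proof (rule strong[OF rJ(1) rG(1) _ _ y(1)])
      fix y assume "y \<in> S'" "y \<noteq> y1"
      then show "\<exists>x \<in> S. (y, x) \<in> K1" using x unfolding K1_def by (cases "y = y2") auto
    next
      fix v assume v: "v \<in> S"
      show "\<exists>y \<in> S'. (y, v) \<in> K1"
      proof (cases "v = x2")
        case True
        then have "(z0, v) \<in> K1" using z0 x unfolding K1_def by auto
        then show ?thesis using z0 by blast
      next
        case False
        then have "(y2, v) \<in> K1" using v y unfolding K1_def by auto
        then show ?thesis using y by blast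
      qed
    qed
    show "strong_on V ?A2"
    proof (rule strong[OF rJ(2) rG(2) _ _ y(2)])
      fix y assume y': "y \<in> S'" "y \<noteq> y2"
      have "(y, if y = y1 then x2 else x1) \<in> K2" using y' x unfolding K2_def by auto
      then show "\<exists>x \<in> S. (y, x) \<in> K2" using x by (metis (full_types))
    next
      fix v assume v: "v \<in> S"
      have "(if v = x1 then z0 else y1, v) \<in> K2" using v z0 y unfolding K2_def by auto
      then show "\<exists>y \<in> S'. (y, v) \<in> K2" using z0 y by (metis (full_types))
    qed
    have "J1 \<inter> (G2 \<union> K2 \<union> {(x2, y2)}) = {}" "J2 \<inter> (G1 \<union> K1 \<union> {(x1, y1)}) = {}"
      using J(3,4) G(3,4) K(3,4) V(2) x y by blast+
    moreover have "G1 \<inter> (K2 \<union> {(x2, y2)}) = {}" "G2 \<inter> (K1 \<union> {(x1, y1)}) = {}"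
      using G(3,4) K(3,4) V(2) x y by blast+
    moreover have "K1 \<inter> {(x2, y2)} = {}" "K2 \<inter> {(x1, y1)} = {}" "(x1, y1) \<noteq> (x2, y2)"
      using K(3,4) V(2) x y by blast+
    ultimately show "?A1 \<inter> ?A2 = {}" using J(5) G(5) K(5)
      by (simp add: Int_Un_distrib Int_Un_distrib2 Int_commute)
  qed
qed

section \<open>Tight cuts\<close>

text \<open>If the two arcs of the cut share an endpoint, that endpoint is a cut vertex in the sense
  of \<open>good_cut_vertex\<close>. Otherwise both sides carry rooted branchings for
  \<open>good_glue\<close>, with a third vertex of \<open>V - S\<close> as its
  \<open>z0\<close>.\<close>

lemma good_tight_aux:
  fixes A :: "'a rel"
  assumes sc: "semicomp V A" and ts: "two_arc_strong V A" and dec: "decomposable_upto TYPE('a) (card V - 1)"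
    and S: "S \<subseteq> V" "2 \<le> card S" "3 \<le> card (V - S)" and tight: "leaving A S \<subseteq> {e, f}"
  shows "good V A"
proof -
  note fin = semicompD(1)[OF sc] and irr = semicompD(2)[OF sc] and AV = semicompD(3)[OF sc]
    and adj = semicompD(4)[OF sc]
  define S' where "S' = V - S"
  have V: "V = S \<union> S'" "S \<inter> S' = {}" using S(1) unfolding S'_def by auto
  have finS: "finite S" "finite S'" using fin V by auto
  have "S \<noteq> {}" "S' \<noteq> {}" using S unfolding S'_def by auto
  then have SV: "S \<subset> V" using V by auto
  have cV: "card V = card S + card S'" using V finS card_Un_disjoint by metis
  have VS: "V - S = S'" and cS': "3 \<le> card S'" using S(3) unfolding S'_def by auto
  obtain x1 y1 where a1: "(x1, y1) \<in> A" "x1 \<in> S" "y1 \<in> V - S" by (rule two_arc_strongD[OF ts SV \<open>S \<noteq> {}\<close>])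
  obtain x2 y2 where a2: "(x2, y2) \<in> A" "x2 \<in> S" "y2 \<in> V - S" "(x2, y2) \<noteq> (x1, y1)"
    by (rule two_arc_strongD[OF ts SV \<open>S \<noteq> {}\<close>])
  have "(x1, y1) \<in> leaving A S" "(x2, y2) \<in> leaving A S" using a1 a2 by (auto simp: leaving_def)
  then have ef: "{e, f} = {(x1, y1), (x2, y2)}" using tight a2(4) by auto
  have y: "y1 \<in> S'" "y2 \<in> S'" using a1(3) a2(3) VS by auto
  have only: "(a, b) = (x1, y1) \<or> (a, b) = (x2, y2)" if "(a, b) \<in> A" "a \<in> S" "b \<notin> S" for a b
  proof -
    have "(a, b) \<in> leaving A S" using that by (auto simp: leaving_def)
    then show ?thesis using tight ef by auto
  qed
  consider "x1 = x2" | "y1 = y2" | "x1 \<noteq> x2" "y1 \<noteq> y2" by blast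
  then show ?thesis
  proof cases
    case 1
    then have "y1 \<noteq> y2" using a2(4) by auto
    obtain u where u: "u \<in> S" "u \<noteq> x1" using S(2) finS
      by (metis card_le_Suc0_iff_eq not_less_eq_eq numeral_2_eq_2)
    \<comment> \<open>A second vertex of \<open>S - {x1}\<close>: \<open>u\<close> has an
      out-neighbour other than \<open>x1\<close>, and it lies in \<open>S\<close> because only
      \<open>x1\<close> sends arcs across.\<close>
    have "{u} \<subset> V" using u(1) SV a1(2) u(2) by auto
    then obtain a b where b: "(a, b) \<in> A" "a \<in> {u}" "b \<in> V - {u}" "(a, b) \<noteq> (u, x1)"
      by (rule two_arc_strongD[OF ts]) simp
    then have b: "(u, b) \<in> A" "b \<in> V" "b \<noteq> u" "b \<noteq> x1" by auto
    have "b \<in> S" using only[of u b] b u 1 by auto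
    show ?thesis
    proof (rule good_cut_vertex[OF sc ts dec, of x1 "S - {x1}" S' u b y1 y2])
      show "V = insert x1 (S - {x1} \<union> S')" using V(1) a1(2) by auto
      show "x1 \<notin> S'" "(S - {x1}) \<inter> S' = {}" using a1(2) V(2) by auto
      fix v w assume vw: "v \<in> S - {x1}" "w \<in> S'"
      then have "w \<notin> S" using V(2) by auto
      then show "(v, w) \<notin> A" using only[of v w] vw 1 by auto
    qed (use u b \<open>b \<in> S\<close> y \<open>y1 \<noteq> y2\<close> in auto)
  next
    case 2
    then have "x1 \<noteq> x2" using a2(4) by auto
    have "\<not> card S' \<le> Suc 0" using cS' by auto
    then obtain x where x: "x \<in> S'" "x \<noteq> y1" using finS(2) y(1) by (metis card_le_Suc0_iff_eq)
    have "V - {x} \<subset> V" "V - {x} \<noteq> {}" using x y V(1) by auto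
    then obtain a b where ab: "(a, b) \<in> A" "a \<in> V - {x}" "b \<in> V - (V - {x})" "(a, b) \<noteq> (y1, x)"
      by (rule two_arc_strongD[OF ts])
    then have a: "(a, x) \<in> A" "a \<noteq> x" "a \<in> V" "a \<noteq> y1" by auto
    have "x \<notin> S" using x V(2) by auto
    then have "a \<in> S'" using only[of a x] a x 2 V(1) by auto
    show ?thesis
    proof (rule good_cut_vertex[OF sc ts dec, of y1 S "S' - {y1}" x1 x2 x a])
      show "V = insert y1 (S \<union> (S' - {y1}))" using V(1) y(1) by auto
      show "y1 \<notin> S" "S \<inter> (S' - {y1}) = {}" using y V(2) by auto
      fix v w assume vw: "v \<in> S" "w \<in> S' - {y1}"
      then have "w \<notin> S" using V(2) by auto
      then show "(v, w) \<notin> A" using only[of v w] vw 2 by auto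
    qed (use a x \<open>a \<in> S'\<close> \<open>x1 \<noteq> x2\<close> a1 a2 in auto)
  next
    case 3
    have ne: "x1 \<notin> S'" "y1 \<notin> S" using a1 y V by auto
    have cS: "card S + 1 \<le> card V - 1" "card S' + 1 \<le> card V - 1" using S(2) cS' cV by auto
    obtain G1 G2 where G: "G1 \<subseteq> A" "G2 \<subseteq> A" "G1 \<subseteq> S' \<times> S'" "G2 \<subseteq> S' \<times> S'" "G1 \<inter> G2 = {}"
      "S' \<subseteq> G1\<^sup>* `` {y1}" "S' \<subseteq> G2\<^sup>* `` {y2}"
    proof (rule two_branchings_two_roots[OF finS(2) ne(1) irr _ y 3(2)])
      show "decomposable_upto TYPE('a) (card S' + 1)" by (rule decomposable_upto_mono[OF dec cS(2)])
      fix Z and e :: "'a \<times> 'a" assume Z: "Z \<subseteq> S'" "Z \<noteq> {}"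
      have VZ: "V - Z \<subset> V" "V - Z \<noteq> {}" using Z V(1) a1(2) ne(1) by auto
      \<comment> \<open>With \<open>S\<close> contracted to the root \<open>x1\<close>, the arc
        \<open>(x2, y2)\<close> appears as \<open>(x1, y2)\<close>; the excluded arc is translated
        back accordingly.\<close>
      obtain a b where ab: "(a, b) \<in> A" "a \<in> V - Z" "b \<in> V - (V - Z)"
        "(a, b) \<noteq> (if e = (x1, y1) then (x1, y1) else if e = (x1, y2) then (x2, y2) else e)"
        by (rule two_arc_strongD[OF ts VZ])
      have b: "b \<in> Z" "b \<in> S'" using ab Z by auto
      show "\<exists>a b. ((a, b) \<in> A \<and> a \<in> S' - Z \<or> a = x1 \<and> (b = y1 \<or> b = y2)) \<and> b \<in> Z \<and> (a, b) \<noteq> e"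
      proof (cases "a \<in> S")
        case True
        then have "(a, b) = (x1, y1) \<or> (a, b) = (x2, y2)" using only[OF ab(1) True] b(2) V(2) by auto
        then show ?thesis using b ab 3 by (intro exI[of _ x1] exI[of _ b]) (auto split: if_splits)
      next
        case False
        then have "a \<in> S'" using ab(2) V(1) by auto
        then show ?thesis using b ab ne by (intro exI[of _ a] exI[of _ b]) (auto split: if_splits)
      qed
    qed (use adj V in auto)
    obtain J1 J2 where J: "J1 \<subseteq> A\<inverse>" "J2 \<subseteq> A\<inverse>" "J1 \<subseteq> S \<times> S" "J2 \<subseteq> S \<times> S" "J1 \<inter> J2 = {}"
      "S \<subseteq> J1\<^sup>* `` {x1}" "S \<subseteq> J2\<^sup>* `` {x2}"
    proof (rule two_branchings_two_roots[OF finS(1) ne(2) _ _ a1(2) a2(2) 3(1)])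
      show "irrefl (A\<inverse>)" using irr by (auto simp: irrefl_def)
      show "decomposable_upto TYPE('a) (card S + 1)" by (rule decomposable_upto_mono[OF dec cS(1)])
      fix Z and e :: "'a \<times> 'a" assume Z: "Z \<subseteq> S" "Z \<noteq> {}"
      have VZ: "Z \<subset> V" using Z SV by auto
      obtain a b where ab: "(a, b) \<in> A" "a \<in> Z" "b \<in> V - Z"
        "(a, b) \<noteq> (if e = (y1, x1) then (x1, y1) else if e = (y1, x2) then (x2, y2) else prod.swap e)"
        by (rule two_arc_strongD[OF ts VZ Z(2)])
      show "\<exists>a b. ((a, b) \<in> A\<inverse> \<and> a \<in> S - Z \<or> a = y1 \<and> (b = x1 \<or> b = x2)) \<and> b \<in> Z \<and> (a, b) \<noteq> e"
      proof (cases "b \<in> S")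
        case True
        then show ?thesis using ab Z ne by (intro exI[of _ b] exI[of _ a]) (auto split: if_splits)
      next
        case False
        then have "(a, b) = (x1, y1) \<or> (a, b) = (x2, y2)" using only[OF ab(1) _ False] ab(2) Z(1) by auto
        then show ?thesis using ab(2,4) 3 by (intro exI[of _ y1] exI[of _ a]) (auto split: if_splits)
      qed
    qed (use adj V in auto)
    obtain z0 where z0: "z0 \<in> S'" "z0 \<notin> {y1, y2}"
    proof -
      have "\<not> S' \<subseteq> {y1, y2}"
      proof
        assume "S' \<subseteq> {y1, y2}"
        then have "card S' \<le> card {y1, y2}" by (intro card_mono) auto
        then show False using cS' 3(2) by auto
      qed
      then show thesis using that by blast
    qed
    show ?thesis
    proof (rule good_glue[of V S S' A "J1\<inverse>" "J2\<inverse>" x1 x2 G1 G2 y1 y2 z0, OF V AV])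
      show "J1\<inverse> \<inter> J2\<inverse> = {}" using J(5) by auto
      show "(x, x1) \<in> (J1\<inverse>)\<^sup>*" "(x, x2) \<in> (J2\<inverse>)\<^sup>*" if "x \<in> S" for x
        using J(6,7) that by (auto simp: rtrancl_converse)
      fix y x assume yx: "y \<in> S'" "x \<in> S" "(y, x) \<noteq> (y1, x1)" "(y, x) \<noteq> (y2, x2)"
      then have "y \<notin> S" "x \<in> V" "y \<in> V" using V by auto
      then have "(x, y) \<notin> A" using only[of x y] yx by auto
      then show "(y, x) \<in> A" using adj[of x y] \<open>x \<in> V\<close> \<open>y \<in> V\<close> \<open>y \<notin> S\<close> yx(2) by auto
    qed (use J G a1(1,2) a2(1,2) 3 y z0 in auto)
  qed
qed

text \<open>Five vertices put three on one side of the cut. If that side is \<open>S\<close>, all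
  arcs are reversed and the sides change roles.\<close>

lemma good_tight:
  fixes A :: "'a rel"
  assumes sc: "semicomp V A" and ts: "two_arc_strong V A" and dec: "decomposable_upto TYPE('a) (card V - 1)"
    and S: "S \<subseteq> V" "2 \<le> card S" "2 \<le> card (V - S)" and tight: "leaving A S \<subseteq> {e, f}" and V: "5 \<le> card V"
  shows "good V A"
proof (cases "3 \<le> card (V - S)")
  case True
  then show ?thesis using good_tight_aux[OF sc ts dec S(1,2) _ tight] by simp
next
  case False
  have fin: "finite V" and AV: "A \<subseteq> V \<times> V" using sc unfolding semicomp_def by auto
  have VS: "V - (V - S) = S" using S(1) by auto
  have "card V = card S + card (V - S)"
    using S(1) fin by (metis card_Diff_subset card_mono finite_subset le_add_diff_inverse)
  then have "3 \<le> card S" using False V by auto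
  moreover have "leaving (A\<inverse>) (V - S) = (leaving A S)\<inverse>" using leaving_converse[OF AV, of "V - S"] VS by auto
  then have "leaving (A\<inverse>) (V - S) \<subseteq> {prod.swap e, prod.swap f}" using tight by (cases e; cases f) auto
  ultimately have "good V (A\<inverse>)"
    by (intro good_tight_aux[OF _ two_arc_strong_converse[OF ts] dec, of "V - S" "prod.swap e" "prod.swap f"])
      (use sc S VS in \<open>simp_all add: semicomp_converse\<close>)
  then show ?thesis by (simp add: good_converse)
qed

section \<open>Small orders and tournaments\<close>

lemma successively_rtrancl:
  assumes "successively (\<lambda>x y. (x, y) \<in> R) (x # xs)" "y \<in> set (x # xs)"
  shows "(x, y) \<in> R\<^sup>* \<and> (y, last (x # xs)) \<in> R\<^sup>*"
  using assms
proof (induction xs arbitrary: x y)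
  case (Cons a xs)
  have xa: "(x, a) \<in> R" and s: "successively (\<lambda>x y. (x, y) \<in> R) (a # xs)" using Cons.prems by auto
  show ?case
  proof (cases "y = x")
    case True
    have "(a, last (a # xs)) \<in> R\<^sup>*" using Cons.IH[OF s, of a] by simp
    then show ?thesis using True xa by (auto intro: converse_rtrancl_into_rtrancl)
  next
    case False
    then have "y \<in> set (a # xs)" using Cons.prems(2) by auto
    from Cons.IH[OF s this] show ?thesis using xa by (auto intro: converse_rtrancl_into_rtrancl)
  qed
qed simp

lemma strong_on_closed_walk:
  assumes "successively (\<lambda>x y. (x, y) \<in> R) (p # xs)" "last (p # xs) = p" "V \<subseteq> set (p # xs)"
  shows "strong_on V R"
proof (rule strong_onI[where p = p])
  fix v assume "v \<in> V"
  then have "v \<in> set (p # xs)" using assms(3) by blast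
  from successively_rtrancl[OF assms(1) this] assms(2)
  show "(p, v) \<in> R\<^sup>*" "(v, p) \<in> R\<^sup>*" by simp_all
qed

lemma good_three:
  assumes "distinct [a, b, c]" "{(a, b), (b, c), (c, a), (b, a), (c, b), (a, c)} \<subseteq> A"
  shows "good {a, b, c} A"
proof (rule goodI[of "{(a, b), (b, c), (c, a)}" _ _ "{(b, a), (c, b), (a, c)}"])
  show "strong_on {a, b, c} {(a, b), (b, c), (c, a)}" by (rule strong_on_closed_walk[of _ a "[b, c, a]"]) auto
  show "strong_on {a, b, c} {(b, a), (c, b), (a, c)}" by (rule strong_on_closed_walk[of _ a "[c, b, a]"]) auto
qed (use assms in auto)

lemma good_four_missing_triangle:
  assumes "distinct [a, b, c, d]"
    "{(b, a), (c, b), (a, c), (a, d), (d, a), (b, d), (d, b), (c, d), (d, c)} \<subseteq> A"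
  shows "good {a, b, c, d} A"
proof (rule goodI[of "{(d, b), (b, a), (a, c), (c, d)}" _ _ "{(c, b), (d, a), (a, d), (b, d), (d, c)}"])
  show "strong_on {a, b, c, d} {(d, b), (b, a), (a, c), (c, d)}"
    by (rule strong_on_closed_walk[of _ d "[b, a, c, d]"]) auto
  show "strong_on {a, b, c, d} {(c, b), (d, a), (a, d), (b, d), (d, c)}"
    by (rule strong_on_closed_walk[of _ d "[a, d, c, b, d]"]) auto
qed (use assms in auto)

lemma good_four_missing_path:
  assumes "distinct [a, b, c, d]"
    "{(b, a), (c, b), (d, c), (a, c), (c, a), (b, d), (d, b), (a, d), (d, a)} \<subseteq> A"
  shows "good {a, b, c, d} A"
proof (rule goodI[of "{(a, c), (c, b), (b, d), (d, a)}" _ _ "{(b, a), (d, c), (c, a), (d, b), (a, d)}"])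
  show "strong_on {a, b, c, d} {(a, c), (c, b), (b, d), (d, a)}"
    by (rule strong_on_closed_walk[of _ a "[c, b, d, a]"]) auto
  show "strong_on {a, b, c, d} {(b, a), (d, c), (c, a), (d, b), (a, d)}"
    by (rule strong_on_closed_walk[of _ a "[d, b, a, d, c, a]"]) auto
qed (use assms in auto)

lemma two_arc_strong_out:
  assumes "two_arc_strong V A" "u \<in> V" "V \<noteq> {u}"
  obtains v where "(u, v) \<in> A" "v \<in> V" "v \<noteq> u" "v \<noteq> x"
proof -
  obtain a b where "(a, b) \<in> A" "a \<in> {u}" "b \<in> V - {u}" "(a, b) \<noteq> (u, x)"
    by (rule two_arc_strongD[OF assms(1), of "{u}" "(u, x)"]) (use assms in auto)
  then show ?thesis using that by auto
qed

lemma two_arc_strong_in: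
  assumes "two_arc_strong V A" "u \<in> V" "V \<noteq> {u}"
  obtains v where "(v, u) \<in> A" "v \<in> V" "v \<noteq> u" "v \<noteq> x"
proof -
  obtain a b where "(a, b) \<in> A" "a \<in> V - {u}" "b \<in> V - (V - {u})" "(a, b) \<noteq> (x, u)"
    by (rule two_arc_strongD[OF assms(1), of "V - {u}" "(x, u)"]) (use assms in auto)
  then show ?thesis using that by auto
qed

text \<open>On four vertices each vertex lacks at most one out-arc and at most one in-arc, and no
  pair lacks both arcs. The absent arcs therefore lie in a directed triangle or in a path of three
  arcs, or they form a four-cycle, which is S4.\<close>

lemma good_four:
  fixes A :: "'a rel"
  assumes V: "V = {a, b, c, d}" and dist: "distinct [a, b, c, d]"
    and sc: "semicomp V A" and ts: "two_arc_strong V A" and nS: "\<not> is_S4 V A"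
  shows "good V A"
proof -
  have AV: "A \<subseteq> V \<times> V" and irr: "irrefl A" using sc unfolding semicomp_def by auto
  note adj = semicompD(4)[OF sc]
  have out: "(p, q) \<in> A \<or> (p, r) \<in> A" "(q, p) \<in> A \<or> (r, p) \<in> A"
    if "V = {p, q, r, s}" "distinct [p, q, r, s]" for p q r s
  proof -
    have p: "p \<in> V" "V \<noteq> {p}" using that by auto
    obtain v where "(p, v) \<in> A" "v \<in> V" "v \<noteq> p" "v \<noteq> s" by (rule two_arc_strong_out[OF ts p])
    then show "(p, q) \<in> A \<or> (p, r) \<in> A" using that by auto
    obtain v where "(v, p) \<in> A" "v \<in> V" "v \<noteq> p" "v \<noteq> s" by (rule two_arc_strong_in[OF ts p])
    then show "(q, p) \<in> A \<or> (r, p) \<in> A" using that by auto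
  qed
  \<comment> \<open>Two consecutive absent arcs \<open>r\<close>, \<open>p\<close>, \<open>q\<close>
    close up to a triangle or a four-cycle, or lie on a path prolonged at its end or at its
    beginning.\<close>
  have chain: "good V A" if W: "V = {p, q, r, s}" "distinct [p, q, r, s]"
    and m: "(p, q) \<notin> A" "(r, p) \<notin> A" for p q r s
  proof -
    have pr: "(p, r) \<in> A" "(p, s) \<in> A" "(s, q) \<in> A" "(r, q) \<in> A" "(s, p) \<in> A" "(r, s) \<in> A" "(q, p) \<in> A"
      using out[of p q r s] out[of p q s r] out[of q p s r] out[of q p r s] out[of p r s q] out[of r p s q]
        adj[of p q] W m by auto
    consider "(q, r) \<notin> A" | "(q, s) \<notin> A" "(s, r) \<notin> A" | "(q, s) \<notin> A" "(s, r) \<in> A"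
      | "(q, r) \<in> A" "(q, s) \<in> A" by blast
    then show ?thesis
    proof cases
      case 1
      have "(q, s) \<in> A" "(s, r) \<in> A" using out[of q r s p] out[of r q s p] W 1 by auto
      then show ?thesis unfolding W(1) by (intro good_four_missing_triangle) (use pr W(2) in auto)
    next
      case 2
      have "(q, r) \<in> A" using out(1)[of q r s p] W 2 by auto
      then have "{(r, q), (q, r), (p, s), (s, p), (p, r), (q, p), (s, q), (r, s)} \<subseteq> A" using pr by auto
      moreover have "A \<subseteq> {(r, q), (q, r), (p, s), (s, p), (p, r), (q, p), (s, q), (r, s)}"
      proof
        fix e assume e: "e \<in> A"
        then obtain u v where uv: "e = (u, v)" "u \<in> {p, q, r, s}" "v \<in> {p, q, r, s}" using AV W(1) by auto
        then show "e \<in> {(r, q), (q, r), (p, s), (s, p), (p, r), (q, p), (s, q), (r, s)}"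
        proof -
          have "(u, v) \<in> A" "u \<noteq> v" using e uv(1) irr by (auto simp: irrefl_def)
          then show ?thesis using uv(2,3) m 2 unfolding uv(1) by (elim insertE emptyE) simp_all
        qed
      qed
      ultimately have "A = {(r, q), (q, r), (p, s), (s, p), (p, r), (q, p), (s, q), (r, s)}" by (rule subset_antisym[rotated])
      moreover have "distinct [r, p, q, s]" "V = {r, p, q, s}" using W by auto
      ultimately have "is_S4 V A" unfolding is_S4_def by blast
      then show ?thesis using nS by simp
    next
      case 3
      have "(q, r) \<in> A" using out(1)[of q r s p] W 3 by auto
      moreover have "V = {r, p, q, s}" using W by auto
      ultimately show ?thesis using good_four_missing_path[of r p q s A] 3 pr W(2) by auto
    next
      case 4
      moreover have "V = {s, r, p, q}" using W by auto
      ultimately show ?thesis using good_four_missing_path[of s r p q A] pr W(2) by auto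
    qed
  qed
  have missing: "good V A" if W: "V = {p, q, r, s}" "distinct [p, q, r, s]"
    and m: "(p, q) \<notin> A" for p q r s
  proof -
    have pr: "(p, r) \<in> A" "(p, s) \<in> A" "(s, q) \<in> A" "(r, q) \<in> A" "(q, p) \<in> A"
      using out[of p q r s] out[of p q s r] out[of q p s r] out[of q p r s] adj[of p q] W m by auto
    have sym: "V = {p, q, s, r}" using W by auto
    have o: "(q, r) \<in> A \<or> (q, s) \<in> A" "(q, r) \<in> A \<or> (s, r) \<in> A" "(q, s) \<in> A \<or> (r, s) \<in> A" "(r, s) \<in> A \<or> (s, r) \<in> A"
      using out[of q r s p] out[of r q s p] out[of s q r p] adj[of r s] W by auto
    consider "(r, p) \<notin> A" | "(s, p) \<notin> A" | "(r, p) \<in> A" "(s, p) \<in> A" by blast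
    then show ?thesis
    proof cases
      case 1
      then show ?thesis using chain[OF W m] by simp
    next
      case 2
      then show ?thesis using chain[OF sym _ m] W(2) by auto
    next
      case 3
      have "(q, s) \<in> A \<and> (s, r) \<in> A \<or> (q, r) \<in> A \<and> (r, s) \<in> A" using o by blast
      then show ?thesis
        using good_four_missing_path[of p q r s A] good_four_missing_path[of p q s r A] 3 pr W(2) sym W(1)
        by auto
    qed
  qed
  show ?thesis
  proof (cases "\<exists>p \<in> V. \<exists>q \<in> V. p \<noteq> q \<and> (p, q) \<notin> A")
    case True
    then obtain p q where pq: "p \<in> V" "q \<in> V" "p \<noteq> q" "(p, q) \<notin> A" by blast
    have "card (V - {p, q}) = 2" using pq V dist by (simp add: card_Diff_subset)
    then obtain r s where "V - {p, q} = {r, s}" "r \<noteq> s" by (auto simp: card_2_iff)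
    then have "V = {p, q, r, s}" "distinct [p, q, r, s]" using pq by auto
    then show ?thesis using missing pq(4) by blast
  next
    case False
    then show ?thesis unfolding V by (intro good_four_missing_path[OF dist]) (use V dist in auto)
  qed
qed

lemma good_card_le_four:
  fixes A :: "'a rel"
  assumes sc: "semicomp V A" and ts: "two_arc_strong V A" and nS: "\<not> is_S4 V A" and V: "card V \<le> 4"
  shows "good V A"
proof -
  have fin: "finite V" using sc unfolding semicomp_def by auto
  have two: "\<exists>v w. (u, v) \<in> A \<and> (u, w) \<in> A \<and> v \<in> V - {u} \<and> w \<in> V - {u} \<and> v \<noteq> w"
    if u: "u \<in> V" "V \<noteq> {u}" for u
  proof -
    obtain v where v: "(u, v) \<in> A" "v \<in> V" "v \<noteq> u" "v \<noteq> u" by (rule two_arc_strong_out[OF ts u])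
    obtain w where "(u, w) \<in> A" "w \<in> V" "w \<noteq> u" "w \<noteq> v" by (rule two_arc_strong_out[OF ts u])
    then show ?thesis using v by blast
  qed
  consider "card V = 0" | "card V = 1" | "card V = 2" | "card V = 3" | "card V = 4" using V by linarith
  then show ?thesis
  proof cases
    case 1
    then show ?thesis using fin by (intro goodI[of "{}" _ _ "{}"]) (auto simp: strong_on_def)
  next
    case 2
    then obtain a where "V = {a}" by (auto simp: card_1_singleton_iff)
    then show ?thesis by (intro goodI[of "{}" _ _ "{}"]) (auto simp: strong_on_def)
  next
    case 3
    then obtain a b where "V = {a, b}" "a \<noteq> b" by (auto simp: card_2_iff)
    then show ?thesis using two[of a] by auto
  next
    case 4
    then obtain a b c where "V = {a, b, c}" "a \<noteq> b" "a \<noteq> c" "b \<noteq> c" by (auto simp: card_3_iff)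
    then show ?thesis using two[of a] two[of b] two[of c] good_three[of a b c A] by auto
  next
    case 5
    then have "card V = Suc 3" by simp
    then obtain a W where W: "V = insert a W" "a \<notin> W" "card W = 3" by (metis card_Suc_eq)
    then obtain b c d where "W = {b, c, d}" "b \<noteq> c" "b \<noteq> d" "c \<noteq> d" by (auto simp: card_3_iff)
    then show ?thesis using good_four[OF _ _ sc ts nS, of a b c d] W by auto
  qed
qed

text \<open>Dropping one arc of a two-cycle keeps the digraph semicomplete, so only a cut can forbid
  it, and besides \<open>(u, v)\<close> that cut has at most one arc. By \<open>good_tight\<close>
  one of its sides is a single vertex, namely \<open>u\<close> or \<open>v\<close>.\<close>

lemma two_cycle_arc_endpoint:
  fixes A :: "'a rel"
  assumes sc: "semicomp V A" and ts: "two_arc_strong V A" and dec: "decomposable_upto TYPE('a) (card V - 1)"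
    and V: "5 \<le> card V" and ng: "\<not> good V A"
    and uv: "(u, v) \<in> A" "(v, u) \<in> A"
    and min: "\<not> (semicomp V (A - {(u, v)}) \<and> two_arc_strong V (A - {(u, v)}))"
  shows "(\<exists>b. \<forall>x. (u, x) \<in> A \<longrightarrow> x = v \<or> x = b) \<or> (\<exists>b. \<forall>x. (x, v) \<in> A \<longrightarrow> x = u \<or> x = b)"
proof -
  note fin = semicompD(1)[OF sc] and irr = semicompD(2)[OF sc] and AV = semicompD(3)[OF sc]
  have AVV: "A \<inter> V \<times> V = A" using AV by auto
  have "semicomp V (A - {(u, v)})" using sc uv unfolding semicomp_def irrefl_def by auto
  then have "\<not> two_arc_strong V (A - {(u, v)})" using min by simp
  then obtain Z e where Z: "Z \<subset> V" "Z \<noteq> {}" "leaving ((A - {(u, v)}) \<inter> V \<times> V) Z \<subseteq> {e}"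
    unfolding two_arc_strong_def by blast
  have sub: "leaving A Z \<subseteq> {e, (u, v)}" using Z(3) AV unfolding leaving_def by auto
  have nc: "\<not> leaving A Z \<subseteq> {e}" using ts Z(1,2) AVV unfolding two_arc_strong_def by metis
  then have "(u, v) \<in> leaving A Z" using sub by auto
  then have uZ: "u \<in> Z" "v \<in> V - Z" "u \<in> V" "v \<in> V" using AV by (auto simp: leaving_def)
  have "\<not> (2 \<le> card Z \<and> 2 \<le> card (V - Z))" using good_tight[OF sc ts dec _ _ _ sub V] ng Z(1) by blast
  moreover have "card Z \<noteq> 0" "card (V - Z) \<noteq> 0" using uZ fin Z(1) finite_subset by fastforce+
  ultimately have "card Z = 1 \<or> card (V - Z) = 1" by linarith
  then have "Z = {u} \<or> V - Z = {v}"
  proof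
    assume "card Z = 1"
    then obtain a where "Z = {a}" by (auto simp: card_1_singleton_iff)
    then show ?thesis using uZ(1) by simp
  next
    assume "card (V - Z) = 1"
    then obtain a where "V - Z = {a}" by (auto simp: card_1_singleton_iff)
    then show ?thesis using uZ(2) by simp
  qed
  then consider "Z = {u}" | "V - Z = {v}" by blast
  then show ?thesis
  proof cases
    case 1
    have "\<forall>x. (u, x) \<in> A \<longrightarrow> x = v \<or> x = snd e"
    proof (intro allI impI)
      fix x assume "(u, x) \<in> A"
      then have "(u, x) \<in> leaving A Z" using 1 irr by (auto simp: leaving_def irrefl_def)
      then show "x = v \<or> x = snd e" using sub by auto
    qed
    then show ?thesis by blast
  next
    case 2
    have "\<forall>x. (x, v) \<in> A \<longrightarrow> x = u \<or> x = fst e"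
    proof (intro allI impI)
      fix x assume x: "(x, v) \<in> A"
      then have "x \<in> V" "x \<noteq> v" using AV irr by (auto simp: irrefl_def)
      then have "x \<in> Z" using 2 by blast
      then have "(x, v) \<in> leaving A Z" using x uZ by (auto simp: leaving_def)
      then show "x = u \<or> x = fst e" using sub by auto
    qed
    then show ?thesis by blast
  qed
qed

text \<open>A vertex of a two-cycle whose in- and out-degree are both at most 2 has at most three
  neighbours, too few for order 5. Hence both ends of a two-cycle have small out-degree, and only
  two arcs leave the pair, or both have small in-degree, and only two arcs enter it;
  \<open>good_tight\<close> excludes either.\<close>

lemma minimal_antisym:
  fixes A :: "'a rel"
  assumes sc: "semicomp V A" and ts: "two_arc_strong V A" and dec: "decomposable_upto TYPE('a) (card V - 1)"
    and V: "5 \<le> card V" and ng: "\<not> good V A"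
    and min: "\<And>e. e \<in> A \<Longrightarrow> \<not> (semicomp V (A - {e}) \<and> two_arc_strong V (A - {e}))"
    and uv: "(u, v) \<in> A"
  shows "(v, u) \<notin> A"
proof
  assume vu: "(v, u) \<in> A"
  note fin = semicompD(1)[OF sc] and irr = semicompD(2)[OF sc] and AV = semicompD(3)[OF sc]
    and adj = semicompD(4)[OF sc]
  have W: "u \<in> V" "v \<in> V" "u \<noteq> v" using uv AV irr by (auto simp: irrefl_def)
  have notboth: False
    if "\<forall>x. (p, x) \<in> A \<longrightarrow> x = q \<or> x = b" "\<forall>x. (x, p) \<in> A \<longrightarrow> x = q \<or> x = c" "p \<in> V" for p q b c
  proof -
    have "V \<subseteq> {p, q, b, c}" using adj[of p] that by blast
    then have "card V \<le> card {p, q, b, c}" by (intro card_mono) auto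
    also have "\<dots> \<le> 4" by (intro order.trans[OF card_insert_le_m1]) (auto intro!: card_insert_le_m1)
    finally show False using V by simp
  qed
  have pair: "card {u, v} = 2" using W by simp
  have comp: "card (V - {u, v}) \<ge> 3" using V W fin pair by (subst card_Diff_subset) auto
  define Ou where "Ou = (\<lambda>p q. \<exists>b. \<forall>x. (p, x) \<in> A \<longrightarrow> x = q \<or> x = b)"
  define In where "In = (\<lambda>p q. \<exists>b. \<forall>x. (x, p) \<in> A \<longrightarrow> x = q \<or> x = b)"
  have "Ou u v \<or> In v u" "Ou v u \<or> In u v"
    using two_cycle_arc_endpoint[OF sc ts dec V ng uv vu min[OF uv]]
      two_cycle_arc_endpoint[OF sc ts dec V ng vu uv min[OF vu]] unfolding Ou_def In_def by blast+
  moreover have "\<not> (Ou u v \<and> In u v)" "\<not> (Ou v u \<and> In v u)" using notboth W unfolding Ou_def In_def by blast+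
  ultimately have "Ou u v \<and> Ou v u \<or> In v u \<and> In u v" by blast
  then consider (oo) b c where "\<forall>x. (u, x) \<in> A \<longrightarrow> x = v \<or> x = b" "\<forall>x. (v, x) \<in> A \<longrightarrow> x = u \<or> x = c"
    | (ii) b c where "\<forall>x. (x, v) \<in> A \<longrightarrow> x = u \<or> x = b" "\<forall>x. (x, u) \<in> A \<longrightarrow> x = v \<or> x = c"
    unfolding Ou_def In_def by blast
  then show False
  proof cases
    case oo
    have "leaving A {u, v} \<subseteq> {(u, b), (v, c)}" using oo unfolding leaving_def by auto
    then show False using good_tight[OF sc ts dec _ _ _ _ V, of "{u, v}"] ng W pair comp by simp
  next
    case ii
    have VV: "V - (V - {u, v}) = {u, v}" using W by auto
    have "leaving A (V - {u, v}) \<subseteq> {(b, v), (c, u)}" using ii AV unfolding leaving_def by auto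
    then show False using good_tight[OF sc ts dec _ _ _ _ V, of "V - {u, v}"] VV ng pair comp by simp
  qed
qed

text \<open>Every vertex has two out- and two in-neighbours, which determines the tournament up to
  names. The arcs assumed in \<open>core\<close> fix the names.\<close>

lemma good_five_tournament:
  fixes A :: "'a rel"
  assumes sc: "semicomp V A" and ts: "two_arc_strong V A" and V: "card V = 5"
    and anti: "\<And>u v. (u, v) \<in> A \<Longrightarrow> (v, u) \<notin> A"
  shows "good V A"
proof -
  note fin = semicompD(1)[OF sc] and irr = semicompD(2)[OF sc] and AV = semicompD(3)[OF sc]
    and adj = semicompD(4)[OF sc]
  have ne: "V \<noteq> {u}" for u using V by auto
  have out: "\<exists>v w. (u, v) \<in> A \<and> (u, w) \<in> A \<and> v \<noteq> w" if u: "u \<in> V" for u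
  proof -
    obtain v where v: "(u, v) \<in> A" by (rule two_arc_strong_out[OF ts u ne])
    obtain w where "(u, w) \<in> A" "w \<noteq> v" by (rule two_arc_strong_out[OF ts u ne])
    then show ?thesis using v by blast
  qed
  have inn: "\<exists>v w. (v, u) \<in> A \<and> (w, u) \<in> A \<and> v \<noteq> w" if u: "u \<in> V" for u
  proof -
    obtain v where v: "(v, u) \<in> A" by (rule two_arc_strong_in[OF ts u ne])
    obtain w where "(w, u) \<in> A" "w \<noteq> v" by (rule two_arc_strong_in[OF ts u ne])
    then show ?thesis using v by blast
  qed
  have core: "good V A" if W: "V = {a, b, c, d, e}" "distinct [a, b, c, d, e]"
    and arcs: "(a, b) \<in> A" "(a, c) \<in> A" "(d, a) \<in> A" "(e, a) \<in> A" "(b, c) \<in> A" "(b, d) \<in> A" for a b c d e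
  proof -
    have no: "(c, a) \<notin> A" "(c, b) \<notin> A" "(c, c) \<notin> A" using arcs anti irr by (auto simp: irrefl_def)
    obtain v w where "(c, v) \<in> A" "(c, w) \<in> A" "v \<noteq> w" using out[of c] W(1) by auto
    moreover from this have "v \<in> {d, e}" "w \<in> {d, e}" using AV no unfolding W(1) by auto
    ultimately have c: "(c, d) \<in> A" "(c, e) \<in> A" by auto
    have no: "(b, b) \<notin> A" "(c, b) \<notin> A" "(d, b) \<notin> A" using arcs anti irr by (auto simp: irrefl_def)
    obtain v w where "(v, b) \<in> A" "(w, b) \<in> A" "v \<noteq> w" using inn[of b] W(1) by auto
    moreover from this have "v \<in> {a, e}" "w \<in> {a, e}" using AV no unfolding W(1) by auto
    ultimately have e: "(e, b) \<in> A" by auto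
    have no: "(d, b) \<notin> A" "(d, c) \<notin> A" "(d, d) \<notin> A" using arcs c anti irr by (auto simp: irrefl_def)
    obtain v w where "(d, v) \<in> A" "(d, w) \<in> A" "v \<noteq> w" using out[of d] W(1) by auto
    moreover from this have "v \<in> {a, e}" "w \<in> {a, e}" using AV no unfolding W(1) by auto
    ultimately have d: "(d, e) \<in> A" by auto
    show ?thesis unfolding W(1)
    proof (intro goodI[of "{(a, b), (b, c), (c, d), (d, e), (e, a)}" _ _ "{(a, c), (c, e), (e, b), (b, d), (d, a)}"])
      show "strong_on {a, b, c, d, e} {(a, b), (b, c), (c, d), (d, e), (e, a)}"
        by (rule strong_on_closed_walk[of _ a "[b, c, d, e, a]"]) auto
      show "strong_on {a, b, c, d, e} {(a, c), (c, e), (e, b), (b, d), (d, a)}"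
        by (rule strong_on_closed_walk[of _ a "[c, e, b, d, a]"]) auto
      show "{(a, b), (b, c), (c, d), (d, e), (e, a)} \<inter> {(a, c), (c, e), (e, b), (b, d), (d, a)} = {}"
        using W(2) by auto
    qed (use arcs c d e in auto)
  qed
  obtain a where a: "a \<in> V" using V by fastforce
  obtain b c where bc: "(a, b) \<in> A" "(a, c) \<in> A" "b \<noteq> c" "(b, c) \<in> A"
  proof -
    obtain b c where "(a, b) \<in> A" "(a, c) \<in> A" "b \<noteq> c" using out[OF a] by blast
    moreover from this have "b \<in> V" "c \<in> V" using AV by auto
    ultimately show thesis using that[of b c] that[of c b] adj[of b c] by blast
  qed
  obtain d e where de: "(d, a) \<in> A" "(e, a) \<in> A" "d \<noteq> e" using inn[OF a] by blast
  have dist: "distinct [a, b, c, d, e]" using bc de anti irr unfolding irrefl_def by auto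
  have "{a, b, c, d, e} \<subseteq> V" using a bc de AV by auto
  moreover have "card {a, b, c, d, e} = 5" using dist by simp
  ultimately have W: "V = {a, b, c, d, e}" using V fin by (metis card_subset_eq)
  have no: "(b, a) \<notin> A" "(b, b) \<notin> A" using bc anti irr by (auto simp: irrefl_def)
  obtain v w where "(b, v) \<in> A" "(b, w) \<in> A" "v \<noteq> w" using out[of b] W by auto
  moreover from this have "v \<in> {c, d, e}" "w \<in> {c, d, e}" using AV no unfolding W by auto
  ultimately have "(b, d) \<in> A \<or> (b, e) \<in> A" by auto
  moreover have "V = {a, b, c, e, d}" using W by auto
  ultimately show ?thesis using core[of a b c d e] core[of a b c e d] W dist bc de by auto
qed

section \<open>Critical tournaments\<close>

text \<open>The order of the parts matters: arcs are counted from \<open>Y\<close> to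
  \<open>X\<close>, and reversing all arcs exchanges the parts.\<close>

definition split_at :: "'a set \<Rightarrow> 'a \<Rightarrow> 'a set \<Rightarrow> 'a set \<Rightarrow> bool" where
  "split_at V p Y X \<longleftrightarrow> V = insert p (Y \<union> X) \<and> p \<notin> Y \<and> p \<notin> X \<and> Y \<inter> X = {}"

text \<open>
  A decomposition of the digraph left after deleting a vertex p, or after replacing p by an arc (w, y)
  that shortcuts a path w p y, extends back to one of the whole digraph. In a minimal counterexample
  neither operation can therefore leave a 2-arc-strong digraph, which is what \<open>delete\<close> and
  \<open>splice\<close> record.
\<close>

locale critical_tournament =
  fixes V :: "'a set" and A :: "'a rel"
  assumes fin: "finite V"
    and AV: "A \<subseteq> V \<times> V"
    and anti: "(u, v) \<in> A \<Longrightarrow> (v, u) \<notin> A"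
    and adj: "u \<in> V \<Longrightarrow> v \<in> V \<Longrightarrow> u \<noteq> v \<Longrightarrow> (u, v) \<in> A \<or> (v, u) \<in> A"
    and cut2: "Z \<subseteq> V \<Longrightarrow> Z \<noteq> V \<Longrightarrow> Z \<noteq> {} \<Longrightarrow> \<not> leaving A Z \<subseteq> {e}"
    and cut3: "Z \<subseteq> V \<Longrightarrow> 2 \<le> card Z \<Longrightarrow> 2 \<le> card (V - Z) \<Longrightarrow> \<not> leaving A Z \<subseteq> {e, f}"
    and no_cut_vertex: "split_at V p Y X \<Longrightarrow> 2 \<le> card Y \<Longrightarrow> 2 \<le> card X \<Longrightarrow> A \<inter> Y \<times> X \<noteq> {}"
    and six: "6 \<le> card V"
    and delete: "p \<in> V \<Longrightarrow>
      \<exists>Y X e. split_at V p Y X \<and> Y \<noteq> {} \<and> X \<noteq> {} \<and> A \<inter> Y \<times> X \<subseteq> {e}"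
    and splice: "(w, p) \<in> A \<Longrightarrow> (p, y) \<in> A \<Longrightarrow> (w, y) \<notin> A \<Longrightarrow>
      \<exists>Y X e. split_at V p Y X \<and> Y \<noteq> {} \<and> X \<noteq> {} \<and> insert (w, y) A \<inter> Y \<times> X \<subseteq> {e}"
begin

lemma irr: "(u, u) \<notin> A" using anti by blast

lemma mem: "(u, v) \<in> A \<Longrightarrow> u \<in> V \<and> v \<in> V \<and> u \<noteq> v" using AV irr by auto

lemma into: "u \<in> V \<Longrightarrow> v \<in> V \<Longrightarrow> u \<noteq> v \<Longrightarrow> (v, u) \<notin> A \<Longrightarrow> (u, v) \<in> A" using adj by blast

lemma cut2_small:
  assumes "Z \<subseteq> {a, b, c, d, e}" "Z \<noteq> {}" "Z \<subseteq> V"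
  shows "\<not> leaving A Z \<subseteq> {f}"
proof -
  have "card Z \<le> card {a, b, c, d, e}" using assms(1) by (intro card_mono) auto
  also have "\<dots> \<le> 5" using card_length[of "[a, b, c, d, e]"] by simp
  finally have "Z \<noteq> V" using six by auto
  then show ?thesis using cut2 assms by blast
qed

lemma cut3_small:
  assumes "Z \<subseteq> {a, b, c, d}" "x \<in> Z" "y \<in> Z" "x \<noteq> y" "Z \<subseteq> V"
  shows "\<not> leaving A Z \<subseteq> {f, g}"
proof -
  have f: "finite Z" using assms(1) finite_subset by blast
  have "card Z \<le> card {a, b, c, d}" using assms(1) by (intro card_mono) auto
  also have "\<dots> \<le> 4" using card_length[of "[a, b, c, d]"] by simp
  finally have "2 \<le> card (V - Z)" using six assms(5) f by (simp add: card_Diff_subset)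
  moreover have "2 \<le> card Z" using assms f card_mono[of Z "{x, y}"] by simp
  ultimately show ?thesis using cut3 assms by blast
qed

text \<open>No vertex has out-degree below 2, so these are the vertices of out-degree exactly 2, as
  \<open>outle2E\<close> makes explicit.\<close>

definition outle2 :: "'a \<Rightarrow> bool" where
  "outle2 q \<longleftrightarrow> q \<in> V \<and> (\<exists>s t. \<forall>x. (q, x) \<in> A \<longrightarrow> x = s \<or> x = t)"

lemma outle2E:
  assumes "outle2 q"
  obtains s t where "s \<noteq> t" "\<And>x. (q, x) \<in> A \<longleftrightarrow> x = s \<or> x = t"
proof -
  obtain s t where st: "\<And>x. (q, x) \<in> A \<Longrightarrow> x = s \<or> x = t" and q: "q \<in> V" using assms unfolding outle2_def by blast
  have "\<not> leaving A {q} \<subseteq> {(q, s)}" "\<not> leaving A {q} \<subseteq> {(q, t)}" by (rule cut2_small; use q in auto)+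
  then have "(q, t) \<in> A" "(q, s) \<in> A" "s \<noteq> t" using st unfolding leaving_def by auto
  then show thesis using that[of s t] st by blast
qed

text \<open>Names may repeat, so all nonempty sets of at most five vertices are covered; they are
  proper subsets of \<open>V\<close>. In \<open>closed2\<close> at most four vertices leave two
  outside, so that \<open>cut3\<close> forces a third arc.\<close>

lemma closed1:
  assumes "\<And>u v. (u, v) \<in> A \<Longrightarrow> u \<in> {a, b, c, d, e} \<Longrightarrow> v \<notin> {a, b, c, d, e} \<Longrightarrow> (u, v) = f"
    and "{a, b, c, d, e} \<subseteq> V"
  shows False
  using cut2_small[of "{a, b, c, d, e}" a b c d e f] assms unfolding leaving_def by auto

lemma closed2:
  assumes "\<And>u v. (u, v) \<in> A \<Longrightarrow> u \<in> {a, b, c, d} \<Longrightarrow> v \<notin> {a, b, c, d} \<Longrightarrow> (u, v) = f \<or> (u, v) = g"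
    and "{a, b, c, d} \<subseteq> V" "a \<noteq> b"
  shows False
  using cut3_small[of "{a, b, c, d}" a b c d a b f g] assms unfolding leaving_def by auto

lemma deleteE:
  assumes "p \<in> V"
  obtains Y X e where "split_at V p Y X" "Y \<noteq> {}" "X \<noteq> {}" "A \<inter> Y \<times> X \<subseteq> {e}"
  using delete[OF assms] by blast

lemma spliceE:
  assumes "(w, p) \<in> A" "(p, y) \<in> A"
  obtains Y X e where "split_at V p Y X" "Y \<noteq> {}" "X \<noteq> {}" "insert (w, y) A \<inter> Y \<times> X \<subseteq> {e}"
proof (cases "(w, y) \<in> A")
  case True
  have "p \<in> V" using mem assms by blast
  then obtain Y X e where "split_at V p Y X" "Y \<noteq> {}" "X \<noteq> {}" "A \<inter> Y \<times> X \<subseteq> {e}" by (rule deleteE)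
  then show thesis using that[of Y X e] True by (simp add: insert_absorb)
next
  case False
  then show thesis using splice[OF assms False] that by blast
qed

lemma split_atD:
  assumes "split_at V p Y X"
  shows "v \<in> V \<Longrightarrow> v \<noteq> p \<Longrightarrow> v \<in> Y \<or> v \<in> X" "Y \<subseteq> V" "X \<subseteq> V" "p \<notin> Y" "p \<notin> X" "Y \<inter> X = {}" "p \<in> V"
    "v \<in> Y \<Longrightarrow> v \<notin> X"
  using assms unfolding split_at_def by auto

text \<open>Moving \<open>p\<close> to \<open>Y\<close> creates no new outgoing arc.\<close>

lemma closed_insert:
  assumes YX: "split_at V p Y X" "X \<noteq> {}" "A \<inter> Y \<times> X \<subseteq> {e}"
    and p: "\<And>v. (p, v) \<in> A \<Longrightarrow> v \<in> Y"
  shows False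
proof -
  note part = split_atD[OF YX(1)]
  have "leaving A (insert p Y) \<subseteq> {e}"
  proof
    fix z assume "z \<in> leaving A (insert p Y)"
    then obtain u v where z: "z = (u, v)" "(u, v) \<in> A" "u = p \<or> u \<in> Y" "v \<notin> Y" "v \<noteq> p" by (auto simp: leaving_def)
    then have "u \<in> Y" "v \<in> X" using p[of v] part(1)[of v] mem[of u v] by auto
    then show "z \<in> {e}" using YX(3) z by auto
  qed
  then show False using cut2[of "insert p Y" e] part(2,3,5-7) YX(2) by blast
qed

text \<open>Moving \<open>p\<close> to \<open>Y\<close> adds at most the outgoing arc to
  \<open>a\<close>, and \<open>cut3\<close> then leaves room for a single vertex in
  \<open>X\<close>.\<close>

lemma closed_insert2:
  assumes YX: "split_at V p Y X" "Y \<noteq> {}" "A \<inter> Y \<times> X \<subseteq> {e}"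
    and p: "\<And>v. (p, v) \<in> A \<Longrightarrow> v \<in> Y \<or> v = a"
  shows "card X < 2"
proof (rule ccontr)
  assume X: "\<not> card X < 2"
  note part = split_atD[OF YX(1)]
  have f: "finite Y" using fin part(2) finite_subset by blast
  have "leaving A (insert p Y) \<subseteq> {e, (p, a)}"
  proof
    fix z assume "z \<in> leaving A (insert p Y)"
    then obtain u v where z: "z = (u, v)" "(u, v) \<in> A" "u = p \<or> u \<in> Y" "v \<notin> Y" "v \<noteq> p" by (auto simp: leaving_def)
    then show "z \<in> {e, (p, a)}" using p[of v] YX(3) part(1)[of v] mem[of u v] by auto
  qed
  moreover have "insert p Y \<subseteq> V" using part by auto
  moreover have "V - insert p Y = X" using YX(1) unfolding split_at_def by auto
  moreover have "2 \<le> card (insert p Y)" using f YX(2) part(4) by (simp add: card_gt_0_iff Suc_le_eq)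
  ultimately show False using cut3[of "insert p Y"] X by auto
qed

section \<open>At most one vertex of out-degree 2\<close>

text \<open>All vertices outside a few named ones point to both \<open>q1\<close> and
  \<open>q2\<close>, so a side \<open>Y\<close> that avoids one of these and sends only one arc
  across is tiny. Joined with the vertices of known out-neighbourhood it has too few outgoing arcs
  for \<open>closed1\<close> or \<open>closed2\<close>.\<close>

lemma twin_targets_aux:
  assumes N1: "\<And>x. (q1, x) \<in> A \<longleftrightarrow> x = q2 \<or> x = a" and N2: "\<And>x. (q2, x) \<in> A \<longleftrightarrow> x = a \<or> x = c"
    and ac: "a \<noteq> c" and N: "\<And>x. (y, x) \<in> A \<longleftrightarrow> x = q1 \<or> x = q2"
  shows False
proof -
  have q1: "(q1, q2) \<in> A" "(q1, a) \<in> A" "(q2, a) \<in> A" "(q2, c) \<in> A" "(y, q1) \<in> A" "(y, q2) \<in> A"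
    using N1 N2 N by auto
  have inV: "q1 \<in> V" "q2 \<in> V" "a \<in> V" "c \<in> V" "y \<in> V" using q1 mem by auto
  have ne: "q1 \<noteq> q2" "q1 \<noteq> a" "q2 \<noteq> a" "q2 \<noteq> c" "q1 \<noteq> c" "y \<noteq> q1" "y \<noteq> q2" "y \<noteq> a" "y \<noteq> c"
    using q1 mem anti N1 N by blast+
  have to1: "(v, q1) \<in> A" if "v \<in> V" "v \<notin> {q1, q2, a}" for v using into[of v q1] that N1 inV by auto
  have to2: "(v, q2) \<in> A" if "v \<in> V" "v \<notin> {q2, a, c}" for v using into[of v q2] that N2 inV by auto
  obtain Y X e where YX: "split_at V y Y X" "Y \<noteq> {}" "X \<noteq> {}" "A \<inter> Y \<times> X \<subseteq> {e}" using inV(5) by (rule deleteE)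
  note part = split_atD[OF YX(1)]
  have un': "(u, v) = e" if "u \<in> Y" "(u, v) \<in> A" "v \<notin> Y" "v \<noteq> y" for u v
    using YX(4) that part(1)[of v] mem by blast
  have to1': "(v, q1) = e" if "v \<in> Y" "q1 \<in> X" "v \<notin> {q2, a}" for v
    using un'[of v q1] to1[of v] that part ne by blast
  have to2': "(v, q2) = e" if "v \<in> Y" "q2 \<in> X" "v \<notin> {a, c}" for v
    using un'[of v q2] to2[of v] that part ne by blast
  consider "q1 \<in> Y" "q2 \<in> Y" | "q1 \<in> X" "q2 \<in> X" | "q1 \<in> X" "q2 \<in> Y" | "q1 \<in> Y" "q2 \<in> X"
    using part(1)[of q1] part(1)[of q2] inV ne by blast
  then show False
  proof cases
    case 1
    show False by (rule closed_insert[OF YX(1,3,4)]) (use N 1 in auto)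
  next
    case 2
    \<comment> \<open>Any other vertex of \<open>Y\<close> would send two arcs across, to
      \<open>q1\<close> and to \<open>q2\<close>.\<close>
    have Y: "v \<in> {a, c}" if "v \<in> Y" for v
      using to1'[of v] to2'[of v] that 2 ne part(8)[of q1] part(8)[of q2] by blast
    show False
    proof (cases "a \<in> Y")
      case True
      show False
      proof (cases "c \<in> Y")
        case False
        have Yeq: "x \<in> Y \<longleftrightarrow> x = a" for x using Y True False by blast
        show False by (rule closed2[of y a q1 q2 e "(q2, c)"])
          (use N N1 N2 un'[of a] inV ne in \<open>auto simp: Yeq\<close>)
      next
        case cY: True
        have Yeq: "x \<in> Y \<longleftrightarrow> x = a \<or> x = c" for x using Y True cY by blast
        show False by (rule closed1[of y a q1 q2 c e])
          (use N N1 N2 un'[of a] un'[of c] inV ne in \<open>auto simp: Yeq\<close>)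
      qed
    next
      case False
      then have c: "c \<in> Y" using Y YX(2) by blast
      then have e: "e = (c, q1)" using to1'[of c] 2 ne ac by auto
      have Yeq: "x \<in> Y \<longleftrightarrow> x = c" for x using Y False c by blast
      show False by (rule closed2[of y c q1 q2 "(q1, a)" "(q2, a)"])
          (use N N1 N2 un'[of c] e inV ne in \<open>auto simp: Yeq\<close>)
    qed
  next
    case 3
    have Y3: "v \<in> {q2, a, c}" if "v \<in> Y" "c \<in> Y" for v
      using to1'[of v] to1'[of c] that 3 ne ac by blast
    have Y3': "v \<in> {q2, a}" if "v \<in> Y" "c \<notin> Y" for v
      using to1'[of v] un'[of q2 c] that 3 ne q1 by blast
    show False
    proof (cases "a \<in> Y")
      case True
      show False
      proof (cases "c \<in> Y")
        case cY: True
        then have e: "e = (c, q1)" using to1'[of c] 3 ne ac by auto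
        have Yeq: "x \<in> Y \<longleftrightarrow> x = a \<or> x = c \<or> x = q2" for x using Y3 True cY 3 by blast
        show False by (rule closed1[of y a q1 q2 c e])
          (use N N1 N2 un'[of a] un'[of c] e inV ne in \<open>auto simp: Yeq\<close>)
      next
        case cY: False
        then have e: "e = (q2, c)" using un'[of q2 c] 3 ne q1 by auto
        have Yeq: "x \<in> Y \<longleftrightarrow> x = a \<or> x = q2" for x using Y3' True cY 3 by blast
        show False by (rule closed1[of y a q1 q2 q2 e])
          (use N N1 N2 un'[of a] e inV ne in \<open>auto simp: Yeq\<close>)
      qed
    next
      case False
      then have "e = (q2, a)" using un'[of q2 a] 3 q1 ne by auto
      then show False using un'[of q2 c] to1'[of c] 3 q1 ne ac by auto
    qed
  next
    case 4
    have e: "e = (q1, q2)" using un'[of q1 q2] 4 q1 ne part(8)[of q2] by auto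
    have a: "a \<in> Y" using un'[of q1 a] 4 q1 ne e by auto
    have Y: "v \<in> {q1, a, c}" if "v \<in> Y" for v using to2'[of v] that 4 e by blast
    show False
    proof (cases "c \<in> Y")
      case True
      have Yeq: "x \<in> Y \<longleftrightarrow> x = a \<or> x = c \<or> x = q1" for x using Y True a 4 by blast
      have "v = c \<or> v = q1 \<or> v = y" if "(a, v) \<in> A" for v using un'[of a v] a that e ne Yeq[of v] mem[of a v] by auto
      moreover have "v = a \<or> v = q1 \<or> v = y" if "(c, v) \<in> A" for v using un'[of c v] True that e ne Yeq[of v] mem[of c v] by auto
      ultimately show False using N N1 N2 inV by (intro closed1[of y a q1 q2 c e]) auto
    next
      case False
      have Yeq: "x \<in> Y \<longleftrightarrow> x = a \<or> x = q1" for x using Y False a 4 by blast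
      show False by (rule closed1[of y a q1 q2 q2 "(q2, c)"])
          (use N N1 N2 un'[of a] e inV ne in \<open>auto simp: Yeq\<close>)
    qed
  qed
qed

text \<open>The path from \<open>c\<close> over \<open>q1\<close> to \<open>a\<close> is shortcut,
  so that \<open>(c, a)\<close> counts as a crossing arc as well. Sides are small as in
  \<open>twin_targets_aux\<close>; that lemma disposes of the case where \<open>Y\<close> is one
  vertex with out-neighbours \<open>q1\<close> and \<open>q2\<close>.\<close>

lemma twin_targets:
  assumes N1: "\<And>x. (q1, x) \<in> A \<longleftrightarrow> x = q2 \<or> x = a" and N2: "\<And>x. (q2, x) \<in> A \<longleftrightarrow> x = a \<or> x = c"
    and ac: "a \<noteq> c"
  shows False
proof -
  have no: "\<exists>x. ((y, x) \<in> A) \<noteq> (x = q1 \<or> x = q2)" for y using twin_targets_aux[OF N1 N2 ac] by blast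
  have q1: "(q1, q2) \<in> A" "(q1, a) \<in> A" "(q2, a) \<in> A" "(q2, c) \<in> A" using N1 N2 by auto
  have inV: "q1 \<in> V" "q2 \<in> V" "a \<in> V" "c \<in> V" using q1 mem by auto
  have ne: "q1 \<noteq> q2" "q1 \<noteq> a" "q2 \<noteq> a" "q2 \<noteq> c" "q1 \<noteq> c" using q1 mem anti N1 by blast+
  have to1: "(v, q1) \<in> A" if "v \<in> V" "v \<notin> {q1, q2, a}" for v using into[of v q1] that N1 inV by auto
  have to2: "(v, q2) \<in> A" if "v \<in> V" "v \<notin> {q2, a, c}" for v using into[of v q2] that N2 inV by auto
  have cq: "(c, q1) \<in> A" "(c, q2) \<notin> A" "(a, q1) \<notin> A" "(a, q2) \<notin> A" using to1[of c] inV ne ac q1 anti by auto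
  obtain Y X e where YX: "split_at V q1 Y X" "Y \<noteq> {}" "X \<noteq> {}" "insert (c, a) A \<inter> Y \<times> X \<subseteq> {e}"
    using cq(1) q1(2) by (rule spliceE)
  note part = split_atD[OF YX(1)]
  have un': "(u, v) = e" if "u \<in> Y" "(u, v) \<in> A" "v \<notin> Y" "v \<noteq> q1" for u v
    using YX(4) that part(1)[of v] mem by blast
  have ca: "(c, a) = e" if "c \<in> Y" "a \<notin> Y" using YX(4) that part(1)[of a] inV ne by blast
  have to2': "(v, q2) = e" if "v \<in> Y" "q2 \<in> X" "v \<notin> {a, c}" for v
    using un'[of v q2] to2[of v] that part ne by blast
  show False
  proof (cases "q2 \<in> Y")
    case True
    show False
    proof (cases "a \<in> Y")
      case aY: True
      have "A \<inter> Y \<times> X \<subseteq> {e}" using YX(4) by auto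
      then show False by (rule closed_insert[OF YX(1,3)]) (use N1 True aY in auto)
    next
      case aY: False
      then have "e = (q2, a)" using un'[of q2 a] True q1 ne by auto
      then show False using ca un'[of q2 c] aY True q1 ne ac by auto
    qed
  next
    case False
    then have q2: "q2 \<in> X" using part(1)[of q2] inV ne by auto
    show False
    proof (cases "Y \<subseteq> {a, c}")
      case True
      consider "a \<in> Y" "c \<in> Y" | "a \<in> Y" "c \<notin> Y" | "a \<notin> Y" "c \<in> Y" using True YX(2) by blast
      then show False
      proof cases
        case 1
        have Yeq: "x \<in> Y \<longleftrightarrow> x = a \<or> x = c" for x using 1 True by blast
        show False by (rule closed1[of a c q1 q2 q1 e]) (use N1 N2 un'[of a] un'[of c] inV ne in \<open>auto simp: Yeq\<close>)
      next
        case 2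
        have Yeq: "x \<in> Y \<longleftrightarrow> x = a" for x using 2 True by blast
        have "v \<noteq> q1" if "(a, v) \<in> A" for v using that cq by blast
        then show False using un'[of a] inV by (intro closed1[of a a a a a e]) (auto simp: Yeq)
      next
        case 3
        have e: "e = (c, a)" using ca 3 by simp
        have cN: "v = q1 \<or> v = a" if "(c, v) \<in> A" for v using un'[of c v] that e 3 True mem[of c v] by blast
        have fin3: "finite {c, q1, q2}" "card {c, q1, q2} = 3" using ne by auto
        \<comment> \<open>All arcs that leave \<open>{c, q1, q2}\<close> end in \<open>a\<close>,
          which makes \<open>a\<close> a cut vertex.\<close>
        have "split_at V a {c, q1, q2} (V - {a, c, q1, q2})" unfolding split_at_def using inV ne ac by auto
        moreover have "card {a, c, q1, q2} = 4" using ne ac by auto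
        then have "2 \<le> card (V - {a, c, q1, q2})" using six inV by (subst card_Diff_subset) auto
        ultimately have "A \<inter> {c, q1, q2} \<times> (V - {a, c, q1, q2}) \<noteq> {}"
          using no_cut_vertex[of a "{c, q1, q2}"] fin3 by simp
        then show False using cN N1 N2 by auto
      qed
    next
      case nsub: False
      then obtain v where v: "v \<in> Y" "v \<notin> {a, c}" by blast
      have e: "e = (v, q2)" using to2'[of v] v q2 by simp
      have vV: "v \<in> V" "v \<noteq> q1" "v \<noteq> q2" using v part False by auto
      have Y: "u \<in> {a, c, v}" if "u \<in> Y" for u using to2'[of u] that q2 e by auto
      have vq: "(v, q1) \<in> A" using to1[of v] v vV by auto
      show False
      proof (cases "a \<in> Y")
        case True
        show False
        proof (cases "c \<in> Y")
          case cY: True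
          have Yeq: "x \<in> Y \<longleftrightarrow> x = a \<or> x = c \<or> x = v" for x using Y True cY v by blast
          show False by (rule closed1[of a c q1 q2 v e])
            (use N1 N2 un'[of a] un'[of c] un'[of v] e inV vV in \<open>auto simp: Yeq\<close>)
        next
          case cY: False
          have Yeq: "x \<in> Y \<longleftrightarrow> x = a \<or> x = v" for x using Y True cY v by blast
          show False by (rule closed1[of a v q1 q2 v "(q2, c)"])
            (use N1 N2 un'[of a] un'[of v] e inV vV in \<open>auto simp: Yeq\<close>)
        qed
      next
        case False
        then have "c \<notin> Y" using ca e ne by auto
        then have Yeq: "x \<in> Y \<longleftrightarrow> x = v" for x using Y False v by blast
        have "(v, q2) \<in> A" using to2[of v] vV v by auto
        then have "((v, x) \<in> A) = (x = q1 \<or> x = q2)" for x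
          using un'[of v x] v e vq mem[of v x] by (auto simp: Yeq)
        then show False using no by blast
      qed
    qed
  qed
qed

text \<open>A tournament has one arc per pair of vertices; the form avoids division and
  subtraction.\<close>

lemma inner_count:
  assumes "Z \<subseteq> V"
  shows "2 * card (A \<inter> Z \<times> Z) + card Z = card Z * card Z"
proof -
  let ?B = "A \<inter> Z \<times> Z"
  have f: "finite Z" "finite ?B" using assms fin finite_subset by blast+
  have eq: "Z \<times> Z = ?B \<union> ?B\<inverse> \<union> Id_on Z"
  proof
    show "Z \<times> Z \<subseteq> ?B \<union> ?B\<inverse> \<union> Id_on Z"
    proof
      fix z assume "z \<in> Z \<times> Z"
      then obtain u v where "z = (u, v)" "u \<in> Z" "v \<in> Z" by blast
      then show "z \<in> ?B \<union> ?B\<inverse> \<union> Id_on Z" using adj[of u v] assms by (cases "u = v") auto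
    qed
  qed auto
  have "?B \<inter> ?B\<inverse> = {}" using anti by auto
  moreover have "(?B \<union> ?B\<inverse>) \<inter> Id_on Z = {}" using irr by auto
  moreover have "Id_on Z = (\<lambda>x. (x, x)) ` Z" by auto
  then have "card (Id_on Z) = card Z" "finite (Id_on Z)" using f by (simp_all add: card_image inj_on_def)
  ultimately have "card (?B \<union> ?B\<inverse> \<union> Id_on Z) = card ?B + card (?B\<inverse>) + card Z"
    using f by (simp add: card_Un_disjoint)
  then have "card (Z \<times> Z) = card ?B + card (?B\<inverse>) + card Z" using eq by metis
  then show ?thesis by (simp add: card_inverse card_cartesian_product)
qed

lemma leaving_count:
  assumes "Z \<subseteq> V"
  shows "card (leaving A Z) + card (A \<inter> Z \<times> Z) = (\<Sum>z \<in> Z. card {x. (z, x) \<in> A})"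
proof -
  have f: "finite Z" "finite A" using assms fin AV finite_subset by blast+
  have "finite {x. (z, x) \<in> A}" for z
    by (rule finite_subset[OF _ fin]) (use AV in auto)
  then have "(\<Sum>z \<in> Z. card {x. (z, x) \<in> A}) = card (SIGMA z:Z. {x. (z, x) \<in> A})"
    using f by (simp add: card_SigmaI)
  also have "(SIGMA z:Z. {x. (z, x) \<in> A}) = leaving A Z \<union> A \<inter> Z \<times> Z" unfolding leaving_def by auto
  also have "card \<dots> = card (leaving A Z) + card (A \<inter> Z \<times> Z)"
  proof (rule card_Un_disjoint)
    show "finite (leaving A Z)" by (rule finite_subset[OF _ f(2)]) (auto simp: leaving_def)
  qed (use f in \<open>auto simp: leaving_def\<close>)
  finally show ?thesis by simp
qed

lemma finite_leaving: "finite (leaving A Z)"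
  by (rule finite_subset[of _ "V \<times> V"]) (use AV fin in \<open>auto simp: leaving_def\<close>)

lemma outle2_card: "outle2 q \<Longrightarrow> card {x. (q, x) \<in> A} \<le> 2"
proof -
  assume "outle2 q"
  then obtain s t where "{x. (q, x) \<in> A} = {s, t}" "s \<noteq> t" by (rule outle2E) auto
  then show ?thesis by simp
qed

text \<open>The four vertices send at most eight arcs, six of which stay inside, so at most two
  leave; \<open>cut3\<close> demands three.\<close>

lemma no_four_outle2:
  assumes "distinct [a, b, c, d]" "outle2 a" "outle2 b" "outle2 c" "outle2 d"
  shows False
proof -
  let ?Z = "{a, b, c, d}"
  have Z: "?Z \<subseteq> V" "card ?Z = 4" using assms unfolding outle2_def by auto
  have "2 * card (A \<inter> ?Z \<times> ?Z) + 4 = 4 * 4" using inner_count[OF Z(1)] Z(2) by simp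
  moreover have "(\<Sum>z \<in> ?Z. card {x. (z, x) \<in> A}) \<le> (\<Sum>z \<in> ?Z. 2)"
    by (rule sum_mono) (use assms outle2_card in auto)
  then have "(\<Sum>z \<in> ?Z. card {x. (z, x) \<in> A}) \<le> 8" using Z(2) by simp
  ultimately have c: "card (leaving A ?Z) \<le> 2" using leaving_count[OF Z(1)] by linarith
  have "2 \<le> card (V - ?Z)" using Z six by (subst card_Diff_subset) auto
  then have no: "\<not> leaving A ?Z \<subseteq> {e, f}" for e f using cut3[OF Z(1)] Z(2) by simp
  \<comment> \<open>Three different leaving arcs are drawn in turn; \<open>undefined\<close> fills
    the place of arcs not yet known.\<close>
  obtain e where e: "e \<in> leaving A ?Z" using no[of undefined undefined] by blast
  obtain f where f: "f \<in> leaving A ?Z" "f \<noteq> e" using no[of e e] by blast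
  obtain g where g: "g \<in> leaving A ?Z" "g \<noteq> e" "g \<noteq> f" using no[of e f] by blast
  have "card {e, f, g} \<le> card (leaving A ?Z)" using e f g finite_leaving by (intro card_mono) auto
  then show False using c f g by simp
qed

lemma in_other:
  assumes "v \<in> V"
  obtains s where "(s, v) \<in> A" "s \<noteq> x"
proof -
  have "card (V - {v}) \<noteq> 0" using six assms fin by simp
  then have "V - {v} \<noteq> {}" by (metis card.empty)
  then have "\<not> leaving A (V - {v}) \<subseteq> {(x, v)}" using cut2[of "V - {v}"] assms by blast
  then show thesis using that mem unfolding leaving_def by blast
qed

text \<open>If \<open>q2\<close> is in \<open>Y\<close>, only the arc of \<open>q1\<close> to
  \<open>a\<close> can miss \<open>Y\<close>, and \<open>closed_insert2\<close> makes
  \<open>X\<close> a single vertex. If \<open>q2\<close> is in \<open>X\<close>, every vertex of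
  \<open>Y\<close> except \<open>b\<close> and \<open>c\<close> points to \<open>q2\<close>, so
  \<open>Y\<close> has at most one other vertex, and the cut conditions leave only
  singletons.\<close>

lemma spread_targets_sides:
  assumes N1: "\<And>x. (q1, x) \<in> A \<longleftrightarrow> x = q2 \<or> x = a" and N2: "\<And>x. (q2, x) \<in> A \<longleftrightarrow> x = b \<or> x = c"
    and ac: "b \<noteq> c" "a \<noteq> b" "a \<noteq> c"
    and YX: "split_at V q1 Y X" "Y \<noteq> {}" "X \<noteq> {}" "A \<inter> Y \<times> X \<subseteq> {e}"
  shows "(\<exists>w. Y = {w} \<and> (w, q1) \<in> A \<and> outle2 w) \<or> X = {a}"
proof -
  have q1: "(q1, q2) \<in> A" "(q1, a) \<in> A" "(q2, b) \<in> A" "(q2, c) \<in> A" using N1 N2 by auto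
  have inV: "q1 \<in> V" "q2 \<in> V" "a \<in> V" "b \<in> V" "c \<in> V" using q1 mem by auto
  have ne: "q1 \<noteq> q2" "q1 \<noteq> a" "q2 \<noteq> b" "q2 \<noteq> c" "q1 \<noteq> c" "q1 \<noteq> b" using q1 mem anti N1 by blast+
  have aq: "a \<noteq> q2"
  proof
    assume "a = q2"
    then show False using closed1[of q1 q1 q1 q1 q1 "(q1, q2)"] N1 inV by auto
  qed
  have to1: "(v, q1) \<in> A" if "v \<in> V" "v \<notin> {q1, q2, a}" for v using into[of v q1] that N1 inV by auto
  have to2: "(v, q2) \<in> A" if "v \<in> V" "v \<notin> {q2, b, c}" for v using into[of v q2] that N2 inV by auto
  have bc: "(b, q1) \<in> A" "(c, q1) \<in> A" "(a, q1) \<notin> A" using to1[of b] to1[of c] inV ne ac q1 anti by auto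
  note part = split_atD[OF YX(1)]
  have un': "(u, v) = e" if "u \<in> Y" "(u, v) \<in> A" "v \<notin> Y" "v \<noteq> q1" for u v
    using YX(4) that part(1)[of v] mem by blast
  have to2': "(v, q2) = e" if "v \<in> Y" "q2 \<in> X" "v \<notin> {b, c}" for v
    using un'[of v q2] to2[of v] that part ne by blast
  show ?thesis
  proof (cases "q2 \<in> Y")
    case True
    show ?thesis
    proof (cases "a \<in> Y")
      case aY: True
      show ?thesis using closed_insert[OF YX(1,3,4)] N1 True aY by auto
    next
      case False
      then have "a \<in> X" using part(1)[of a] inV ne by auto
      moreover have "card X < 2" by (rule closed_insert2[OF YX(1,2,4), of a]) (use N1 True in auto)
      moreover have "finite X" using part(3) fin finite_subset by blast
      ultimately have "X = {a}" by (metis One_nat_def card_le_Suc0_iff_eq less_2_cases_iff less_Suc_eq_le insertI1 is_singletonI' is_singleton_the_elem numeral_2_eq_2 empty_iff singletonD)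
      then show ?thesis ..
    qed
  next
    case False
    then have q2: "q2 \<in> X" using part(1)[of q2] inV ne by auto
    show ?thesis
    proof (cases "Y \<subseteq> {b, c}")
      case True
      have single: ?thesis if "Y = {w}" "(w, q1) \<in> A" for w
      proof -
        have "outle2 w" unfolding outle2_def
        proof (intro conjI exI allI impI)
          show "w \<in> V" using that mem by blast
          fix x assume "(w, x) \<in> A"
          then show "x = q1 \<or> x = snd e" using un'[of w x] that mem[of w x] by (cases "x = q1") auto
        qed
        then show ?thesis using that by blast
      qed
      consider "Y = {b, c}" | "Y = {b}" | "Y = {c}" using True YX(2) by blast
      then show ?thesis
      proof cases
        case 1
        have Yeq: "x \<in> Y \<longleftrightarrow> x = b \<or> x = c" for x using 1 by blast
        have False by (rule closed2[of b c q1 q2 e "(q1, a)"])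
          (use N1 N2 un'[of b] un'[of c] inV ac in \<open>auto simp: Yeq\<close>)
        then show ?thesis ..
      qed (use single bc in auto)
    next
      case nsub: False
      then obtain v where v: "v \<in> Y" "v \<notin> {b, c}" by blast
      have e: "e = (v, q2)" using to2'[of v] v q2 by simp
      have vV: "v \<in> V" "v \<noteq> q1" "v \<noteq> q2" using v part False by auto
      have Y: "u \<in> {b, c, v}" if "u \<in> Y" for u using to2'[of u] that q2 e by auto
      consider "b \<in> Y" "c \<in> Y" | "b \<in> Y" "c \<notin> Y" | "b \<notin> Y" "c \<in> Y" | "b \<notin> Y" "c \<notin> Y" by blast
      then show ?thesis
      proof cases
        case 1
        have Yeq: "x \<in> Y \<longleftrightarrow> x = b \<or> x = c \<or> x = v" for x using 1 Y v by blast
        have False by (rule closed1[of b c q1 q2 v "(q1, a)"])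
          (use N1 N2 un'[of b] un'[of c] un'[of v] v e inV vV in \<open>auto simp: Yeq\<close>)
        then show ?thesis ..
      next
        case 2
        have Yeq: "x \<in> Y \<longleftrightarrow> x = b \<or> x = v" for x using 2 Y v by blast
        have False by (rule closed2[of b v q1 q2 "(q1, a)" "(q2, c)"])
          (use N1 N2 un'[of b] un'[of v] v e inV vV in \<open>auto simp: Yeq\<close>)
        then show ?thesis ..
      next
        case 3
        have Yeq: "x \<in> Y \<longleftrightarrow> x = c \<or> x = v" for x using 3 Y v by blast
        have False by (rule closed2[of c v q1 q2 "(q1, a)" "(q2, b)"])
          (use N1 N2 un'[of c] un'[of v] v e inV vV in \<open>auto simp: Yeq\<close>)
        then show ?thesis ..
      next
        case 4
        then have Yv: "Y = {v}" using Y v by blast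
        have N: "x = q1 \<or> x = q2" if "(v, x) \<in> A" for x using un'[of v x] that Yv mem[of v x] e by auto
        have "v \<noteq> a"
        proof
          assume "v = a"
          then show False using closed1[of a a a a a "(a, q2)"] N bc inV by auto
        qed
        then have "(v, q1) \<in> A" using to1 vV by auto
        moreover have "outle2 v" unfolding outle2_def using N vV by blast
        ultimately show ?thesis using Yv by blast
      qed
    qed
  qed
qed

text \<open>A split at \<open>q1\<close> isolates \<open>a\<close> or an in-neighbour of out-degree
  2. A shortcut to \<open>a\<close> from a suitable in-neighbour of \<open>q1\<close> makes a second
  arc cross in either case; where all in-neighbours of \<open>q1\<close> point to \<open>a\<close>
  already, \<open>b\<close> and \<open>c\<close> supply the two arcs.\<close>

lemma spread_targets:
  assumes N1: "\<And>x. (q1, x) \<in> A \<longleftrightarrow> x = q2 \<or> x = a" and N2: "\<And>x. (q2, x) \<in> A \<longleftrightarrow> x = b \<or> x = c"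
    and ac: "b \<noteq> c" "a \<noteq> b" "a \<noteq> c" "a \<noteq> q2"
  shows False
proof -
  have q1: "(q1, q2) \<in> A" "(q1, a) \<in> A" "(q2, b) \<in> A" "(q2, c) \<in> A" using N1 N2 by auto
  have inV: "q1 \<in> V" "q2 \<in> V" "a \<in> V" "b \<in> V" "c \<in> V" using q1 mem by auto
  have ne: "q1 \<noteq> q2" "q1 \<noteq> a" "q2 \<noteq> b" "q2 \<noteq> c" "q1 \<noteq> c" "q1 \<noteq> b" using q1 mem anti N1 by blast+
  have to1: "(v, q1) \<in> A" if "v \<in> V" "v \<notin> {q1, q2, a}" for v using into[of v q1] that N1 inV by auto
  have bc: "(b, q1) \<in> A" "(c, q1) \<in> A" "(a, q1) \<notin> A" "(q2, q1) \<notin> A"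
    using to1[of b] to1[of c] inV ne ac q1 anti by auto
  note sides = spread_targets_sides[OF N1 N2 ac(1-3)]
  obtain s where s: "(s, a) \<in> A" "s \<noteq> q1" using in_other[OF inV(3)] by metis
  show False
  proof (cases "\<exists>w. (w, q1) \<in> A \<and> outle2 w")
    case True
    then obtain w where w: "(w, q1) \<in> A" "outle2 w" by blast
    obtain t where t: "t \<noteq> q1" "\<And>x. (w, x) \<in> A \<longleftrightarrow> x = q1 \<or> x = t"
      using w outle2E[OF w(2)] by metis
    show False
    proof (cases "t = a")
      case True
      \<comment> \<open>Now \<open>w\<close> points to \<open>q1\<close>, and both point to
        \<open>a\<close>.\<close>
      show False by (rule twin_targets[of w q1 a q2]) (use t True N1 ac in auto)
    next
      case False
      have wa: "(w, a) \<notin> A" using t False ne by auto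
      have wt: "(w, t) \<in> A" "t \<in> V" "t \<noteq> w" "w \<noteq> a" using t(2)[of t] mem w bc by auto
      obtain Y X e where YX: "split_at V q1 Y X" "Y \<noteq> {}" "X \<noteq> {}" "insert (w, a) A \<inter> Y \<times> X \<subseteq> {e}"
        using w(1) q1(2) by (rule spliceE)
      note part = split_atD[OF YX(1)]
      have "A \<inter> Y \<times> X \<subseteq> {e}" using YX(4) by auto
      from sides[OF YX(1-3) this] show False
      proof
        assume "\<exists>w. Y = {w} \<and> (w, q1) \<in> A \<and> outle2 w"
        then obtain w' where w': "Y = {w'}" "(w', q1) \<in> A" "outle2 w'" by blast
        have o: "outle2 q1" "outle2 q2" unfolding outle2_def using N1 N2 inV by blast+
        \<comment> \<open>A second such in-neighbour would be a fourth vertex of out-degree 2 beside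
          \<open>q1\<close>, \<open>q2\<close> and \<open>w\<close>.\<close>
        have "w' = w"
        proof (rule ccontr)
          assume "w' \<noteq> w"
          then show False using no_four_outle2[of q1 q2 w w'] w w' o ne bc mem by auto
        qed
        then have "a \<in> X" "t \<in> X" using part(1)[of a] part(1)[of t] inV wt t ne w' by auto
        then have "(w, a) = e" "(w, t) = e" using YX(4) wt w' \<open>w' = w\<close> by auto
        then show False using False by auto
      next
        assume X: "X = {a}"
        have "w \<in> Y" "s \<in> Y" using part(1)[of w] part(1)[of s] X wt s w mem by auto
        then have "(w, a) = e" "(s, a) = e" using YX(4) X s by auto
        then show False using wa s by auto
      qed
    qed
  next
    case nw: False
    show False
    proof (cases "\<exists>z. (z, q1) \<in> A \<and> (z, a) \<notin> A")
      case True
      then obtain z where z: "(z, q1) \<in> A" "(z, a) \<notin> A" by blast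
      obtain Y X e where YX: "split_at V q1 Y X" "Y \<noteq> {}" "X \<noteq> {}" "insert (z, a) A \<inter> Y \<times> X \<subseteq> {e}"
        using z(1) q1(2) by (rule spliceE)
      note part = split_atD[OF YX(1)]
      have "A \<inter> Y \<times> X \<subseteq> {e}" using YX(4) by auto
      from sides[OF YX(1-3) this] have X: "X = {a}" using nw by auto
      have "z \<in> Y" "s \<in> Y" using part(1)[of z] part(1)[of s] X s z mem bc by auto
      then have "(z, a) = e" "(s, a) = e" using YX(4) X s by auto
      then show False using z s by auto
    next
      case False
      obtain Y X e where YX: "split_at V q1 Y X" "Y \<noteq> {}" "X \<noteq> {}" "A \<inter> Y \<times> X \<subseteq> {e}"
        using inV(1) by (rule deleteE)
      note part = split_atD[OF YX(1)]
      have X: "X = {a}" using sides[OF YX(1-4)] nw by blast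
      have "(b, a) \<in> A" "(c, a) \<in> A" using False bc by auto
      moreover have "b \<in> Y" "c \<in> Y" using part(1)[of b] part(1)[of c] X inV ne ac by auto
      ultimately have "(b, a) = e" "(c, a) = e" using YX(4) X by auto
      then show False using ac by auto
    qed
  qed
qed

text \<open>Two such vertices are adjacent; the cases differ in whether the other target of the tail
  is also a target of the head.\<close>

lemma outle2_unique:
  assumes "outle2 p" "outle2 q"
  shows "p = q"
proof (rule ccontr)
  assume ne: "p \<noteq> q"
  have F: False if o: "outle2 q1" "outle2 q2" and arc: "(q1, q2) \<in> A" for q1 q2
  proof -
    obtain a where a: "a \<noteq> q2" "\<And>x. (q1, x) \<in> A \<longleftrightarrow> x = q2 \<or> x = a" using outle2E[OF o(1)] arc by metis
    obtain b c where bc: "b \<noteq> c" "\<And>x. (q2, x) \<in> A \<longleftrightarrow> x = b \<or> x = c" using outle2E[OF o(2)] by metis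
    consider "a = b" | "a = c" | "a \<noteq> b" "a \<noteq> c" by blast
    then show False
    proof cases
      case 1
      then show False using twin_targets[OF a(2), of c] bc by blast
    next
      case 2
      then show False using twin_targets[OF a(2), of b] bc by blast
    next
      case 3
      then show False using spread_targets[OF a(2) bc(2)] a bc by blast
    qed
  qed
  have "p \<in> V" "q \<in> V" using assms unfolding outle2_def by auto
  then show False using adj[of p q] ne F assms by blast
qed

end

section \<open>Reversal and trivial splits\<close>

lemma split_at_commute: "split_at V p Y X \<Longrightarrow> split_at V p X Y"
  unfolding split_at_def by (simp add: Un_commute Int_commute)

lemma converse_subset_singleton:
  assumes "A \<inter> Y \<times> X \<subseteq> {e}"
  shows "A\<inverse> \<inter> X \<times> Y \<subseteq> {prod.swap e}"
proof
  fix z assume z: "z \<in> A\<inverse> \<inter> X \<times> Y"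
  obtain u v where uv: "z = (u, v)" by (cases z)
  then have "(v, u) \<in> A \<inter> Y \<times> X" using z by simp
  then have "e = (v, u)" using assms by (metis subsetD singletonD)
  then show "z \<in> {prod.swap e}" using uv by simp
qed

context critical_tournament
begin

text \<open>Reversal exchanges the two sides of each cut and split and preserves all conditions, so
  every statement on out-degrees has a dual on in-degrees.\<close>

lemma converse_critical: "critical_tournament V (A\<inverse>)"
proof
  show "finite V" "A\<inverse> \<subseteq> V \<times> V" "6 \<le> card V" using fin AV six by auto
  show "(v, u) \<notin> A\<inverse>" if "(u, v) \<in> A\<inverse>" for u v using that anti by auto
  show "(u, v) \<in> A\<inverse> \<or> (v, u) \<in> A\<inverse>" if "u \<in> V" "v \<in> V" "u \<noteq> v" for u v using that adj by auto
  show "\<not> leaving (A\<inverse>) Z \<subseteq> {e}" if Z: "Z \<subseteq> V" "Z \<noteq> V" "Z \<noteq> {}" for Z e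
  proof -
    have "\<not> leaving A (V - Z) \<subseteq> {prod.swap e}" by (rule cut2) (use Z in auto)
    then show ?thesis using leaving_converse[OF AV Z(1)] by auto
  qed
  show "\<not> leaving (A\<inverse>) Z \<subseteq> {e, f}" if Z: "Z \<subseteq> V" "2 \<le> card Z" "2 \<le> card (V - Z)" for Z e f
  proof -
    have "V - (V - Z) = Z" using Z by auto
    then have "\<not> leaving A (V - Z) \<subseteq> {prod.swap e, prod.swap f}" by (intro cut3) (use Z in auto)
    then show ?thesis using leaving_converse[OF AV Z(1)] by auto
  qed
  show "A\<inverse> \<inter> Y \<times> X \<noteq> {}" if YX: "split_at V p Y X" "2 \<le> card Y" "2 \<le> card X" for p Y X
  proof -
    have "split_at V p X Y" using YX(1) by (rule split_at_commute)
    then have "A \<inter> X \<times> Y \<noteq> {}" using YX(2,3) by (intro no_cut_vertex)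
    then show ?thesis by auto
  qed
  show "\<exists>Y X e. split_at V p Y X \<and> Y \<noteq> {} \<and> X \<noteq> {} \<and> A\<inverse> \<inter> Y \<times> X \<subseteq> {e}" if p: "p \<in> V" for p
  proof -
    obtain Y X e where YX: "split_at V p Y X" "Y \<noteq> {}" "X \<noteq> {}" "A \<inter> Y \<times> X \<subseteq> {e}" using p by (rule deleteE)
    then show ?thesis
      by (intro exI[of _ X] exI[of _ Y] exI[of _ "prod.swap e"] conjI split_at_commute[OF YX(1)]
          converse_subset_singleton[OF YX(4)])
  qed
  show "\<exists>Y X e. split_at V p Y X \<and> Y \<noteq> {} \<and> X \<noteq> {} \<and> insert (w, y) (A\<inverse>) \<inter> Y \<times> X \<subseteq> {e}"
    if "(w, p) \<in> A\<inverse>" "(p, y) \<in> A\<inverse>" for w p y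
  proof -
    have "(y, p) \<in> A" "(p, w) \<in> A" using that by auto
    then obtain Y X e where YX: "split_at V p Y X" "Y \<noteq> {}" "X \<noteq> {}" "insert (y, w) A \<inter> Y \<times> X \<subseteq> {e}" by (rule spliceE)
    have "(insert (y, w) A)\<inverse> = insert (w, y) (A\<inverse>)" by auto
    then have "insert (w, y) (A\<inverse>) \<inter> X \<times> Y \<subseteq> {prod.swap e}" using converse_subset_singleton[OF YX(4)] by simp
    then show ?thesis using YX
      by (intro exI[of _ X] exI[of _ Y] exI[of _ "prod.swap e"] conjI split_at_commute[OF YX(1)])
  qed
qed

definition inle2 :: "'a \<Rightarrow> bool" where
  "inle2 q \<longleftrightarrow> q \<in> V \<and> (\<exists>s t. \<forall>x. (x, q) \<in> A \<longrightarrow> x = s \<or> x = t)"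

lemma converse_outle2: "critical_tournament.outle2 V (A\<inverse>) q \<longleftrightarrow> inle2 q"
  unfolding critical_tournament.outle2_def[OF converse_critical] inle2_def by simp

lemma converse_inle2: "critical_tournament.inle2 V (A\<inverse>) q \<longleftrightarrow> outle2 q"
  unfolding critical_tournament.inle2_def[OF converse_critical] outle2_def by simp

lemma inle2_unique: "inle2 p \<Longrightarrow> inle2 q \<Longrightarrow> p = q"
  using critical_tournament.outle2_unique[OF converse_critical] by (simp add: converse_outle2)

lemma inle2E:
  assumes "inle2 q"
  obtains s t where "s \<noteq> t" "\<And>x. (x, q) \<in> A \<longleftrightarrow> x = s \<or> x = t"
proof -
  have "critical_tournament.outle2 V (A\<inverse>) q" using assms by (simp add: converse_outle2)
  then obtain s t where st: "s \<noteq> t" "\<And>x. (q, x) \<in> A\<inverse> \<longleftrightarrow> x = s \<or> x = t"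
    by (rule critical_tournament.outle2E[OF converse_critical]) blast
  then show thesis using that[of s t] by simp
qed

lemma out_other:
  assumes "v \<in> V"
  obtains s where "(v, s) \<in> A" "s \<noteq> x"
  by (rule critical_tournament.in_other[OF converse_critical assms, where x = x]) (use that in auto)

text \<open>By \<open>delete\<close> some split with at most one crossing arc and nonempty parts
  exists; here one part of it is a single vertex, which \<open>trivial_source\<close> and
  \<open>trivial_sink\<close> identify.\<close>

definition trivially_split :: "'a \<Rightarrow> bool" where
  "trivially_split p \<longleftrightarrow> (\<forall>Y X e. split_at V p Y X \<longrightarrow> A \<inter> Y \<times> X \<subseteq> {e} \<longrightarrow> card Y < 2 \<or> card X < 2)"

lemma trivial_source:
  assumes YX: "split_at V p {y} X" "A \<inter> {y} \<times> X \<subseteq> {e}"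
  shows "outle2 y \<and> (y, p) \<in> A"
proof -
  note part = split_atD[OF YX(1)]
  have y: "y \<in> V" using part(2) by simp
  have N: "x = p \<or> x = snd e" if "(y, x) \<in> A" for x
    using that part(1)[of x] mem[of y x] YX(2) by auto
  obtain s where s: "(y, s) \<in> A" "s \<noteq> snd e" using y by (rule out_other)
  then show ?thesis unfolding outle2_def using N y by blast
qed

lemma trivial_sink:
  assumes YX: "split_at V p Y {x}" "A \<inter> Y \<times> {x} \<subseteq> {e}"
  shows "inle2 x \<and> (p, x) \<in> A"
proof -
  have "split_at V p {x} Y" "A\<inverse> \<inter> {x} \<times> Y \<subseteq> {prod.swap e}"
    using split_at_commute[OF YX(1)] converse_subset_singleton[OF YX(2)] by auto
  then have "critical_tournament.outle2 V (A\<inverse>) x \<and> (x, p) \<in> A\<inverse>"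
    by (rule critical_tournament.trivial_source[OF converse_critical])
  then show ?thesis by (simp add: converse_outle2)
qed

lemma trivially_splitE:
  assumes p: "trivially_split p" and YX: "split_at V p Y X" "Y \<noteq> {}" "X \<noteq> {}" "A \<inter> Y \<times> X \<subseteq> {e}"
  obtains y where "Y = {y}" "outle2 y" "(y, p) \<in> A" | x where "X = {x}" "inle2 x" "(p, x) \<in> A"
proof -
  have f: "finite Y" "finite X" using split_atD(2,3)[OF YX(1)] fin finite_subset by blast+
  have "card Y < 2 \<or> card X < 2" using p YX unfolding trivially_split_def by blast
  then have "card Y = 1 \<or> card X = 1" using f YX(2,3) by (metis One_nat_def card_gt_0_iff less_2_cases less_not_refl)
  then show thesis
  proof
    assume "card Y = 1"
    then obtain y where "Y = {y}" by (auto simp: card_1_singleton_iff)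
    then show thesis using that(1) trivial_source YX by blast
  next
    assume "card X = 1"
    then obtain x where "X = {x}" by (auto simp: card_1_singleton_iff)
    then show thesis using that(2) trivial_sink YX by blast
  qed
qed

text \<open>Splits at \<open>p\<close> could then only isolate the unique vertex \<open>w\<close> of
  out-degree 2, an in-neighbour of \<open>p\<close>. A shortcut from \<open>w\<close> to an
  out-neighbour of \<open>p\<close> that is not the second target of \<open>w\<close> makes two arcs
  cross.\<close>

lemma not_trivially_split_if_no_inle2:
  assumes p: "p \<in> V" "trivially_split p" and no: "\<And>u. inle2 u \<Longrightarrow> (p, u) \<notin> A"
  shows False
proof (cases "\<exists>w. outle2 w \<and> (w, p) \<in> A")
  case True
  then obtain w where w: "outle2 w" "(w, p) \<in> A" by blast
  obtain t where t: "t \<noteq> p" "\<And>x. (w, x) \<in> A \<longleftrightarrow> x = p \<or> x = t" using outle2E[OF w(1)] w(2) by metis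
  obtain y where y: "(p, y) \<in> A" "y \<noteq> t" using p(1) by (rule out_other)
  have ne: "y \<noteq> p" "y \<noteq> w" "t \<noteq> w" "t \<in> V" "y \<in> V" using y t w anti mem by blast+
  obtain Y X e where YX: "split_at V p Y X" "Y \<noteq> {}" "X \<noteq> {}" "insert (w, y) A \<inter> Y \<times> X \<subseteq> {e}"
    using w(2) y(1) by (rule spliceE)
  have "A \<inter> Y \<times> X \<subseteq> {e}" using YX(4) by auto
  from p(2) YX(1-3) this show False
  proof (rule trivially_splitE)
    fix v assume v: "Y = {v}" "outle2 v"
    then have "v = w" using outle2_unique w(1) by blast
    then have "y \<in> X" "t \<in> X" using split_atD(1)[OF YX(1)] v ne t(1) by auto
    then have "(w, y) = e" "(w, t) = e" using YX(4) v \<open>v = w\<close> t(2) by auto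
    then show False using y by auto
  qed (use no in blast)
next
  case False
  obtain Y X e where "split_at V p Y X" "Y \<noteq> {}" "X \<noteq> {}" "A \<inter> Y \<times> X \<subseteq> {e}" using p(1) by (rule deleteE)
  with p(2) show False by (rule trivially_splitE) (use False no in blast)+
qed

lemma trivially_split_converse: "critical_tournament.trivially_split V (A\<inverse>) p \<longleftrightarrow> trivially_split p"
proof -
  have "card Y < 2 \<or> card X < 2"
    if "trivially_split p" "split_at V p Y X" "A\<inverse> \<inter> Y \<times> X \<subseteq> {e}" for Y X e
  proof -
    have "A \<inter> X \<times> Y \<subseteq> {prod.swap e}" using converse_subset_singleton[OF that(3)] by simp
    moreover have "split_at V p X Y" using that(2) by (rule split_at_commute)
    ultimately show ?thesis using that(1) unfolding trivially_split_def by blast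
  qed
  moreover have "card Y < 2 \<or> card X < 2"
    if "critical_tournament.trivially_split V (A\<inverse>) p" "split_at V p Y X" "A \<inter> Y \<times> X \<subseteq> {e}" for Y X e
  proof -
    have "A\<inverse> \<inter> X \<times> Y \<subseteq> {prod.swap e}" using converse_subset_singleton[OF that(3)] .
    moreover have "split_at V p X Y" using that(2) by (rule split_at_commute)
    ultimately show ?thesis using that(1) unfolding critical_tournament.trivially_split_def[OF converse_critical] by blast
  qed
  ultimately show ?thesis
    unfolding trivially_split_def critical_tournament.trivially_split_def[OF converse_critical] by blast
qed

text \<open>If the arc from \<open>w\<close> to \<open>u\<close> were absent, it could serve as the
  shortcut through \<open>p\<close>. The resulting split would isolate \<open>w\<close> or
  \<open>u\<close>, but each of these has a second crossing arc besides the shortcut.\<close>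

lemma trivially_split_triangle:
  assumes p: "p \<in> V" "trivially_split p"
  obtains w u where "outle2 w" "inle2 u" "(w, p) \<in> A" "(p, u) \<in> A" "(w, u) \<in> A"
proof -
  obtain u where u: "inle2 u" "(p, u) \<in> A" using not_trivially_split_if_no_inle2[OF p] by blast
  obtain w where w: "outle2 w" "(w, p) \<in> A"
  proof -
    have "\<not> (\<forall>u. outle2 u \<longrightarrow> (u, p) \<notin> A)"
      using critical_tournament.not_trivially_split_if_no_inle2[OF converse_critical p(1)] p(2)
      by (auto simp: trivially_split_converse converse_inle2)
    then show thesis using that by blast
  qed
  have "(w, u) \<in> A"
  proof (rule ccontr)
    assume wu: "(w, u) \<notin> A"
    obtain t where t: "t \<noteq> p" "\<And>x. (w, x) \<in> A \<longleftrightarrow> x = p \<or> x = t" using outle2E[OF w(1)] w(2) by metis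
    obtain s where s: "s \<noteq> p" "\<And>x. (x, u) \<in> A \<longleftrightarrow> x = p \<or> x = s" using inle2E[OF u(1)] u(2) by metis
    have a: "(w, t) \<in> A" "(s, u) \<in> A" using s t by auto
    have ne: "u \<noteq> w" "u \<noteq> p" "w \<noteq> p" "t \<noteq> w" "s \<noteq> u" "t \<in> V" "s \<in> V" "u \<in> V" "w \<in> V" using a u w anti mem by blast+
    obtain Y X e where YX: "split_at V p Y X" "Y \<noteq> {}" "X \<noteq> {}" "insert (w, u) A \<inter> Y \<times> X \<subseteq> {e}"
      using w(2) u(2) by (rule spliceE)
    have "A \<inter> Y \<times> X \<subseteq> {e}" using YX(4) by auto
    from p(2) YX(1-3) this show False
    proof (rule trivially_splitE)
      fix v assume v: "Y = {v}" "outle2 v"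
      then have "v = w" using outle2_unique w(1) by blast
      then have "u \<in> X" "t \<in> X" using split_atD(1)[OF YX(1)] v ne t(1) by auto
      then have "(w, u) = e" "(w, t) = e" using YX(4) v \<open>v = w\<close> a by auto
      then show False using wu a by auto
    next
      fix v assume v: "X = {v}" "inle2 v"
      then have "v = u" using inle2_unique u(1) by blast
      then have "w \<in> Y" "s \<in> Y" using split_atD(1)[OF YX(1)] v ne s(1) by auto
      then have "(w, u) = e" "(s, u) = e" using YX(4) v \<open>v = u\<close> a by auto
      then show False using wu a by auto
    qed
  qed
  then show thesis using that u w by blast
qed

text \<open>Otherwise every vertex would be one of the two out-neighbours of the unique vertex of
  out-degree 2.\<close>

lemma not_all_trivially_split: "\<exists>p \<in> V. \<not> trivially_split p"
proof (rule ccontr)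
  assume all: "\<not> (\<exists>p \<in> V. \<not> trivially_split p)"
  have tri: "\<exists>w u. outle2 w \<and> inle2 u \<and> (w, p) \<in> A" if p: "p \<in> V" for p
    using trivially_split_triangle[OF p] all p by blast
  have "card V \<noteq> 0" using six by simp
  then obtain q where "q \<in> V" by fastforce
  then obtain w where w: "outle2 w" using tri by blast
  obtain s t where st: "\<And>x. (w, x) \<in> A \<longleftrightarrow> x = s \<or> x = t" using outle2E[OF w] by blast
  have "V \<subseteq> {s, t}"
  proof
    fix p assume "p \<in> V"
    then obtain w' where "outle2 w'" "(w', p) \<in> A" using tri by blast
    then show "p \<in> {s, t}" using outle2_unique[OF _ w] st by auto
  qed
  then have "card V \<le> card {s, t}" by (intro card_mono) auto
  then show False using six card_length[of "[s, t]"] by simp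
qed

section \<open>Nontrivial splits with a smallest source side\<close>

text \<open>An uncrossing argument. Given a nontrivial split \<open>Y'\<close>, \<open>X'\<close> at
  \<open>p'\<close>, every arc between \<open>Y \<inter> X'\<close> and \<open>X \<inter> Y'\<close>
  crosses one of the two splits, so these sets span at most two pairs. Minimality of
  \<open>Y\<close> compares their sizes and reduces both to single vertices; then nothing enters
  \<open>X \<inter> X'\<close>.\<close>

lemma trivially_split_in_minimal:
  assumes YX: "split_at V p Y X" "2 \<le> card X" "A \<inter> Y \<times> X \<subseteq> {(t0, x0)}"
    and t0: "(t0, x0) \<in> A" "t0 \<in> Y" "x0 \<in> X"
    and min: "\<And>p' Y' X' e. split_at V p' Y' X' \<Longrightarrow> A \<inter> Y' \<times> X' \<subseteq> {e} \<Longrightarrow>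
      2 \<le> card Y' \<Longrightarrow> 2 \<le> card X' \<Longrightarrow> card Y \<le> card Y'"
    and y: "y1 \<in> Y" "y2 \<in> Y" "y1 \<noteq> y2" "(y1, p) \<in> A" "(y2, p) \<in> A"
    and p': "p' \<in> Y" "p' \<noteq> y1" "p' \<noteq> y2" "p' \<noteq> t0"
  shows "trivially_split p'"
  unfolding trivially_split_def
proof (intro allI impI, rule ccontr)
  fix Y' X' e1
  assume YX': "split_at V p' Y' X'" "A \<inter> Y' \<times> X' \<subseteq> {e1}" and "\<not> (card Y' < 2 \<or> card X' < 2)"
  then have c': "2 \<le> card Y'" "2 \<le> card X'" by auto
  note P = split_atD[OF YX(1)] and P' = split_atD[OF YX'(1)]
  have f0: "u = t0 \<and> v = x0" if "u \<in> Y" "v \<in> X" "(u, v) \<in> A" for u v using that YX(3) by blast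
  have f1: "(u, v) = e1" if "u \<in> Y'" "v \<in> X'" "(u, v) \<in> A" for u v using that YX'(2) by blast
  have fY: "finite Y" "finite X" "finite Y'" "finite X'" using P(2,3) P'(2,3) fin finite_subset by blast+
  have "card {y1, y2, p'} \<le> card Y" using y p' fY by (intro card_mono) auto
  then have c3: "3 \<le> card Y" using y p' by simp
  \<comment> \<open>If at most one arc crossed after \<open>s\<close> is moved to \<open>X\<close>,
    the new split would contradict minimality.\<close>
  have small: "\<not> A \<inter> (Y - {s}) \<times> insert s X \<subseteq> {e}" if s: "s \<in> Y" for s e
  proof
    assume sub: "A \<inter> (Y - {s}) \<times> insert s X \<subseteq> {e}"
    have sp: "split_at V p (Y - {s}) (insert s X)" using YX(1) s unfolding split_at_def by auto
    have "card (Y - {s}) = card Y - 1" using s fY by simp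
    moreover have "card X \<le> card (insert s X)" using fY by (simp add: card_insert_le)
    ultimately show False using min[OF sp sub] c3 YX(2) by linarith
  qed
  define A0 where "A0 = Y \<inter> X'"
  define B where "B = X \<inter> Y'"
  have pp: "p \<noteq> p'" using p' P(4) by auto
  have pV: "p \<in> Y' \<or> p \<in> X'" using P'(1)[of p] P(7) pp by auto
  have Yc: "v = p' \<or> v \<in> Y' \<or> v \<in> A0" if "v \<in> Y" for v using P'(1)[of v] P(2) that unfolding A0_def by blast
  have Xc: "v \<in> B \<or> v \<in> X'" if "v \<in> X" for v
    using P'(1)[of v] P(3,8) p' that unfolding B_def by blast
  have pairs: "s = t0 \<and> t = x0 \<or> (t, s) = e1" if "s \<in> A0" "t \<in> B" for s t
  proof -
    have st: "s \<in> Y" "s \<in> X'" "t \<in> X" "t \<in> Y'" using that unfolding A0_def B_def by auto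
    have "s \<noteq> t" using st P(8) by auto
    then have "(s, t) \<in> A \<or> (t, s) \<in> A" using adj[of s t] st P(2,3) by auto
    then show ?thesis using f0[of s t] f1[of t s] st by auto
  qed
  have A0ne: "A0 \<noteq> {}"
  proof
    assume A0: "A0 = {}"
    then have YY: "v \<in> Y'" if "v \<in> Y" "v \<noteq> p'" for v using Yc that by blast
    show False
    proof (cases "p \<in> Y'")
      case True
      have "v \<in> Y'" if v: "(p', v) \<in> A" for v
      proof (rule ccontr)
        assume "v \<notin> Y'"
        then have "v \<in> X" using v mem[of p' v] P(1)[of v] YY True by blast
        then show False using f0[of p' v] p' v by auto
      qed
      moreover have "X' \<noteq> {}" using c' by auto
      ultimately show False using closed_insert[OF YX'(1) _ YX'(2)] by blast
    next
      case False
      then have "p \<in> X'" using pV by simp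
      then have "(y1, p) = e1" "(y2, p) = e1" using f1 YY y p' by auto
      then show False using y by auto
    qed
  qed
  \<comment> \<open>\<open>Y\<close> consists of \<open>p'\<close>, \<open>Y \<inter> Y'\<close> and
    \<open>A0\<close>, while \<open>Y'\<close> consists of \<open>Y \<inter> Y'\<close>,
    \<open>B\<close> and possibly \<open>p\<close>.\<close>
  have ineq: "card A0 + 1 \<le> card B + (if p \<in> Y' then 1 else 0)"
  proof -
    define M where "M = Y \<inter> Y'"
    have fM: "finite M" "finite A0" "finite B" unfolding M_def A0_def B_def using fY by auto
    have "Y = insert p' (M \<union> A0)" using Yc p' unfolding M_def A0_def by blast
    moreover have "p' \<notin> M \<union> A0" using P'(4,5) unfolding M_def A0_def by blast
    moreover have "M \<inter> A0 = {}" using P'(6) unfolding M_def A0_def by blast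
    ultimately have "card Y = 1 + card M + card A0" using fM by (simp add: card_Un_disjoint)
    moreover have "card Y' \<le> card (M \<union> B) + card (Y' \<inter> {p})"
    proof -
      have "Y' \<subseteq> (M \<union> B) \<union> (Y' \<inter> {p})" using P'(2) P(1) unfolding M_def B_def by blast
      then have "card Y' \<le> card ((M \<union> B) \<union> (Y' \<inter> {p}))" using fM by (intro card_mono) auto
      also have "\<dots> \<le> card (M \<union> B) + card (Y' \<inter> {p})" by (rule card_Un_le)
      finally show ?thesis .
    qed
    moreover have "card (M \<union> B) \<le> card M + card B" by (rule card_Un_le)
    moreover have "card (Y' \<inter> {p}) = (if p \<in> Y' then 1 else 0)" by auto
    moreover have "card Y \<le> card Y'" using min[OF YX' c'] .
    ultimately show ?thesis by linarith
  qed
  have fAB: "finite A0" "finite B" unfolding A0_def B_def using fY by auto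
  obtain s where s: "s \<in> A0" using A0ne by blast
  have single: "A0 = {s}"
  proof (rule ccontr)
    assume "A0 \<noteq> {s}"
    then obtain s' where s': "s' \<in> A0" "s' \<noteq> s" using s by blast
    have "card {s, s'} \<le> card A0" using s s' fAB by (intro card_mono) auto
    then have "2 \<le> card A0" using s' by simp
    then have "\<not> card B \<le> Suc 0" using ineq by (auto split: if_splits)
    then obtain t t' where t: "t \<in> B" "t' \<in> B" "t \<noteq> t'" using fAB(2) by (auto simp: card_le_Suc0_iff_eq)
    \<comment> \<open>Two vertices in each set give four pairs, but only two arcs are
      available.\<close>
    show False using pairs[OF s t(1)] pairs[OF s t(2)] pairs[OF s'(1) t(1)] pairs[OF s'(1) t(2)] s'(2) t(3) by auto
  qed
  have sY: "s \<in> Y" "s \<in> X'" "s \<noteq> p'" using s P'(5) unfolding A0_def by auto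
  have Ys: "v \<in> Y'" if "v \<in> Y" "v \<noteq> p'" "v \<noteq> s" for v using Yc that single by blast
  \<comment> \<open>When the crossing arc starts in \<open>s\<close>, moving \<open>s\<close> to
    \<open>X\<close> leaves only arcs into \<open>s\<close> as crossing arcs. One of them does not
    start in \<open>p'\<close>, so it goes from \<open>Y'\<close> to \<open>X'\<close> and is
    \<open>e1\<close>.\<close>
  have obt: "\<exists>m. m \<in> Y' \<and> m \<in> Y \<and> (m, s) = e1" if ts: "t0 = s"
  proof -
    obtain u v where uv: "(u, v) \<in> A" "u \<in> Y - {s}" "v \<in> insert s X" "(u, v) \<noteq> (p', s)"
      using small[OF sY(1), of "(p', s)"] by auto
    have "v = s" using f0[of u v] uv ts by auto
    then have "u \<in> Y'" using Ys[of u] uv by auto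
    then have "(u, s) = e1" using f1 uv sY \<open>v = s\<close> by auto
    then show ?thesis using \<open>u \<in> Y'\<close> uv by auto
  qed
  have Bne: "B \<noteq> {}" using ineq single by (auto split: if_splits)
  \<comment> \<open>In both cases \<open>x0\<close> is the only vertex of \<open>B\<close> and
    \<open>e1\<close> ends in \<open>s\<close>.\<close>
  obtain t z where t: "B = {t}" "x0 = t" "e1 = (z, s)"
  proof (cases "\<exists>t \<in> B. s = t0 \<and> t = x0")
    case True
    then obtain m where m: "m \<in> Y" "(m, s) = e1" using obt by blast
    have "t' = x0" if "t' \<in> B" for t'
      using pairs[OF s that] m P(8)[OF m(1)] that unfolding B_def by auto
    then have "B = {x0}" using Bne by blast
    then show thesis using that[of x0 m] m by auto
  next
    case False
    then have all: "(t, s) = e1" if "t \<in> B" for t using pairs[OF s that] that by blast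
    then obtain t where t: "B = {t}" "(t, s) = e1" using Bne by (metis is_singletonI' is_singleton_def prod.inject singletonI)
    then have tX: "t \<in> X" "t \<in> Y'" unfolding B_def by auto
    have "t0 \<noteq> s"
    proof
      assume "t0 = s"
      then obtain m where "m \<in> Y" "(m, s) = e1" using obt by blast
      then show False using t tX P(8) by auto
    qed
    then have "t0 \<in> Y'" using Ys t0 p' by auto
    moreover have "x0 \<notin> X'"
    proof
      assume "x0 \<in> X'"
      then have "(t0, x0) = e1" using f1 \<open>t0 \<in> Y'\<close> t0 by auto
      then show False using t t0(2) tX P(8) by auto
    qed
    ultimately have "x0 \<in> B" using Xc t0 by auto
    then show thesis using that[of t t] t by auto
  qed
  have pY': "p \<in> Y'" using ineq t(1) single by (auto split: if_splits)
  \<comment> \<open>An arc into \<open>X \<inter> X'\<close> from outside starts in \<open>Y\<close>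
    or in \<open>Y'\<close>. In the first case it ends in \<open>x0\<close>, which is in
    \<open>Y'\<close>; in the second it ends in \<open>s\<close>, which is in \<open>Y\<close>. The
    vertex \<open>p\<close> is covered because it lies in \<open>Y'\<close>.\<close>
  define Z where "Z = V - (X \<inter> X')"
  have none: False if uv: "(u, v) \<in> A" "u \<in> Z" "v \<notin> Z" for u v
  proof -
    have v: "v \<in> X" "v \<in> X'" using uv mem unfolding Z_def by auto
    have u: "u \<in> V" "\<not> (u \<in> X \<and> u \<in> X')" using uv unfolding Z_def by auto
    have "v \<noteq> t" using t(1) v P'(8) unfolding B_def by auto
    then have "u \<notin> Y" using f0[of u v] v uv t by auto
    then have "u \<in> Y'" using P(1)[of u] u pY' Xc unfolding B_def by auto
    then have "v = s" using f1[of u v] uv v t by auto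
    then show False using v sY P(8) by auto
  qed
  have "leaving A Z \<subseteq> {undefined}" using none unfolding leaving_def by auto
  moreover have "Z \<noteq> {}" "Z \<subseteq> V" using P(5,7) unfolding Z_def by auto
  ultimately have "Z = V" using cut2 by blast
  then have "X \<subseteq> {t}" using Xc t(1) P(3) unfolding Z_def by blast
  then have "card X \<le> 1" by (metis card.empty card_mono finite.emptyI finite_insert card_insert_disjoint empty_iff One_nat_def)
  then show False using YX(2) by simp
qed

lemma out_card:
  assumes "v \<in> V"
  shows "2 \<le> card {x. (v, x) \<in> A}" "\<not> outle2 v \<Longrightarrow> 3 \<le> card {x. (v, x) \<in> A}"
proof -
  have f: "finite {x. (v, x) \<in> A}" by (rule finite_subset[OF _ fin]) (use AV in auto)
  obtain s where s: "(v, s) \<in> A" using assms by (rule out_other)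
  obtain t where t: "(v, t) \<in> A" "t \<noteq> s" using assms by (rule out_other)
  have "card {s, t} \<le> card {x. (v, x) \<in> A}" using s t f by (intro card_mono) auto
  then show "2 \<le> card {x. (v, x) \<in> A}" using t by simp
  assume "\<not> outle2 v"
  then obtain r where r: "(v, r) \<in> A" "r \<noteq> s" "r \<noteq> t" unfolding outle2_def using assms by blast
  have "card {s, t, r} \<le> card {x. (v, x) \<in> A}" using s t r f by (intro card_mono) auto
  then show "3 \<le> card {x. (v, x) \<in> A}" using t r by simp
qed

text \<open>At most one vertex of \<open>Z\<close> has out-degree 2, all others at least 3.\<close>

lemma out_sum:
  assumes "Z \<subseteq> V"
  shows "3 * card Z \<le> (\<Sum>z \<in> Z. card {x. (z, x) \<in> A}) + 1"
proof -
  have f: "finite Z" using assms fin finite_subset by blast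
  have le: "(\<Sum>z \<in> W. 3) \<le> (\<Sum>z \<in> W. card {x. (z, x) \<in> A})" if "W \<subseteq> Z" "\<And>w. w \<in> W \<Longrightarrow> \<not> outle2 w" for W
    by (rule sum_mono) (use that assms out_card(2) in blast)
  show ?thesis
  proof (cases "\<exists>w \<in> Z. outle2 w")
    case True
    then obtain w where w: "w \<in> Z" "outle2 w" by blast
    have "(\<Sum>z \<in> Z - {w}. 3) \<le> (\<Sum>z \<in> Z - {w}. card {x. (z, x) \<in> A})"
      by (rule le) (use w outle2_unique in auto)
    moreover have "(\<Sum>z \<in> Z. card {x. (z, x) \<in> A}) = card {x. (w, x) \<in> A} + (\<Sum>z \<in> Z - {w}. card {x. (z, x) \<in> A})"
      using f w(1) by (rule sum.remove)
    moreover have "2 \<le> card {x. (w, x) \<in> A}" using out_card(1) w assms by blast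
    moreover have "card Z = card (Z - {w}) + 1" using f w(1) by (metis Suc_eq_plus1 card_Suc_Diff1)
    ultimately show ?thesis by simp
  next
    case False
    then show ?thesis using le[of Z] by simp
  qed
qed

text \<open>Apart from one pair, every vertex of \<open>X\<close> points to every vertex of
  \<open>Y\<close>. The vertex \<open>p'\<close> lies in a triangle with \<open>u\<close> of
  in-degree 2 and \<open>w\<close> of out-degree 2. The arc from \<open>p'\<close> cannot lead into
  \<open>X\<close>, and for any other place of \<open>u\<close> either \<open>u\<close> has a third
  in-neighbour or \<open>w\<close> a third out-neighbour.\<close>

theorem contradiction: False
proof -
  define NT where "NT = (\<lambda>p Y X. split_at V p Y X \<and> 2 \<le> card Y \<and> 2 \<le> card X \<and> (\<exists>e. A \<inter> Y \<times> X \<subseteq> {e}))"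
  have "\<exists>n p Y X. NT p Y X \<and> card Y = n"
    using not_all_trivially_split unfolding trivially_split_def NT_def by (meson not_less)
  then have "\<exists>n. (\<exists>p Y X. NT p Y X \<and> card Y = n) \<and> (\<forall>m < n. \<not> (\<exists>p Y X. NT p Y X \<and> card Y = m))"
    by (rule exists_least_iff[THEN iffD1])
  then obtain p Y X where nt: "NT p Y X" and least: "\<And>p' Y' X'. NT p' Y' X' \<Longrightarrow> card Y \<le> card Y'"
    by (metis not_less)
  have YX: "split_at V p Y X" "2 \<le> card Y" "2 \<le> card X" using nt unfolding NT_def by auto
  note P = split_atD[OF YX(1)]
  have fY: "finite Y" "finite X" using P(2,3) fin finite_subset by blast+
  obtain e where "A \<inter> Y \<times> X \<subseteq> {e}" using nt unfolding NT_def by auto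
  moreover have "A \<inter> Y \<times> X \<noteq> {}" using no_cut_vertex YX by blast
  ultimately have "A \<inter> Y \<times> X = {e}" by blast
  moreover obtain t0 x0 where "e = (t0, x0)" by (cases e)
  ultimately have e: "A \<inter> Y \<times> X = {(t0, x0)}" by simp
  have t0: "(t0, x0) \<in> A" "t0 \<in> Y" "x0 \<in> X" using e by blast+
  have f0: "u = t0 \<and> v = x0" if "u \<in> Y" "v \<in> X" "(u, v) \<in> A" for u v using that e by blast
  have pX: "v = p \<or> v \<in> X" if "(u, v) \<in> A" "v \<notin> Y" for u v using P(1)[of v] mem that by blast
  define T where "T = {y \<in> Y. (y, p) \<in> A}"
  have fT: "finite T" unfolding T_def using fY by simp
  have cutY: "leaving A Y \<subseteq> insert (t0, x0) ((\<lambda>y. (y, p)) ` T)"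
  proof
    fix z assume "z \<in> leaving A Y"
    then obtain u v where "z = (u, v)" "(u, v) \<in> A" "u \<in> Y" "v \<notin> Y" by (auto simp: leaving_def)
    then show "z \<in> insert (t0, x0) ((\<lambda>y. (y, p)) ` T)" using f0[of u v] pX[of u v] unfolding T_def by auto
  qed
  have "V - Y = insert p X" using YX(1) unfolding split_at_def by auto
  then have cVY: "2 \<le> card (V - Y)" using YX(3) fY P(5) by simp
  \<comment> \<open>With a single arc from \<open>Y\<close> to \<open>p\<close>, at most two arcs
    would leave \<open>Y\<close>.\<close>
  have T2: "\<not> T \<subseteq> {y}" for y
  proof
    assume "T \<subseteq> {y}"
    then have "leaving A Y \<subseteq> {(t0, x0), (y, p)}" using cutY by blast
    then show False using cut3[OF P(2) YX(2) cVY] by blast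
  qed
  \<comment> \<open>Besides \<open>t0\<close>, \<open>p'\<close> has to avoid two in-neighbours of
    \<open>p\<close>. If \<open>Y\<close> is within \<open>{s1, s2, t0}\<close>, either the
    out-degrees are too large for the arcs available, or \<open>T\<close> has a third member and
    \<open>p'\<close> is taken from \<open>T\<close>.\<close>
  obtain p' y1 y2 where p': "p' \<in> Y" "p' \<noteq> t0" and y: "y1 \<in> T" "y2 \<in> T" "y1 \<noteq> y2" "y1 \<noteq> p'" "y2 \<noteq> p'"
  proof -
    obtain s1 where s1: "s1 \<in> T" using T2 by blast
    obtain s2 where s2: "s2 \<in> T" "s2 \<noteq> s1" using T2[of s1] by blast
    show thesis
    proof (cases "Y \<subseteq> {s1, s2, t0}")
      case False
      then show thesis using that s1 s2 by blast
    next
      case True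
      show thesis
      proof (cases "T \<subseteq> {s1, s2}")
        case sub: True
        have n3: "card Y \<le> 3" using card_mono[OF _ True] card_length[of "[s1, s2, t0]"] by simp
        have "(\<lambda>y. (y, p)) ` T \<subseteq> {(s1, p), (s2, p)}" using sub by blast
        then have "leaving A Y \<subseteq> {(t0, x0), (s1, p), (s2, p)}" using cutY by blast
        then have "card (leaving A Y) \<le> card {(t0, x0), (s1, p), (s2, p)}" by (intro card_mono) auto
        also have "\<dots> \<le> 3" using card_length[of "[(t0, x0), (s1, p), (s2, p)]"] by simp
        finally have "card (leaving A Y) \<le> 3" .
        then have a: "3 * card Y \<le> 4 + card (A \<inter> Y \<times> Y)" using out_sum[OF P(2)] leaving_count[OF P(2)] by linarith
        \<comment> \<open>The out-degrees in \<open>Y\<close> sum to at least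
          \<open>3 * card Y - 1\<close>, while at most three arcs leave \<open>Y\<close>: at least 5
          against at most 4 for two vertices, 8 against 6 for three.\<close>
        have b: "2 * card (A \<inter> Y \<times> Y) + card Y = card Y * card Y" by (rule inner_count[OF P(2)])
        have "card Y = 2 \<or> card Y = 3" using n3 YX(2) by linarith
        then show thesis using a b by auto
      next
        case False
        then obtain r where r: "r \<in> T" "r \<noteq> s1" "r \<noteq> s2" by blast
        have rY: "s1 \<in> Y" "s2 \<in> Y" "r \<in> Y" using r s1 s2 unfolding T_def by auto
        show thesis
        proof (cases "s1 = t0")
          case True
          then show thesis using that[of s2 s1 r] s1 s2 r rY by auto
        next
          case False
          then show thesis using that[of s1 s2 r] s1 s2 r rY by auto
        qed
      qed
    qed
  qed
  have yY: "y1 \<in> Y" "y2 \<in> Y" "(y1, p) \<in> A" "(y2, p) \<in> A" using y unfolding T_def by auto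
  have "trivially_split p'"
  proof (rule trivially_split_in_minimal[OF YX(1,3) _ t0 _ yY(1,2) y(3) yY(3,4)])
    show "card Y \<le> card Y'"
      if "split_at V p' Y' X'" "A \<inter> Y' \<times> X' \<subseteq> {e}" "2 \<le> card Y'" "2 \<le> card X'" for p' Y' X' e
      using least[of p' Y' X'] that unfolding NT_def by blast
  qed (use e p' y in auto)
  moreover have "p' \<in> V" using p' P(2) by blast
  ultimately obtain w u where wu: "outle2 w" "inle2 u" "(w, p') \<in> A" "(p', u) \<in> A" "(w, u) \<in> A"
    using trivially_split_triangle by blast
  obtain r s where inu: "\<And>x. (x, u) \<in> A \<longleftrightarrow> x = r \<or> x = s" using inle2E[OF wu(2)] by blast
  obtain r' s' where outw: "\<And>x. (w, x) \<in> A \<longleftrightarrow> x = r' \<or> x = s'" using outle2E[OF wu(1)] by blast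
  have three: False if "(a, u) \<in> A" "(b, u) \<in> A" "(c, u) \<in> A" "a \<noteq> b" "a \<noteq> c" "b \<noteq> c" for a b c
    using that inu by auto
  have bk: "(x, v) \<in> A" if "x \<in> X" "v \<in> Y" "x \<noteq> x0 \<or> v \<noteq> t0" for x v
    using f0[of v x] adj[of x v] that P(2,3) P(8)[of v] by blast
  \<comment> \<open>Being different from \<open>x0\<close>, \<open>x\<close> points to every vertex
    of \<open>Y\<close>.\<close>
  obtain x where x: "x \<in> X" "x \<noteq> x0" using YX(3) t0(3) fY(2)
    by (metis card_le_Suc0_iff_eq not_less_eq_eq numeral_2_eq_2)
  have xp: "x \<noteq> p'" "x0 \<noteq> p'" using x t0 p' P(8) by auto
  consider "u \<in> X" | "u = p" | "u \<in> Y" using P(1)[of u] mem[OF wu(4)] by blast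
  then show False
  proof cases
    case 1
    then show False using f0[of p' u] p' wu by auto
  next
    case 2
    then show False using three[of y1 y2 p'] yY y wu by auto
  next
    case 3
    have xu: "(x, u) \<in> A" using bk x 3 by auto
    show False
    proof (cases "u = t0")
      case False
      then show False using three[of x x0 p'] bk[of x0 u] t0 3 xu x xp wu by auto
    next
      case True
      have "w \<noteq> p'" using wu(3) irr by auto
      \<comment> \<open>\<open>u\<close> already has the in-neighbours \<open>x\<close> and
        \<open>p'\<close>, so \<open>w\<close> is \<open>x\<close>; but \<open>x\<close> has three
        out-neighbours in \<open>Y\<close>.\<close>
      then have "w = x" using three[of x p' w] xu wu xp by auto
      then have "(w, y1) \<in> A" "(w, y2) \<in> A" "(w, p') \<in> A" using bk x yY wu by auto
      then show False using outw y by auto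
    qed
  qed
qed

end

section \<open>From a counterexample to a critical tournament\<close>

lemma split_at_if_not_two_arc_strong:
  assumes "\<not> two_arc_strong (V - {p}) C" "p \<in> V"
  shows "\<exists>Y X e. split_at V p Y X \<and> Y \<noteq> {} \<and> X \<noteq> {} \<and> C \<inter> Y \<times> X \<subseteq> {e}"
proof -
  obtain Z e where Z: "Z \<subset> V - {p}" "Z \<noteq> {}" "leaving (C \<inter> (V - {p}) \<times> (V - {p})) Z \<subseteq> {e}"
    using assms(1) unfolding two_arc_strong_def by blast
  have "C \<inter> Z \<times> (V - {p} - Z) \<subseteq> leaving (C \<inter> (V - {p}) \<times> (V - {p})) Z"
    using Z(1) unfolding leaving_def by auto
  then have "C \<inter> Z \<times> (V - {p} - Z) \<subseteq> {e}" using Z(3) by (rule subset_trans)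
  moreover have "split_at V p Z (V - {p} - Z)" using Z assms(2) unfolding split_at_def by auto
  moreover have "V - {p} - Z \<noteq> {}" using Z(1) by auto
  ultimately show ?thesis using Z(2) by blast
qed

lemma is_S4_card:
  assumes "is_S4 V A"
  shows "card V = 4"
proof -
  obtain a b c d where "distinct [a, b, c, d]" "V = {a, b, c, d}" using assms unfolding is_S4_def by blast
  then show ?thesis by simp
qed

text \<open>\<open>cut3\<close> and \<open>no_cut_vertex\<close> are contrapositives of
  \<open>good_tight\<close> and \<open>good_cut_vertex\<close>. For \<open>delete\<close> and
  \<open>splice\<close>, the digraph without \<open>p\<close> has at least five vertices and is not
  S4, so a decomposition of it would extend by \<open>good_attach\<close> or
  \<open>good_split\<close>.\<close>

lemma critical_if_not_good:
  fixes A :: "'a rel"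
  assumes sc: "semicomp V A" and ts: "two_arc_strong V A" and dec: "decomposable_upto TYPE('a) (card V - 1)"
    and V: "6 \<le> card V" and ng: "\<not> good V A" and anti: "\<And>u v. (u, v) \<in> A \<Longrightarrow> (v, u) \<notin> A"
  shows "critical_tournament V A"
proof
  note fin = semicompD(1)[OF sc] and irr = semicompD(2)[OF sc] and AV = semicompD(3)[OF sc]
    and adj = semicompD(4)[OF sc]
  have AVV: "A \<inter> V \<times> V = A" using AV by auto
  have ne: "V \<noteq> {u}" for u using V by auto
  show "finite V" "A \<subseteq> V \<times> V" "6 \<le> card V" by fact+
  show "(v, u) \<notin> A" if "(u, v) \<in> A" for u v using that by (rule anti)
  show "(u, v) \<in> A \<or> (v, u) \<in> A" if "u \<in> V" "v \<in> V" "u \<noteq> v" for u v using that by (rule adj)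
  show "\<not> leaving A Z \<subseteq> {e}" if "Z \<subseteq> V" "Z \<noteq> V" "Z \<noteq> {}" for Z e
    using ts that AVV unfolding two_arc_strong_def by (metis psubsetI)
  show "\<not> leaving A Z \<subseteq> {e, f}" if "Z \<subseteq> V" "2 \<le> card Z" "2 \<le> card (V - Z)" for Z e f
  proof
    assume "leaving A Z \<subseteq> {e, f}"
    then have "good V A" using V by (intro good_tight[OF sc ts dec that]) simp_all
    then show False using ng by simp
  qed
  show "A \<inter> Y \<times> X \<noteq> {}" if YX: "split_at V p Y X" "2 \<le> card Y" "2 \<le> card X" for p Y X
  proof
    assume none: "A \<inter> Y \<times> X = {}"
    have "finite Y" "finite X" using YX(1) fin unfolding split_at_def by auto
    then obtain y1 y2 x1 x2 where "y1 \<in> Y" "y2 \<in> Y" "y1 \<noteq> y2" "x1 \<in> X" "x2 \<in> X" "x1 \<noteq> x2"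
      using YX(2,3) by (metis card_le_Suc0_iff_eq not_less_eq_eq numeral_2_eq_2)
    then have "good V A" using YX(1) none unfolding split_at_def
      by (intro good_cut_vertex[OF sc ts dec, of p Y X y1 y2 x1 x2]) auto
    then show False using ng by simp
  qed
  have cp: "card (V - {p}) = card V - 1" if "p \<in> V" for p using that fin by simp
  have smaller: "good (V - {p}) C"
    if "p \<in> V" "two_arc_strong (V - {p}) C" "semicomp (V - {p}) C" for p C
  proof -
    have "\<not> is_S4 (V - {p}) C" using is_S4_card[of "V - {p}" C] cp[OF that(1)] V by auto
    then show ?thesis using dec that cp[of p] unfolding decomposable_upto_def by simp
  qed
  have scd: "semicomp (V - {p}) (A \<inter> (V - {p}) \<times> (V - {p}))" if "p \<in> V" for p
    unfolding semicomp_def using fin irr adj by (auto simp: irrefl_def)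
  show "\<exists>Y X e. split_at V p Y X \<and> Y \<noteq> {} \<and> X \<noteq> {} \<and> A \<inter> Y \<times> X \<subseteq> {e}" if p: "p \<in> V" for p
  proof -
    let ?C = "A \<inter> (V - {p}) \<times> (V - {p})"
    have "\<not> two_arc_strong (V - {p}) ?C"
    proof
      assume "two_arc_strong (V - {p}) ?C"
      from smaller[OF p this scd[OF p]] have "good (V - {p}) A" by (rule good_mono) blast
      then have "good V A"
      proof (rule good_attach)
        fix v assume "v \<in> V - (V - {p})"
        then have v: "v = p" using p by auto
        obtain a where a: "(a, p) \<in> A" "a \<in> V" "a \<noteq> p" by (rule two_arc_strong_in[OF ts p ne])
        obtain b where "(b, p) \<in> A" "b \<in> V" "b \<noteq> p" "b \<noteq> a" by (rule two_arc_strong_in[OF ts p ne])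
        then show "\<exists>x \<in> V - {p}. \<exists>y \<in> V - {p}. x \<noteq> y \<and> (x, v) \<in> A \<and> (y, v) \<in> A" using a v by blast
        obtain a where a: "(p, a) \<in> A" "a \<in> V" "a \<noteq> p" by (rule two_arc_strong_out[OF ts p ne])
        obtain b where "(p, b) \<in> A" "b \<in> V" "b \<noteq> p" "b \<noteq> a" by (rule two_arc_strong_out[OF ts p ne])
        then show "\<exists>x \<in> V - {p}. \<exists>y \<in> V - {p}. x \<noteq> y \<and> (v, x) \<in> A \<and> (v, y) \<in> A" using a v by blast
      qed auto
      then show False using ng by simp
    qed
    from split_at_if_not_two_arc_strong[OF this p] obtain Y X e where
      YX: "split_at V p Y X" "Y \<noteq> {}" "X \<noteq> {}" "?C \<inter> Y \<times> X \<subseteq> {e}" by blast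
    have "A \<inter> Y \<times> X \<subseteq> ?C \<inter> Y \<times> X" using YX(1) unfolding split_at_def by auto
    then have "A \<inter> Y \<times> X \<subseteq> {e}" using YX(4) by (rule subset_trans)
    then show ?thesis using YX by blast
  qed
  show "\<exists>Y X e. split_at V p Y X \<and> Y \<noteq> {} \<and> X \<noteq> {} \<and> insert (w, y) A \<inter> Y \<times> X \<subseteq> {e}"
    if a: "(w, p) \<in> A" "(p, y) \<in> A" "(w, y) \<notin> A" for w p y
  proof -
    let ?C = "insert (w, y) (A \<inter> (V - {p}) \<times> (V - {p}))"
    have W: "w \<in> V" "p \<in> V" "y \<in> V" "w \<noteq> p" "y \<noteq> p" using a AV irr by (auto simp: irrefl_def)
    have "w \<noteq> y" using a anti by blast
    have "\<not> two_arc_strong (V - {p}) ?C"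
    proof
      assume t: "two_arc_strong (V - {p}) ?C"
      have "semicomp (V - {p}) ?C" unfolding semicomp_def
      proof (intro conjI ballI impI)
        show "irrefl ?C" using irr \<open>w \<noteq> y\<close> by (simp add: irrefl_def)
        show "?C \<subseteq> (V - {p}) \<times> (V - {p})" using W by auto
        show "(u, v) \<in> ?C \<or> (v, u) \<in> ?C" if "u \<in> V - {p}" "v \<in> V - {p}" "u \<noteq> v" for u v
          using adj[of u v] that by auto
      qed (use fin in simp)
      from smaller[OF W(2) t this] have g: "good (V - {p}) ?C" .
      obtain z where z: "(z, p) \<in> A" "z \<in> V" "z \<noteq> p" "z \<noteq> w" by (rule two_arc_strong_in[OF ts W(2) ne])
      obtain u where u: "(p, u) \<in> A" "u \<in> V" "u \<noteq> p" "u \<noteq> y" by (rule two_arc_strong_out[OF ts W(2) ne])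
      have "good V A" by (rule good_split[OF g]) (use W a z u in auto)
      then show False using ng by simp
    qed
    from split_at_if_not_two_arc_strong[OF this W(2)] obtain Y X e where
      YX: "split_at V p Y X" "Y \<noteq> {}" "X \<noteq> {}" "?C \<inter> Y \<times> X \<subseteq> {e}" by blast
    have "insert (w, y) A \<inter> Y \<times> X \<subseteq> ?C \<inter> Y \<times> X" using YX(1) unfolding split_at_def by auto
    then have "insert (w, y) A \<inter> Y \<times> X \<subseteq> {e}" using YX(4) by (rule subset_trans)
    then show ?thesis using YX by blast
  qed
qed

text \<open>Orders up to 4 are settled before the arc set is minimised, since minimisation might end
  in S4.\<close>

theorem good_if_two_arc_strong_semicomp:
  fixes A :: "'a rel"
  assumes "semicomp V A" "two_arc_strong V A" "\<not> is_S4 V A"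
  shows "good V A"
  using assms
proof (induction "card V" arbitrary: V A rule: less_induct)
  case less
  show ?case
  proof (cases "card V \<le> 4")
    case True
    then show ?thesis using good_card_le_four less.prems by blast
  next
    case False
    have dec: "decomposable_upto TYPE('a) (card V - 1)"
      unfolding decomposable_upto_def
    proof (intro allI impI)
      fix W :: "'a set" and B assume "card W \<le> card V - 1" "semicomp W B" "two_arc_strong W B" "\<not> is_S4 W B"
      then show "good W B" using less.hyps[of W B] False by simp
    qed
    have "finite V" "A \<subseteq> V \<times> V" using less.prems(1) unfolding semicomp_def by auto
    then have "finite A" by (simp add: finite_subset)
    let ?F = "{B. B \<subseteq> A \<and> semicomp V B \<and> two_arc_strong V B}"
    have "finite ?F" using \<open>finite A\<close> by simp
    moreover have "A \<in> ?F" using less.prems by simp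
    ultimately have "\<exists>B \<in> ?F. B \<subseteq> A \<and> (\<forall>C \<in> ?F. C \<subseteq> B \<longrightarrow> B = C)" by (rule finite_has_minimal2)
    then obtain B where B: "B \<in> ?F" "\<forall>C \<in> ?F. C \<subseteq> B \<longrightarrow> B = C" by (elim bexE conjE) (rule that)
    then have sc: "semicomp V B" and ts: "two_arc_strong V B" and BA: "B \<subseteq> A" by auto
    have min: "\<not> (semicomp V (B - {e}) \<and> two_arc_strong V (B - {e}))" if "e \<in> B" for e
    proof
      assume "semicomp V (B - {e}) \<and> two_arc_strong V (B - {e})"
      then have "B - {e} \<in> ?F" using BA by auto
      then have "B = B - {e}" using bspec[OF B(2), of "B - {e}"] by simp
      then show False using that by blast
    qed
    have "good V B"
    proof (rule ccontr)
      assume ng: "\<not> good V B"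
      have anti: "(v, u) \<notin> B" if "(u, v) \<in> B" for u v
        using minimal_antisym[OF sc ts dec _ ng min that] False by simp
      show False
      proof (cases "card V = 5")
        case True
        then show False using good_five_tournament[OF sc ts True anti] ng by simp
      next
        case n5: False
        then have "critical_tournament V B" using critical_if_not_good[OF sc ts dec _ ng anti] False by simp
        then show False by (rule critical_tournament.contradiction)
      qed
    qed
    then show ?thesis using BA by (rule good_mono)
  qed
qed

section \<open>Compositions\<close>

text \<open>Only a lower bound on \<open>B\<close>: it may contain further arcs, such as those
  inside the \<open>H u\<close>.\<close>

definition is_blowup :: "'a rel \<Rightarrow> ('a \<Rightarrow> 'b set) \<Rightarrow> ('a \<times> 'b) rel \<Rightarrow> bool" where
  "is_blowup A W B \<longleftrightarrow> (\<forall>u v x y. (u, v) \<in> A \<longrightarrow> x \<in> W u \<longrightarrow> y \<in> W v \<longrightarrow> ((u, x), (v, y)) \<in> B)"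

lemma is_blowupD: "is_blowup A W B \<Longrightarrow> (u, v) \<in> A \<Longrightarrow> x \<in> W u \<Longrightarrow> y \<in> W v \<Longrightarrow> ((u, x), (v, y)) \<in> B"
  unfolding is_blowup_def by blast

lemma rtrancl_map_prod: "(u, v) \<in> R\<^sup>* \<Longrightarrow> (g u, g v) \<in> (map_prod g g ` R)\<^sup>*"
  by (induction rule: rtrancl_induct) (auto intro: rtrancl_into_rtrancl)

lemma good_image:
  assumes g: "good V A" and inj: "inj_on g V"
    and B: "\<And>u v. (u, v) \<in> A \<Longrightarrow> u \<in> V \<Longrightarrow> v \<in> V \<Longrightarrow> (g u, g v) \<in> B"
  shows "good (g ` V) B"
proof -
  obtain A1 A2 where A: "A1 \<subseteq> A" "A1 \<subseteq> V \<times> V" "A2 \<subseteq> A" "A2 \<subseteq> V \<times> V" "A1 \<inter> A2 = {}"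
    "strong_on V A1" "strong_on V A2" using g by (rule goodE)
  let ?g = "map_prod g g"
  have "inj_on ?g (V \<times> V)" using inj by (auto simp: inj_on_def)
  then have "?g ` A1 \<inter> ?g ` A2 = ?g ` (A1 \<inter> A2)" using A(2,4) by (metis inj_on_image_Int)
  moreover have "strong_on (g ` V) (?g ` A1)" "strong_on (g ` V) (?g ` A2)"
    using A(6,7) unfolding strong_on_def by (auto intro: rtrancl_map_prod)
  moreover have "?g ` A1 \<subseteq> B" "?g ` A2 \<subseteq> B" using A(1-4) B by fastforce+
  moreover have "?g ` A1 \<subseteq> g ` V \<times> g ` V" "?g ` A2 \<subseteq> g ` V \<times> g ` V" using A(2,4) by auto
  ultimately show ?thesis using A(5) by (intro goodI[of "?g ` A1" _ _ "?g ` A2"]) auto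
qed

text \<open>Arcs between copies depend only on the vertices of \<open>V\<close> below them, so the
  same pairs in \<open>U\<close> serve every new vertex over \<open>u\<close>. The two members of a
  pair may lie over the same vertex, as they do in the Hamiltonian case.\<close>

lemma good_blowup_extend:
  assumes B: "is_blowup A W B" and U: "good U B" "U \<subseteq> (SIGMA u:V. W u)"
    and i: "\<And>u. u \<in> V \<Longrightarrow> \<exists>p \<in> U. \<exists>q \<in> U. p \<noteq> q \<and> (fst p, u) \<in> A \<and> (fst q, u) \<in> A"
    and o: "\<And>u. u \<in> V \<Longrightarrow> \<exists>p \<in> U. \<exists>q \<in> U. p \<noteq> q \<and> (u, fst p) \<in> A \<and> (u, fst q) \<in> A"
  shows "good (SIGMA u:V. W u) B"
proof (rule good_attach[OF U])
  fix v assume "v \<in> (SIGMA u:V. W u) - U"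
  then obtain u x where v: "v = (u, x)" "u \<in> V" "x \<in> W u" by auto
  obtain p q where pq: "p \<in> U" "q \<in> U" "p \<noteq> q" "(fst p, u) \<in> A" "(fst q, u) \<in> A" using i[OF v(2)] by blast
  then have "(p, v) \<in> B" "(q, v) \<in> B"
    using is_blowupD[OF B, of "fst p" u "snd p" x] is_blowupD[OF B, of "fst q" u "snd q" x] U(2) v by auto
  then show "\<exists>x \<in> U. \<exists>y \<in> U. x \<noteq> y \<and> (x, v) \<in> B \<and> (y, v) \<in> B" using pq by blast
  obtain p q where pq: "p \<in> U" "q \<in> U" "p \<noteq> q" "(u, fst p) \<in> A" "(u, fst q) \<in> A" using o[OF v(2)] by blast
  then have "(v, p) \<in> B" "(v, q) \<in> B"
    using is_blowupD[OF B, of u "fst p" x "snd p"] is_blowupD[OF B, of u "fst q" x "snd q"] U(2) v by auto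
  then show "\<exists>x \<in> U. \<exists>y \<in> U. x \<noteq> y \<and> (v, x) \<in> B \<and> (v, y) \<in> B" using pq by blast
qed

lemma two_arc_strong_neighbours:
  assumes ts: "two_arc_strong V A" and V: "2 \<le> card V" and u: "u \<in> V"
  shows "\<exists>v \<in> V. \<exists>w \<in> V. v \<noteq> w \<and> (u, v) \<in> A \<and> (u, w) \<in> A" "\<exists>v \<in> V. \<exists>w \<in> V. v \<noteq> w \<and> (v, u) \<in> A \<and> (w, u) \<in> A"
proof -
  have ne: "V \<noteq> {u}" using V by auto
  obtain v where v: "(u, v) \<in> A" "v \<in> V" by (rule two_arc_strong_out[OF ts u ne])
  obtain w where "(u, w) \<in> A" "w \<in> V" "w \<noteq> v" by (rule two_arc_strong_out[OF ts u ne])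
  then show "\<exists>v \<in> V. \<exists>w \<in> V. v \<noteq> w \<and> (u, v) \<in> A \<and> (u, w) \<in> A" using v by blast
  obtain v where v: "(v, u) \<in> A" "v \<in> V" by (rule two_arc_strong_in[OF ts u ne])
  obtain w where "(w, u) \<in> A" "w \<in> V" "w \<noteq> v" by (rule two_arc_strong_in[OF ts u ne])
  then show "\<exists>v \<in> V. \<exists>w \<in> V. v \<noteq> w \<and> (v, u) \<in> A \<and> (w, u) \<in> A" using v by blast
qed

lemma good_blowup_two_arc_strong:
  assumes B: "is_blowup A W B" and ts: "two_arc_strong V A" and V: "2 \<le> card V" and g: "good V A"
    and W: "\<And>u. u \<in> V \<Longrightarrow> W u \<noteq> {}"
  shows "good (SIGMA u:V. W u) B"
proof -
  have "\<forall>u \<in> V. \<exists>x. x \<in> W u" using W by blast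
  then obtain f where f: "\<And>u. u \<in> V \<Longrightarrow> f u \<in> W u" using bchoice[of V "\<lambda>u x. x \<in> W u"] by blast
  let ?U = "(\<lambda>u. (u, f u)) ` V"
  show ?thesis
  proof (rule good_blowup_extend[OF B, of ?U])
    show "good ?U B" by (rule good_image[OF g]) (use is_blowupD[OF B] f in \<open>auto simp: inj_on_def\<close>)
    show "?U \<subseteq> (SIGMA u:V. W u)" using f by auto
    fix u assume u: "u \<in> V"
    show "\<exists>p \<in> ?U. \<exists>q \<in> ?U. p \<noteq> q \<and> (fst p, u) \<in> A \<and> (fst q, u) \<in> A"
      "\<exists>p \<in> ?U. \<exists>q \<in> ?U. p \<noteq> q \<and> (u, fst p) \<in> A \<and> (u, fst q) \<in> A"
      using two_arc_strong_neighbours[OF ts V u] by (auto; blast)+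
  qed
qed

text \<open>Doubling one vertex removes the exception: on the five vertices one half is a
  Hamiltonian cycle and the other a closed walk that meets \<open>g c\<close> twice. Rotating the
  deleted four-cycle brings \<open>u\<close> to position \<open>a\<close>.\<close>

lemma good_blowup_S4:
  assumes B: "is_blowup A W B" and ts: "two_arc_strong V A" and S4: "is_S4 V A"
    and W: "\<And>u. u \<in> V \<Longrightarrow> W u \<noteq> {}" and u: "u \<in> V" "x \<in> W u" "x' \<in> W u" "x \<noteq> x'"
  shows "good (SIGMA u:V. W u) B"
proof -
  obtain a b c d where abcd: "distinct [a, b, c, d]" "V = {a, b, c, d}"
    "A = {(a, c), (c, a), (b, d), (d, b), (b, a), (c, b), (d, c), (a, d)}" and au: "a = u"
  proof -
    obtain a b c d where *: "distinct [a, b, c, d]" "V = {a, b, c, d}"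
      "A = {(a, c), (c, a), (b, d), (d, b), (b, a), (c, b), (d, c), (a, d)}"
      using S4 unfolding is_S4_def by blast
    then consider "a = u" | "b = u" | "c = u" | "d = u" using u(1) by blast
    then show thesis
    proof cases
      case 1 then show ?thesis using that[of a b c d] * by simp
    next
      case 2 show ?thesis by (rule that[of b c d a]) (use * 2 in auto)
    next
      case 3 show ?thesis by (rule that[of c d a b]) (use * 3 in auto)
    next
      case 4 show ?thesis by (rule that[of d a b c]) (use * 4 in auto)
    qed
  qed
  obtain f where f: "\<And>v. v \<in> V \<Longrightarrow> f v \<in> W v" "f u = x"
  proof -
    have "\<forall>u \<in> V. \<exists>x. x \<in> W u" using W by blast
    then obtain f where "\<And>u. u \<in> V \<Longrightarrow> f u \<in> W u" using bchoice[of V "\<lambda>u x. x \<in> W u"] by blast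
    then show thesis using that[of "f(u := x)"] u by auto
  qed
  define g where "g = (\<lambda>v. (v, f v))"
  let ?p = "(a, x')"
  let ?U = "{g a, ?p, g b, g c, g d}"
  let ?B1 = "{(g a, g d), (g d, g b), (g b, ?p), (?p, g c), (g c, g a)}"
  let ?B2 = "{(g a, g c), (g c, ?p), (?p, g d), (g d, g c), (g c, g b), (g b, g a)}"
  have fW: "f a \<in> W a" "f b \<in> W b" "f c \<in> W c" "f d \<in> W d" "x' \<in> W a" "f a = x" "x \<noteq> x'"
    using f u au abcd(2) by auto
  have arcs: "?B1 \<subseteq> B" "?B2 \<subseteq> B" using is_blowupD[OF B] abcd(3) fW unfolding g_def by auto
  have "good ?U B"
  proof (rule goodI[of ?B1 _ _ ?B2])
    show "strong_on ?U ?B1" by (rule strong_on_closed_walk[of _ "g a" "[g d, g b, ?p, g c, g a]"]) auto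
    show "strong_on ?U ?B2" by (rule strong_on_closed_walk[of _ "g a" "[g c, ?p, g d, g c, g b, g a]"]) auto
    show "?B1 \<inter> ?B2 = {}" using abcd(1) fW unfolding g_def by auto
  qed (use arcs in auto)
  moreover have "?U \<subseteq> (SIGMA u:V. W u)" using fW abcd(2) unfolding g_def by auto
  ultimately show ?thesis
  proof (rule good_blowup_extend[OF B])
    fix w assume w: "w \<in> V"
    have gU: "g v \<in> ?U" "fst (g v) = v" if "v \<in> V" for v using that abcd(2) unfolding g_def by auto
    have V2: "2 \<le> card V" using abcd(1,2) by simp
    obtain v v' where "v \<in> V" "v' \<in> V" "v \<noteq> v'" "(v, w) \<in> A" "(v', w) \<in> A"
      using two_arc_strong_neighbours(2)[OF ts V2 w] by blast
    then show "\<exists>p \<in> ?U. \<exists>q \<in> ?U. p \<noteq> q \<and> (fst p, w) \<in> A \<and> (fst q, w) \<in> A"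
      using gU by (metis (no_types, lifting))
    obtain v v' where "v \<in> V" "v' \<in> V" "v \<noteq> v'" "(w, v) \<in> A" "(w, v') \<in> A"
      using two_arc_strong_neighbours(1)[OF ts V2 w] by blast
    then show "\<exists>p \<in> ?U. \<exists>q \<in> ?U. p \<noteq> q \<and> (w, fst p) \<in> A \<and> (w, fst q) \<in> A"
      using gU by (metis (no_types, lifting))
  qed
qed

text \<open>The copy of the outer digraph on the vertices \<open>f u\<close> connects the strong
  pieces in the first half, and the copy on the \<open>g u\<close> lies entirely in the second.
  Every vertex has an arc to and an arc from the second copy, and since
  \<open>g u \<noteq> f u\<close> these are not arcs of the first copy.\<close>

lemma good_blowup_strong:
  assumes B: "is_blowup A W B" and inner: "\<And>u x y. u \<in> V \<Longrightarrow> (x, y) \<in> I u \<Longrightarrow> ((u, x), (u, y)) \<in> B"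
    and A: "A \<subseteq> V \<times> V" "irrefl A" "strong_on V A" and V: "2 \<le> card V"
    and I: "\<And>u. u \<in> V \<Longrightarrow> I u \<subseteq> W u \<times> W u \<and> strong_on (W u) (I u)" and W: "\<And>u. u \<in> V \<Longrightarrow> 2 \<le> card (W u)"
  shows "good (SIGMA u:V. W u) B"
proof -
  have "\<exists>x y. x \<in> W u \<and> y \<in> W u \<and> x \<noteq> y" if "u \<in> V" for u
    using W[OF that] by (metis card.infinite card_le_Suc0_iff_eq not_less_eq_eq numeral_2_eq_2 zero_less_Suc le_zero_eq zero_neq_numeral)
  then obtain f g where fg: "\<And>u. u \<in> V \<Longrightarrow> f u \<in> W u \<and> g u \<in> W u \<and> f u \<noteq> g u" by metis
  define B1 where "B1 = {((u, x), (u, y)) | u x y. u \<in> V \<and> (x, y) \<in> I u} \<union> {((u, f u), (v, f v)) | u v. (u, v) \<in> A}"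
  define B2 where "B2 = {((u, x), (v, y)) | u x v y. (u, v) \<in> A \<and> x \<in> W u \<and> y \<in> W v \<and> \<not> (x = f u \<and> y = f v)}"
  let ?Q = "SIGMA u:V. W u"
  have in1: "((u, x), (u, y)) \<in> B1\<^sup>*" if u: "u \<in> V" "x \<in> W u" "y \<in> W u" for u x y
  proof -
    have "(x, y) \<in> (I u)\<^sup>*" using I[OF u(1)] u unfolding strong_on_def by blast
    then have "((u, x), (u, y)) \<in> (map_prod (Pair u) (Pair u) ` I u)\<^sup>*" by (rule rtrancl_map_prod)
    then show ?thesis by (rule rtrancl_mono_mem) (use u in \<open>auto simp: B1_def\<close>)
  qed
  have rep1: "((u, f u), (v, f v)) \<in> B1\<^sup>*" if uv: "u \<in> V" "v \<in> V" for u v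
  proof -
    have "(u, v) \<in> A\<^sup>*" using A(3) uv unfolding strong_on_def by blast
    then have "((u, f u), (v, f v)) \<in> (map_prod (\<lambda>u. (u, f u)) (\<lambda>u. (u, f u)) ` A)\<^sup>*" by (rule rtrancl_map_prod)
    then show ?thesis by (rule rtrancl_mono_mem) (auto simp: B1_def)
  qed
  have s1: "strong_on ?Q B1" unfolding strong_on_def
  proof (intro ballI)
    fix p q assume "p \<in> ?Q" "q \<in> ?Q"
    then obtain u x v y where pq: "p = (u, x)" "q = (v, y)" "u \<in> V" "x \<in> W u" "v \<in> V" "y \<in> W v" by auto
    then show "(p, q) \<in> B1\<^sup>*" using in1[of u x "f u"] rep1[of u v] in1[of v "f v" y] fg by (meson rtrancl_trans)
  qed
  have other: "\<exists>v \<in> V. v \<noteq> u" if "u \<in> V" for u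
  proof (rule ccontr)
    assume "\<not> (\<exists>v \<in> V. v \<noteq> u)"
    then have "V \<subseteq> {u}" by blast
    then have "card V \<le> card {u}" by (intro card_mono) auto
    then show False using V by simp
  qed
  have out: "\<exists>v. (u, v) \<in> A" if u: "u \<in> V" for u
  proof -
    obtain v where "v \<in> V" "v \<noteq> u" using other[OF u] by blast
    then have "(u, v) \<in> A\<^sup>*" "u \<noteq> v" using A(3) u unfolding strong_on_def by auto
    then show ?thesis by (meson converse_rtranclE)
  qed
  have inn: "\<exists>v. (v, u) \<in> A" if u: "u \<in> V" for u
  proof -
    obtain v where "v \<in> V" "v \<noteq> u" using other[OF u] by blast
    then have "(v, u) \<in> A\<^sup>*" "v \<noteq> u" using A(3) u unfolding strong_on_def by auto
    then show ?thesis by (meson rtranclE)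
  qed
  have rep2: "((u, g u), (v, g v)) \<in> B2\<^sup>*" if uv: "u \<in> V" "v \<in> V" for u v
  proof -
    have "(u, v) \<in> A\<^sup>*" using A(3) uv unfolding strong_on_def by blast
    then have "((u, g u), (v, g v)) \<in> (map_prod (\<lambda>u. (u, g u)) (\<lambda>u. (u, g u)) ` A)\<^sup>*" by (rule rtrancl_map_prod)
    moreover have "map_prod (\<lambda>u. (u, g u)) (\<lambda>u. (u, g u)) ` A \<subseteq> B2"
    proof
      fix e assume "e \<in> map_prod (\<lambda>u. (u, g u)) (\<lambda>u. (u, g u)) ` A"
      then obtain u v where "(u, v) \<in> A" "e = ((u, g u), (v, g v))" by auto
      moreover from this have "u \<in> V" "v \<in> V" using A(1) by auto
      ultimately show "e \<in> B2" using fg[of u] fg[of v] unfolding B2_def by auto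
    qed
    ultimately show ?thesis by (rule rtrancl_mono_mem)
  qed
  have s2: "strong_on ?Q B2" unfolding strong_on_def
  proof (intro ballI)
    fix p q assume "p \<in> ?Q" "q \<in> ?Q"
    then obtain u x v y where pq: "p = (u, x)" "q = (v, y)" "u \<in> V" "x \<in> W u" "v \<in> V" "y \<in> W v" by auto
    obtain u' where u': "(u, u') \<in> A" using out pq by blast
    obtain v' where v': "(v', v) \<in> A" using inn pq by blast
    have V': "u' \<in> V" "v' \<in> V" using u' v' A(1) by auto
    have "(p, (u', g u')) \<in> B2" using u' pq fg[OF V'(1)] unfolding B2_def by auto
    moreover have "((v', g v'), q) \<in> B2" using v' pq fg[OF V'(2)] unfolding B2_def by auto
    ultimately show "(p, q) \<in> B2\<^sup>*" using rep2[OF V'] by (meson converse_rtrancl_into_rtrancl rtrancl_into_rtrancl)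
  qed
  show ?thesis
  proof (rule goodI[of B1 _ _ B2])
    show "B1 \<subseteq> B" "B2 \<subseteq> B" unfolding B1_def B2_def
      using inner is_blowupD[OF B] fg A(1) by blast+
    show "B1 \<subseteq> ?Q \<times> ?Q" "B2 \<subseteq> ?Q \<times> ?Q" unfolding B1_def B2_def using A(1) fg I by fast+
    show "B1 \<inter> B2 = {}" unfolding B1_def B2_def using A(2) unfolding irrefl_def by blast
  qed (rule s1 s2)+
qed

section \<open>Recombining two copies of a Hamiltonian cycle\<close>

lemma chain_rtrancl:
  assumes "\<And>i. Suc i < t \<Longrightarrow> (r i, r (Suc i)) \<in> R" "i \<le> j" "j < t"
  shows "(r i, r j) \<in> R\<^sup>*"
  using assms(2,3)
proof (induction j rule: dec_induct)
  case (step n)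
  then have "(r i, r n) \<in> R\<^sup>*" "(r n, r (Suc n)) \<in> R" using assms(1) by auto
  then show ?case by (rule rtrancl_into_rtrancl)
qed simp

lemma untwisted_cycles:
  assumes "\<And>i b. Suc i < t \<Longrightarrow> (r i b, r (Suc i) b) \<in> R" "\<And>b. (r (t - 1) b, r 0 b) \<in> R"
    and "i < t" "j < t"
  shows "(r i b, r j b) \<in> R\<^sup>*"
proof -
  have "(r i b, r (t - 1) b) \<in> R\<^sup>*" using chain_rtrancl[of t "\<lambda>i. r i b" R i "t - 1"] assms by auto
  moreover have "(r 0 b, r j b) \<in> R\<^sup>*" using chain_rtrancl[of t "\<lambda>i. r i b" R 0 j] assms by auto
  ultimately show ?thesis using assms(2) by (meson converse_rtrancl_into_rtrancl rtrancl_trans)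
qed

lemma twisted_cycle:
  assumes step: "\<And>i b. Suc i < t \<Longrightarrow> (r i b, r (Suc i) b) \<in> R" and wrap: "\<And>b. (r (t - 1) b, r 0 (\<not> b)) \<in> R"
    and ij: "i < t" "j < t"
  shows "(r i b, r j b') \<in> R\<^sup>*"
proof -
  have to0: "(r i b, r 0 (\<not> b)) \<in> R\<^sup>*" if "i < t" for i b
  proof -
    have "(r i b, r (t - 1) b) \<in> R\<^sup>*" using chain_rtrancl[of t "\<lambda>i. r i b" R i "t - 1"] step that by auto
    then show ?thesis using wrap[of b] by (rule rtrancl_into_rtrancl)
  qed
  have from0: "(r 0 b, r j b) \<in> R\<^sup>*" for b using chain_rtrancl[of t "\<lambda>i. r i b" R 0 j] step ij by auto
  show ?thesis
  proof (cases "b' = b")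
    case True
    have "(r i b, r 0 (\<not> b)) \<in> R\<^sup>*" "(r 0 (\<not> b), r 0 b) \<in> R\<^sup>*" using to0[of i b] to0[of 0 "\<not> b"] ij by auto
    then show ?thesis using from0[of b] True by (meson rtrancl_trans)
  next
    case False
    then have "b' = (\<not> b)" by auto
    then show ?thesis using to0[OF ij(1), of b] from0[of "\<not> b"] by (meson rtrancl_trans)
  qed
qed

text \<open>
  Each vertex of the Hamiltonian cycle is represented by two copies, told apart by a truth value.
  Between consecutive levels the four arcs form two perfect matchings: one keeps the truth value and
  one swaps it. The predicate s marks the levels at which the swapping matching is used; the resulting
  2-regular digraph is one cycle if the number of swaps is odd and two cycles otherwise.
\<close>

definition level_arcs :: "nat \<Rightarrow> (nat \<Rightarrow> bool \<Rightarrow> 'c) \<Rightarrow> (nat \<Rightarrow> bool) \<Rightarrow> 'c rel" where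
  "level_arcs t r s = {(r i b, r (Suc i mod t) (b \<noteq> s i)) | i b. i < t}"

lemma level_arcsI: "i < t \<Longrightarrow> (r i b, r (Suc i mod t) (b \<noteq> s i)) \<in> level_arcs t r s"
  unfolding level_arcs_def by blast

lemma level_arcs_step: "Suc i < t \<Longrightarrow> (r i b, r (Suc i) (b \<noteq> s i)) \<in> level_arcs t r s"
  using level_arcsI[of i t r b s] by simp

lemma level_arcs_wrap: "0 < t \<Longrightarrow> (r (t - 1) b, r 0 (b \<noteq> s (t - 1))) \<in> level_arcs t r s"
  using level_arcsI[of "t - 1" t r b s] by simp

text \<open>All three patterns have an odd number of swaps. In the last two, exchanging the names of
  the copies at odd levels removes the swaps between consecutive levels and leaves one twist where
  the cycle closes.\<close>

lemma level_arcs_connected: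
  assumes s: "s = (\<lambda>i. i = t - 1) \<or> s = (\<lambda>i. i \<noteq> t - 1) \<and> even t \<or> s = (\<lambda>_. True) \<and> odd t"
    and ij: "i < t" "j < t"
  shows "(r i b, r j b') \<in> (level_arcs t r s)\<^sup>*"
proof (cases "s = (\<lambda>i. i = t - 1)")
  case True
  show ?thesis
  proof (rule twisted_cycle[where t = t])
    show "(r i b, r (Suc i) b) \<in> level_arcs t r s" if "Suc i < t" for i b
    proof -
      have "\<not> s i" using True that by auto
      then show ?thesis using level_arcs_step[OF that, of r b s] by simp
    qed
    show "(r (t - 1) b, r 0 (\<not> b)) \<in> level_arcs t r s" for b
      using level_arcs_wrap[of t r b s] True ij by simp
  qed (rule ij)+
next
  case False
  define q where "q = (\<lambda>i b. r i (b \<noteq> odd i))"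
  have "(q i c, q j c') \<in> (level_arcs t r s)\<^sup>*" for c c'
  proof (rule twisted_cycle[where t = t])
    show "(q i b, q (Suc i) b) \<in> level_arcs t r s" if "Suc i < t" for i b
    proof -
      have "s i" using s False that by auto
      then have "((b \<noteq> odd i) \<noteq> s i) = (b \<noteq> odd (Suc i))" by auto
      then show ?thesis using level_arcs_step[OF that, of r "b \<noteq> odd i" s] unfolding q_def by simp
    qed
    show "(q (t - 1) b, q 0 (\<not> b)) \<in> level_arcs t r s" for b
    proof -
      have "0 < t" using ij by auto
      have "((b \<noteq> odd (t - 1)) \<noteq> s (t - 1)) = (\<not> b)" using s False \<open>0 < t\<close> by auto
      then show ?thesis using level_arcs_wrap[OF \<open>0 < t\<close>, of r "b \<noteq> odd (t - 1)" s] unfolding q_def by simp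
    qed
  qed (rule ij)+
  from this[of "b \<noteq> odd i" "b' \<noteq> odd j"] show ?thesis unfolding q_def by (cases "odd i"; cases "odd j") auto
qed

lemma level_arcs_disjoint:
  assumes inj: "\<And>i j b c. i < t \<Longrightarrow> j < t \<Longrightarrow> r i b = r j c \<Longrightarrow> i = j \<and> b = c"
    and s: "\<And>i. i < t \<Longrightarrow> s i \<noteq> s' i"
  shows "level_arcs t r s \<inter> level_arcs t r s' = {}"
proof (rule ccontr)
  assume "level_arcs t r s \<inter> level_arcs t r s' \<noteq> {}"
  then obtain i b j c where ij: "i < t" "j < t" "r i b = r j c"
    "r (Suc i mod t) (b \<noteq> s i) = r (Suc j mod t) (c \<noteq> s' j)"
    unfolding level_arcs_def by auto
  then have "i = j" "b = c" using inj by blast+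
  moreover have "Suc i mod t < t" using ij by simp
  ultimately have "(b \<noteq> s i) = (b \<noteq> s' i)" using inj ij(4) by blast
  then show False using s[OF ij(1)] by auto
qed

locale hamiltonian_blowup =
  fixes V :: "'a set" and A :: "'a rel" and W :: "'a \<Rightarrow> 'b set" and B :: "('a \<times> 'b) rel"
    and t :: nat and L :: "nat \<Rightarrow> 'a"
  assumes B: "is_blowup A W B" and t: "2 \<le> t"
    and L: "bij_betw L {..<t} V" and arcs: "\<And>i. i < t \<Longrightarrow> (L i, L (Suc i mod t)) \<in> A"
begin

definition selects :: "(nat \<Rightarrow> bool \<Rightarrow> 'b) \<Rightarrow> bool" where
  "selects f \<longleftrightarrow> (\<forall>i < t. f i True \<in> W (L i) \<and> f i False \<in> W (L i) \<and> f i True \<noteq> f i False)"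

definition pos :: "(nat \<Rightarrow> bool \<Rightarrow> 'b) \<Rightarrow> nat \<Rightarrow> bool \<Rightarrow> 'a \<times> 'b" where
  "pos f i b = (L i, f i b)"

definition base :: "(nat \<Rightarrow> bool \<Rightarrow> 'b) \<Rightarrow> ('a \<times> 'b) set" where
  "base f = {pos f i b | i b. i < t}"

lemma L_inj: "i < t \<Longrightarrow> j < t \<Longrightarrow> L i = L j \<Longrightarrow> i = j"
  using L unfolding bij_betw_def inj_on_def by auto

lemma selectsD: "selects f \<Longrightarrow> i < t \<Longrightarrow> f i b \<in> W (L i)"
  unfolding selects_def by (cases b) auto

lemma pos_inj:
  assumes "selects f" "i < t" "j < t" "pos f i b = pos f j c"
  shows "i = j \<and> b = c"
proof -
  have "i = j" using assms L_inj unfolding pos_def by simp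
  moreover have "f i True \<noteq> f i False" using assms(1,2) unfolding selects_def by blast
  ultimately show ?thesis using assms(4) unfolding pos_def by (cases b; cases c) auto
qed

lemma suc_lt: "i < t \<Longrightarrow> Suc i mod t < t" using t by simp

lemma level_arcs_sub:
  assumes "selects f"
  shows "level_arcs t (pos f) s \<subseteq> B" "level_arcs t (pos f) s \<subseteq> base f \<times> base f"
proof -
  show "level_arcs t (pos f) s \<subseteq> B"
  proof
    fix e assume "e \<in> level_arcs t (pos f) s"
    then obtain i b where e: "e = (pos f i b, pos f (Suc i mod t) (b \<noteq> s i))" "i < t" unfolding level_arcs_def by auto
    then show "e \<in> B"
      using is_blowupD[OF B arcs[OF e(2)]] selectsD[OF assms e(2)] selectsD[OF assms suc_lt[OF e(2)]] unfolding pos_def by auto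
  qed
  show "level_arcs t (pos f) s \<subseteq> base f \<times> base f" unfolding level_arcs_def base_def using suc_lt by auto
qed

lemma base_sub: "selects f \<Longrightarrow> base f \<subseteq> (SIGMA u:V. W u)"
  unfolding base_def pos_def using selectsD L unfolding bij_betw_def by auto

lemma pred:
  assumes "i < t"
  obtains j where "j < t" "Suc j mod t = i"
proof (cases i)
  case 0
  then show thesis using that[of "t - 1"] t by simp
next
  case (Suc j)
  then show thesis using that[of j] assms by simp
qed

text \<open>Each further vertex has both copies on the preceding level as in-neighbours and both
  copies on the next level as out-neighbours.\<close>

lemma extend:
  assumes f: "selects f" and g: "good U B" "base f \<subseteq> U" "U \<subseteq> (SIGMA u:V. W u)"
  shows "good (SIGMA u:V. W u) B"
proof (rule good_blowup_extend[OF B g(1,3)])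
  fix u assume "u \<in> V"
  then obtain i where i: "i < t" "u = L i" using L unfolding bij_betw_def by auto
  obtain j where j: "j < t" "Suc j mod t = i" using i(1) by (rule pred)
  have two: "\<exists>p \<in> U. \<exists>q \<in> U. p \<noteq> q \<and> fst p = L k \<and> fst q = L k" if k: "k < t" for k
  proof -
    have "pos f k True \<in> U" "pos f k False \<in> U" using g(2) k unfolding base_def by blast+
    moreover have "pos f k True \<noteq> pos f k False" using pos_inj[OF f k k] by blast
    moreover have "fst (pos f k b) = L k" for b unfolding pos_def by simp
    ultimately show ?thesis by blast
  qed
  show "\<exists>p \<in> U. \<exists>q \<in> U. p \<noteq> q \<and> (fst p, u) \<in> A \<and> (fst q, u) \<in> A" using two[OF j(1)] arcs[OF j(1)] j(2) i(2) by metis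
  show "\<exists>p \<in> U. \<exists>q \<in> U. p \<noteq> q \<and> (u, fst p) \<in> A \<and> (u, fst q) \<in> A" using two[OF suc_lt[OF i(1)]] arcs[OF i(1)] i(2) by metis
qed

lemma ex_selects:
  assumes "\<And>u. u \<in> V \<Longrightarrow> 2 \<le> card (W u)"
  obtains f where "selects f"
proof -
  have "\<forall>i \<in> {..<t}. \<exists>g. g True \<in> W (L i) \<and> g False \<in> W (L i) \<and> g True \<noteq> g False"
  proof
    fix i assume "i \<in> {..<t}"
    then have "2 \<le> card (W (L i))" using assms L unfolding bij_betw_def by auto
    then obtain x y where "x \<in> W (L i)" "y \<in> W (L i)" "x \<noteq> y"
      by (metis card.infinite card_le_Suc0_iff_eq not_less_eq_eq numeral_2_eq_2 zero_less_Suc le_zero_eq zero_neq_numeral)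
    then show "\<exists>g. g True \<in> W (L i) \<and> g False \<in> W (L i) \<and> g True \<noteq> g False"
      by (intro exI[of _ "\<lambda>b. if b then x else y"]) simp
  qed
  from bchoice[OF this] obtain f where
    "\<forall>i \<in> {..<t}. f i True \<in> W (L i) \<and> f i False \<in> W (L i) \<and> f i True \<noteq> f i False" by (elim exE)
  then have "selects f" unfolding selects_def by simp
  then show thesis by (rule that)
qed

lemma strong_base:
  assumes "\<And>i j b c. i < t \<Longrightarrow> j < t \<Longrightarrow> (pos f i b, pos f j c) \<in> R\<^sup>*"
  shows "strong_on (base f) R"
  unfolding strong_on_def base_def using assms by auto

text \<open>One swap against \<open>t - 1\<close> swaps: complementary patterns, and both numbers
  are odd.\<close>

lemma good_even:
  assumes "even t" "\<And>u. u \<in> V \<Longrightarrow> 2 \<le> card (W u)"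
  shows "good (SIGMA u:V. W u) B"
proof -
  obtain f where f: "selects f" using assms(2) by (rule ex_selects)
  let ?A1 = "level_arcs t (pos f) (\<lambda>i. i = t - 1)" and ?A2 = "level_arcs t (pos f) (\<lambda>i. i \<noteq> t - 1)"
  have "good (base f) B"
  proof (rule goodI[of ?A1 _ _ ?A2])
    show "?A1 \<inter> ?A2 = {}" by (rule level_arcs_disjoint) (use pos_inj[OF f] in auto)
    show "strong_on (base f) ?A1" by (rule strong_base, rule level_arcs_connected) auto
    show "strong_on (base f) ?A2" by (rule strong_base, rule level_arcs_connected) (use assms(1) in auto)
  qed (use level_arcs_sub[OF f] in auto)
  then show ?thesis by (rule extend[OF f _ subset_refl base_sub[OF f]])
qed

text \<open>
  For odd t the untwisted half consists of two disjoint cycles, which have to be joined in both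
  directions by additional arcs.
\<close>

lemma untwisted_connected:
  assumes sub: "level_arcs t (pos f) (\<lambda>_. False) \<subseteq> R"
    and c: "\<And>b. \<exists>i < t. \<exists>j < t. (pos f i b, pos f j (\<not> b)) \<in> R\<^sup>*"
    and ij: "i < t" "j < t"
  shows "(pos f i b, pos f j b') \<in> R\<^sup>*"
proof -
  have same: "(pos f i b, pos f j b) \<in> R\<^sup>*" if "i < t" "j < t" for i j b
  proof (rule untwisted_cycles[where t = t and r = "pos f"])
    show "(pos f i b, pos f (Suc i) b) \<in> R" if "Suc i < t" for i b
      using level_arcs_step[OF that, of "pos f" b "\<lambda>_. False"] sub by auto
    show "(pos f (t - 1) b, pos f 0 b) \<in> R" for b
      using level_arcs_wrap[of t "pos f" b "\<lambda>_. False"] sub t by auto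
  qed (rule that)+
  show ?thesis
  proof (cases "b' = b")
    case False
    obtain k l where kl: "k < t" "l < t" "(pos f k b, pos f l (\<not> b)) \<in> R\<^sup>*" using c by blast
    have "b' = (\<not> b)" using False by auto
    then show ?thesis using same[OF ij(1) kl(1), of b] kl(3) same[OF kl(2) ij(2), of "\<not> b"] by (meson rtrancl_trans)
  qed (use same ij in simp)
qed

text \<open>Swapping at all levels gives a single cycle for odd \<open>t\<close>; the two inner arcs
  join the two cycles of the other half, one in each direction.\<close>

lemma good_odd_arcs:
  assumes odd: "odd t" and W: "\<And>u. u \<in> V \<Longrightarrow> 2 \<le> card (W u)"
    and u: "u \<in> V" "x \<in> W u" "y \<in> W u" "x \<noteq> y" "((u, x), (u, y)) \<in> B"
    and v: "v \<in> V" "x' \<in> W v" "y' \<in> W v" "x' \<noteq> y'" "((v, x'), (v, y')) \<in> B" and uv: "u \<noteq> v"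
  shows "good (SIGMA u:V. W u) B"
proof -
  obtain g where g: "selects g" using W by (rule ex_selects)
  obtain i where i: "i < t" "u = L i" using L u unfolding bij_betw_def by auto
  obtain j where j: "j < t" "v = L j" using L v unfolding bij_betw_def by auto
  have ij: "i \<noteq> j" using uv i j by auto
  \<comment> \<open>\<open>x\<close> is the copy \<open>True\<close> at level \<open>i\<close>,
    whereas \<open>x'\<close> is the copy \<open>False\<close> at level \<open>j\<close>, so the
    inner arcs run in opposite directions between the cycles.\<close>
  define f where "f = g(i := (\<lambda>b. if b then x else y), j := (\<lambda>b. if b then y' else x'))"
  have f: "selects f" using g u v i j ij unfolding selects_def f_def by auto
  have p: "pos f i True = (u, x)" "pos f i False = (u, y)" "pos f j True = (v, y')" "pos f j False = (v, x')"
    unfolding pos_def f_def using i j ij by auto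
  let ?A1 = "level_arcs t (pos f) (\<lambda>_. True)"
  let ?C = "{((u, x), (u, y)), ((v, x'), (v, y'))}"
  let ?A2 = "level_arcs t (pos f) (\<lambda>_. False) \<union> ?C"
  have C: "?C \<subseteq> base f \<times> base f" unfolding base_def p[symmetric] using i(1) j(1) by blast
  have "good (base f) B"
  proof (rule goodI[of ?A1 _ _ ?A2])
    have "?A1 \<inter> level_arcs t (pos f) (\<lambda>_. False) = {}" by (rule level_arcs_disjoint) (use pos_inj[OF f] in auto)
    moreover have "fst (fst e) \<noteq> fst (snd e)" if e: "e \<in> ?A1" for e
    proof -
      obtain k b where k: "k < t" "e = (pos f k b, pos f (Suc k mod t) (b \<noteq> True))" using e unfolding level_arcs_def by auto
      have "Suc k mod t \<noteq> k" using k(1) t by (cases "Suc k = t") auto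
      then show ?thesis using L_inj[OF suc_lt[OF k(1)] k(1)] k(2) unfolding pos_def by auto
    qed
    then have "?A1 \<inter> ?C = {}" by fastforce
    ultimately show "?A1 \<inter> ?A2 = {}" by blast
    show "strong_on (base f) ?A1" by (rule strong_base, rule level_arcs_connected) (use odd in auto)
    show "strong_on (base f) ?A2"
    proof (rule strong_base, rule untwisted_connected)
      show "\<exists>k < t. \<exists>l < t. (pos f k b, pos f l (\<not> b)) \<in> ?A2\<^sup>*" for b
      proof (cases b)
        case True
        have "(pos f i True, pos f i False) \<in> ?A2\<^sup>*" unfolding p by blast
        then show ?thesis using True i(1) by auto
      next
        case False
        have "(pos f j False, pos f j True) \<in> ?A2\<^sup>*" unfolding p by blast
        then show ?thesis using False j(1) by auto
      qed
    qed auto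
  qed (use level_arcs_sub[OF f] C u v in auto)
  then show ?thesis by (rule extend[OF f _ subset_refl base_sub[OF f]])
qed

text \<open>A third vertex on a level is joined to both copies on the levels before and after, so a
  path through it can change from one cycle to the other.\<close>

lemma detour_vertex:
  assumes f: "selects f" and i: "i < t" and z: "z \<in> W (L i)" "z \<noteq> f i True" "z \<noteq> f i False"
  obtains j k where "j < t" "k < t" "\<And>b. (pos f j b, (L i, z)) \<in> B" "\<And>b. ((L i, z), pos f k b) \<in> B"
    "(L i, z) \<notin> base f"
proof -
  obtain j where j: "j < t" "Suc j mod t = i" using i by (rule pred)
  have "(pos f j b, (L i, z)) \<in> B" for b
    using is_blowupD[OF B arcs[OF j(1)] selectsD[OF f j(1)], of z] z(1) j(2) unfolding pos_def by simp
  moreover have "((L i, z), pos f (Suc i mod t) b) \<in> B" for b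
    using is_blowupD[OF B arcs[OF i] z(1) selectsD[OF f suc_lt[OF i]]] unfolding pos_def by simp
  moreover have "(L i, z) \<notin> base f"
  proof
    assume "(L i, z) \<in> base f"
    then obtain k b where kb: "k < t" "L i = L k" "z = f k b" unfolding base_def pos_def by auto
    then show False using L_inj[OF i kb(1)] z by (cases b) auto
  qed
  ultimately show thesis using that[OF j(1) suc_lt[OF i]] by blast
qed

text \<open>In the untwisted half the third vertices \<open>Y\<close> and \<open>Z\<close> are
  bridges between the two cycles. The swapped half is a single cycle, to which they are merely
  attached by the complementary arcs.\<close>

lemma good_odd_third:
  assumes odd: "odd t" and W: "\<And>u. u \<in> V \<Longrightarrow> 2 \<le> card (W u)"
    and uv: "u \<in> V" "v \<in> V" "u \<noteq> v" "3 \<le> card (W u)" "3 \<le> card (W v)"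
  shows "good (SIGMA u:V. W u) B"
proof -
  obtain f where f: "selects f" using W by (rule ex_selects)
  obtain i where i: "i < t" "u = L i" using L uv unfolding bij_betw_def by auto
  obtain j where j: "j < t" "v = L j" using L uv unfolding bij_betw_def by auto
  have third: "\<exists>z. z \<in> W (L k) \<and> z \<noteq> f k True \<and> z \<noteq> f k False" if "3 \<le> card (W (L k))" for k
  proof (rule ccontr)
    assume "\<not> ?thesis"
    then have "W (L k) \<subseteq> {f k True, f k False}" by blast
    then have "card (W (L k)) \<le> card {f k True, f k False}" by (intro card_mono) auto
    then show False using that card_length[of "[f k True, f k False]"] by simp
  qed
  obtain y where y: "y \<in> W (L i)" "y \<noteq> f i True" "y \<noteq> f i False" using third[of i] uv(4) i by blast
  obtain z where z: "z \<in> W (L j)" "z \<noteq> f j True" "z \<noteq> f j False" using third[of j] uv(5) j by blast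
  define Y where "Y = (L i, y)"
  define Z where "Z = (L j, z)"
  obtain a a' where a: "a < t" "a' < t" "\<And>b. (pos f a b, Y) \<in> B" "\<And>b. (Y, pos f a' b) \<in> B" "Y \<notin> base f"
    using detour_vertex[OF f i(1) y] unfolding Y_def by metis
  obtain c c' where c: "c < t" "c' < t" "\<And>b. (pos f c b, Z) \<in> B" "\<And>b. (Z, pos f c' b) \<in> B" "Z \<notin> base f"
    using detour_vertex[OF f j(1) z] unfolding Z_def by metis
  have YZ: "Y \<noteq> Z" using uv(3) i j unfolding Y_def Z_def by auto
  have inb: "pos f k b \<in> base f" if "k < t" for k b using that unfolding base_def by blast
  have neb: "pos f k b \<noteq> Y" "pos f k b \<noteq> Z" if "k < t" for k b using inb[OF that] a(5) c(5) by metis+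
  \<comment> \<open>\<open>D True\<close> leads from the cycle of \<open>True\<close> over
    \<open>Y\<close> to that of \<open>False\<close>, and back over \<open>Z\<close>;
    \<open>D False\<close> has the opposite truth values at the same levels.\<close>
  define D where "D = (\<lambda>b. {(pos f a b, Y), (Y, pos f a' (\<not> b)), (pos f c (\<not> b), Z), (Z, pos f c' b)})"
  have DB: "D b \<subseteq> B" for b unfolding D_def using a c by auto
  let ?U = "insert Y (insert Z (base f))"
  let ?L1 = "level_arcs t (pos f) (\<lambda>_. True)" and ?L2 = "level_arcs t (pos f) (\<lambda>_. False)"
  have strong: "strong_on ?U (R \<union> D b)"
    if R: "\<And>k l b' b''. k < t \<Longrightarrow> l < t \<Longrightarrow> (pos f k b', pos f l b'') \<in> (R \<union> D b)\<^sup>*" for R b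
  proof (rule strong_onI[where p = "pos f 0 True"])
    have t0: "0 < t" using t by simp
    have Y: "(pos f a b, Y) \<in> R \<union> D b" "(Y, pos f a' (\<not> b)) \<in> R \<union> D b"
      "(pos f c (\<not> b), Z) \<in> R \<union> D b" "(Z, pos f c' b) \<in> R \<union> D b" unfolding D_def by auto
    fix v assume "v \<in> ?U"
    then consider "v = Y" | "v = Z" | k b' where "k < t" "v = pos f k b'" unfolding base_def by blast
    then have "(pos f 0 True, v) \<in> (R \<union> D b)\<^sup>* \<and> (v, pos f 0 True) \<in> (R \<union> D b)\<^sup>*"
    proof cases
      case 1
      then show ?thesis using Y(1,2) R[OF t0 a(1), of True b] R[OF a(2) t0, of "\<not> b" True]
        by (meson converse_rtrancl_into_rtrancl rtrancl_into_rtrancl)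
    next
      case 2
      then show ?thesis using Y(3,4) R[OF t0 c(1), of True "\<not> b"] R[OF c(2) t0, of b True]
        by (meson converse_rtrancl_into_rtrancl rtrancl_into_rtrancl)
    next
      case 3
      then show ?thesis using R t0 by blast
    qed
    then show "(pos f 0 True, v) \<in> (R \<union> D b)\<^sup>*" "(v, pos f 0 True) \<in> (R \<union> D b)\<^sup>*" by auto
  qed
  have "good ?U B"
  proof (rule goodI[of "?L1 \<union> D False" _ _ "?L2 \<union> D True"])
    show "strong_on ?U (?L1 \<union> D False)"
    proof (rule strong)
      fix k l b' b'' assume kl: "k < t" "l < t"
      have "(pos f k b', pos f l b'') \<in> ?L1\<^sup>*" by (rule level_arcs_connected) (use odd kl in auto)
      then show "(pos f k b', pos f l b'') \<in> (?L1 \<union> D False)\<^sup>*" by (rule rtrancl_mono_mem) blast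
    qed
    show "strong_on ?U (?L2 \<union> D True)"
    proof (rule strong, rule untwisted_connected)
      have "(pos f a True, Y) \<in> D True" "(Y, pos f a' False) \<in> D True"
        "(pos f c False, Z) \<in> D True" "(Z, pos f c' True) \<in> D True" unfolding D_def by auto
      then have "(pos f a True, pos f a' False) \<in> (?L2 \<union> D True)\<^sup>*" "(pos f c False, pos f c' True) \<in> (?L2 \<union> D True)\<^sup>*"
        by (meson UnI2 r_into_rtrancl rtrancl_into_rtrancl)+
      then show "\<exists>k < t. \<exists>l < t. (pos f k b, pos f l (\<not> b)) \<in> (?L2 \<union> D True)\<^sup>*" for b
        using a(1,2) c(1,2) by (cases b) auto
    qed auto
    have LL: "?L1 \<inter> ?L2 = {}" by (rule level_arcs_disjoint) (use pos_inj[OF f] in auto)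
    have DL: "D b \<inter> (base f \<times> base f) = {}" for b unfolding D_def using a(5) c(5) by auto
    have DD: "D False \<inter> D True = {}"
      unfolding D_def using YZ neb[OF a(1)] neb[OF a(2)] neb[OF c(1)] neb[OF c(2)]
        pos_inj[OF f a(1) a(1), of True False] pos_inj[OF f a(2) a(2), of True False]
        pos_inj[OF f c(1) c(1), of True False] pos_inj[OF f c(2) c(2), of True False]
      by auto
    have L1: "?L1 \<subseteq> base f \<times> base f" and L2: "?L2 \<subseteq> base f \<times> base f" using level_arcs_sub(2)[OF f] by blast+
    have "?L1 \<inter> D True = {}" "D False \<inter> ?L2 = {}" using L1 L2 DL by blast+
    then show "(?L1 \<union> D False) \<inter> (?L2 \<union> D True) = {}" using LL DD by blast
    have DU: "D b \<subseteq> ?U \<times> ?U" for b unfolding D_def using inb a(1,2) c(1,2) by auto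
    show "?L1 \<union> D False \<subseteq> ?U \<times> ?U" "?L2 \<union> D True \<subseteq> ?U \<times> ?U" using L1 L2 DU by blast+
    show "?L1 \<union> D False \<subseteq> B" "?L2 \<union> D True \<subseteq> B" using level_arcs_sub(1)[OF f] DB by blast+
  qed
  then show ?thesis
  proof (rule extend[OF f])
    show "?U \<subseteq> (SIGMA u:V. W u)" using base_sub[OF f] y z uv(1,2) i j unfolding Y_def Z_def by auto
  qed auto
qed

end

section \<open>Digraphs and their arc relations\<close>

text \<open>Reachability in \<open>strongly_connected\<close> is confined to \<open>V\<close>, which
  makes no difference when all arcs stay in \<open>V\<close>.\<close>

lemma strongly_connected_iff:
  assumes "R \<subseteq> V \<times> V"
  shows "strongly_connected (with_proj \<lparr>pverts = V, parcs = R\<rparr>) \<longleftrightarrow> V \<noteq> {} \<and> strong_on V R"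
proof -
  have "(u, v) \<in> rtrancl_on V R \<longleftrightarrow> (u, v) \<in> R\<^sup>*" if "u \<in> V" "v \<in> V" for u v
    using that assms rtrancl_on_rtranclI[of u v V R] rtrancl_consistent_rtrancl_on[of u v R V] by blast
  then show ?thesis unfolding strongly_connected_def reachable_def strong_on_def by auto
qed

lemma strong_on_if_strongly_connected:
  assumes "parcs D \<subseteq> pverts D \<times> pverts D" "strongly_connected (with_proj D)"
  shows "strong_on (pverts D) (parcs D)"
proof (cases D)
  case (fields V R)
  then show ?thesis using strongly_connected_iff[of R V] assms by simp
qed

lemma good_decompositionI:
  assumes "good (pverts D) (parcs D)" "pverts D \<noteq> {}"
  shows "good_decomposition D"
proof -
  obtain A1 A2 where A: "A1 \<subseteq> parcs D" "A1 \<subseteq> pverts D \<times> pverts D" "A2 \<subseteq> parcs D" "A2 \<subseteq> pverts D \<times> pverts D"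
    "A1 \<inter> A2 = {}" "strong_on (pverts D) A1" "strong_on (pverts D) A2" using assms(1) by (rule goodE)
  then show ?thesis unfolding good_decomposition_def
    using strongly_connected_iff[OF A(2)] strongly_connected_iff[OF A(4)] assms(2)
    by (intro exI[of _ A1] exI[of _ A2]) simp
qed

lemma pair_digraph_parcs:
  assumes "pair_digraph T"
  shows "finite (pverts T)" "finite (parcs T)" "parcs T \<subseteq> pverts T \<times> pverts T" "irrefl (parcs T)"
proof -
  interpret pair_digraph T by fact
  show "finite (pverts T)" "finite (parcs T)" by (rule pair_finite_verts pair_finite_arcs)+
  show "parcs T \<subseteq> pverts T \<times> pverts T"
  proof
    fix e assume "e \<in> parcs T"
    then have "fst e \<in> pverts T" "snd e \<in> pverts T" by (rule arc_fst_in_verts arc_snd_in_verts)+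
    then show "e \<in> pverts T \<times> pverts T" by (cases e) auto
  qed
  show "irrefl (parcs T)" unfolding irrefl_def using pair_no_loops by fastforce
qed

lemma arc_strong_two_arc_strong:
  assumes T: "pair_digraph T" and "arc_strong 2 T"
  shows "two_arc_strong (pverts T) (parcs T)"
  unfolding two_arc_strong_def
proof (intro allI impI notI)
  note P = pair_digraph_parcs[OF T]
  fix Z e assume Z: "Z \<subset> pverts T" "Z \<noteq> {}" and sub: "leaving (parcs T \<inter> pverts T \<times> pverts T) Z \<subseteq> {e}"
  \<comment> \<open>\<open>e\<close> may fail to be an arc, while \<open>arc_strong\<close> speaks
    of subsets of the arc set.\<close>
  define X where "X = parcs T \<inter> {e}"
  have "card X \<le> card {e}" unfolding X_def by (intro card_mono) auto
  then have "strongly_connected (with_proj \<lparr>pverts = pverts T, parcs = parcs T - X\<rparr>)"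
    using assms(2) unfolding arc_strong_def X_def by auto
  moreover have "parcs T - X \<subseteq> pverts T \<times> pverts T" using P(3) by auto
  ultimately have s: "strong_on (pverts T) (parcs T - X)" using strongly_connected_iff by blast
  obtain u v where uv: "u \<in> Z" "v \<in> pverts T - Z" using Z by blast
  then have "(u, v) \<in> (parcs T - X)\<^sup>*" using s Z unfolding strong_on_def by blast
  moreover have "w \<in> Z" if "(u, w) \<in> (parcs T - X)\<^sup>*" for w
    using that
  proof induction
    case (step x y)
    show ?case
    proof (rule ccontr)
      assume "y \<notin> Z"
      then have "(x, y) \<in> leaving (parcs T \<inter> pverts T \<times> pverts T) Z" using step P(3) unfolding leaving_def by auto
      then show False using sub step unfolding X_def by auto
    qed
  qed (use uv in simp)
  ultimately show False using uv by blast
qed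

lemma cas_nth:
  assumes "pre_digraph.cas (with_proj D) u p v" "i < length p"
  shows "fst (p ! i) = (if i = 0 then u else snd (p ! (i - 1)))" "p \<noteq> [] \<Longrightarrow> snd (last p) = v"
proof -
  show "fst (p ! i) = (if i = 0 then u else snd (p ! (i - 1)))" using assms
  proof (induction p arbitrary: u i)
    case (Cons e p)
    have c: "fst e = u" "pre_digraph.cas (with_proj D) (snd e) p v" using Cons.prems(1) by (auto simp: pre_digraph.cas.simps)
    show ?case
    proof (cases i)
      case (Suc k)
      then have "fst (p ! k) = (if k = 0 then snd e else snd (p ! (k - 1)))" using Cons.IH[OF c(2), of k] Cons.prems(2) by simp
      then show ?thesis using Suc by (cases k) auto
    qed (use c in simp)
  qed simp
  show "snd (last p) = v" if "p \<noteq> []" using that assms(1)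
  proof (induction p arbitrary: u)
    case (Cons e p)
    then show ?case by (cases "p = []") (auto simp: pre_digraph.cas.simps)
  qed simp
qed

lemma cas_awalk_verts:
  "pre_digraph.cas (with_proj D) u p v \<Longrightarrow> pre_digraph.awalk_verts (with_proj D) u p = u # map snd p"
  by (induction p arbitrary: u) (auto simp: pre_digraph.cas.simps pre_digraph.awalk_verts.simps)

text \<open>Level \<open>i\<close> is the head of the arc with index \<open>i\<close>: a cycle has
  distinct vertices after its first, and these are exactly the heads. The arc from level
  \<open>i\<close> to the next one then has index \<open>i + 1\<close> modulo the length.\<close>

lemma hamiltonian_levels:
  assumes "hamiltonian D"
  obtains L where "bij_betw L {..<card (pverts D)} (pverts D)"
    "\<And>i. i < card (pverts D) \<Longrightarrow> (L i, L (Suc i mod card (pverts D))) \<in> parcs D"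
proof -
  obtain p where p: "pre_digraph.cycle (with_proj D) p" "fst ` set p = pverts D" using assms unfolding hamiltonian_def by blast
  obtain u where u: "pre_digraph.awalk (with_proj D) u p u" "distinct (tl (pre_digraph.awalk_verts (with_proj D) u p))" "p \<noteq> []"
    using p(1) unfolding pre_digraph.cycle_def by blast
  have sub: "set p \<subseteq> parcs D" and cas: "pre_digraph.cas (with_proj D) u p u"
    using u(1) unfolding pre_digraph.awalk_def by auto
  have dist: "distinct (map snd p)" using u(2) cas_awalk_verts[OF cas] by simp
  let ?n = "length p"
  define L where "L = (\<lambda>i. snd (p ! i))"
  have n: "0 < ?n" using u(3) by simp
  have fs: "fst (p ! (Suc i mod ?n)) = L i" if "i < ?n" for i
  proof (cases "Suc i = ?n")
    case True
    then have "i = ?n - 1" by simp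
    then have "L i = snd (last p)" unfolding L_def using u(3) by (simp add: last_conv_nth)
    then show ?thesis using cas_nth[OF cas n] u(3) True by simp
  next
    case False
    then have "Suc i < ?n" using that by simp
    then show ?thesis using cas_nth(1)[OF cas \<open>Suc i < ?n\<close>] unfolding L_def by simp
  qed
  have "inj_on L {..<?n}" using dist unfolding L_def by (auto simp: inj_on_def distinct_conv_nth)
  moreover have im: "L ` {..<?n} = pverts D"
  proof
    show "L ` {..<?n} \<subseteq> pverts D"
    proof
      fix x assume "x \<in> L ` {..<?n}"
      then obtain i where i: "i < ?n" "x = L i" by auto
      have "Suc i mod ?n < ?n" using n by simp
      then have "fst (p ! (Suc i mod ?n)) \<in> fst ` set p" by (intro imageI nth_mem)
      then show "x \<in> pverts D" using fs[OF i(1)] i(2) p(2) by simp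
    qed
    show "pverts D \<subseteq> L ` {..<?n}"
    proof
      fix x assume "x \<in> pverts D"
      then have "x \<in> fst ` set p" using p(2) by simp
      then obtain e where "e \<in> set p" "x = fst e" by blast
      then obtain i where i: "i < ?n" "x = fst (p ! i)" by (metis in_set_conv_nth)
      define j where "j = (if i = 0 then ?n - 1 else i - 1)"
      have "j < ?n" "Suc j mod ?n = i" using i(1) n unfolding j_def by auto
      then show "x \<in> L ` {..<?n}" using fs[of j] i(2) by auto
    qed
  qed
  ultimately have bij: "bij_betw L {..<?n} (pverts D)" unfolding bij_betw_def by simp
  then have card: "card (pverts D) = ?n" using bij_betw_same_card by fastforce
  show thesis
  proof (rule that)
    show "bij_betw L {..<card (pverts D)} (pverts D)" using bij card by simp
    fix i assume "i < card (pverts D)"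
    then have i: "i < ?n" "Suc i mod ?n < ?n" using card n by auto
    have "p ! (Suc i mod ?n) \<in> parcs D" using sub i(2) by auto
    moreover have "p ! (Suc i mod ?n) = (L i, L (Suc i mod ?n))" using fs[OF i(1)] unfolding L_def by (metis prod.collapse)
    ultimately show "(L i, L (Suc i mod card (pverts D))) \<in> parcs D" using card by simp
  qed
qed

lemma composition_simps:
  "pverts (composition T H) = (SIGMA u:pverts T. pverts (H u))"
  "is_blowup (parcs T) (\<lambda>u. pverts (H u)) (parcs (composition T H))"
  "u \<in> pverts T \<Longrightarrow> (x, y) \<in> parcs (H u) \<Longrightarrow> ((u, x), (u, y)) \<in> parcs (composition T H)"
  unfolding composition_def is_blowup_def by auto

text \<open>With one vertex in each \<open>H u\<close> the composition merely renames
  \<open>T\<close>, so this is where the exclusion of S4 for the composition enters.\<close>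

lemma composition_S4_iso:
  assumes S4: "is_S4 (pverts T) (parcs T)"
    and H: "\<And>u. u \<in> pverts T \<Longrightarrow> pverts (H u) = {w u}" "\<And>u. u \<in> pverts T \<Longrightarrow> parcs (H u) = {}"
  shows "digraph_iso (with_proj (composition T H)) (with_proj S4)"
proof -
  obtain a b c d where abcd: "distinct [a, b, c, d]" "pverts T = {a, b, c, d}"
    "parcs T = {(a, c), (c, a), (b, d), (d, b), (b, a), (c, b), (d, c), (a, d)}"
    using S4 unfolding is_S4_def by blast
  let ?Q = "composition T H"
  define g where "g = (\<lambda>u. (u, w u))"
  have V: "pverts ?Q = {g a, g b, g c, g d}" unfolding composition_simps using abcd(2) H(1) unfolding g_def by auto
  have A: "parcs ?Q = {(g a, g c), (g c, g a), (g b, g d), (g d, g b), (g b, g a), (g c, g b), (g d, g c), (g a, g d)}"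
  proof -
    have "parcs ?Q = map_prod g g ` parcs T"
    proof
      show "map_prod g g ` parcs T \<subseteq> parcs ?Q"
        using is_blowupD[OF composition_simps(2)[of T H]] H(1) abcd(2,3) unfolding g_def by auto
      show "parcs ?Q \<subseteq> map_prod g g ` parcs T"
      proof
        fix e assume "e \<in> parcs ?Q"
        then obtain u v x y where e: "e = ((u, x), (v, y))" "(u, v) \<in> parcs T" "x \<in> pverts (H u)" "y \<in> pverts (H v)"
          unfolding composition_def using H(2) by auto
        moreover have "u \<in> pverts T" "v \<in> pverts T" using e(2) abcd(2,3) by auto
        ultimately have "e = map_prod g g (u, v)" using H(1) unfolding g_def by auto
        then show "e \<in> map_prod g g ` parcs T" using e(2) by blast
      qed
    qed
    then show ?thesis unfolding abcd(3) by simp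
  qed
  define h where "h = (\<lambda>v. if v = a then 0 else if v = b then 1 else if v = c then 2 else (3 :: nat))"
  have h: "h a = 0" "h b = 1" "h c = 2" "h d = 3" using abcd(1) unfolding h_def by auto
  define f :: "('a \<times> 'b, ('a \<times> 'b) \<times> ('a \<times> 'b), nat, nat \<times> nat) digraph_isomorphism" where
    "f = \<lparr>iso_verts = (\<lambda>v. h (fst v)), iso_arcs = map_prod (\<lambda>v. h (fst v)) (\<lambda>v. h (fst v)), iso_head = snd, iso_tail = fst\<rparr>"
  have gh: "h (fst (g v)) = h v" for v unfolding g_def by simp
  have "pre_digraph.digraph_isomorphism (with_proj ?Q) f"
    unfolding pre_digraph.digraph_isomorphism_def
  proof (intro conjI)
    show "wf_digraph (with_proj ?Q)" by (unfold_locales) (auto simp: V A)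
    show i: "inj_on (iso_verts f) (verts (with_proj ?Q))" unfolding f_def by (auto simp: inj_on_def V gh h)
    show "inj_on (iso_arcs f) (arcs (with_proj ?Q))" unfolding f_def by (auto simp: inj_on_def A gh h)
  qed (auto simp: f_def)
  moreover have "with_proj S4 = app_iso f (with_proj ?Q)"
  proof -
    have "{(i, j). i \<in> {0, 1, 2, 3} \<and> j \<in> {0, 1, 2, 3} \<and> i \<noteq> j} - {(0, 1), (1, 2), (2, 3), (3, 0)}
      = {(0, 2), (2, 0), (1, 3), (3, 1), (1, 0), (2, 1), (3, 2), (0, 3 :: nat)}" by auto
    then show ?thesis unfolding app_iso_def f_def with_proj_def S4_def by (simp add: V A gh h)
  qed
  ultimately show ?thesis unfolding digraph_iso_def by blast
qed

theorem theorem2p2: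
  fixes T :: "'a pair_pre_digraph" and H :: "'a \<Rightarrow> 'b pair_pre_digraph"
    and Q :: "('a \<times> 'b) pair_pre_digraph" and t :: nat and n :: "'a \<Rightarrow> nat"
  defines "Q \<equiv> composition T H"
    and "t \<equiv> card (pverts T)"
    and "n \<equiv> \<lambda>u. card (pverts (H u))"
  assumes "pair_digraph T"
    and "t \<ge> 2"
    and "\<And>u. u \<in> pverts T \<Longrightarrow> pair_digraph (H u)"
    and "\<And>u. u \<in> pverts T \<Longrightarrow> pverts (H u) \<noteq> {}"
    and "(arc_strong 2 T \<and> semicomplete T \<and> \<not> digraph_iso (with_proj Q) (with_proj S4))
       \<or> (hamiltonian T \<and>
            ((even t \<and> (\<forall>u \<in> pverts T. n u \<ge> 2))
           \<or> (odd t \<and> (\<exists>v \<in> pverts T. n v \<ge> 2 \<and> (\<forall>u \<in> pverts T - {v}. n u \<ge> 3)))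
           \<or> (odd t \<and> (\<forall>u \<in> pverts T. n u \<ge> 2) \<and>
                (\<exists>u \<in> pverts T. \<exists>v \<in> pverts T.
                   u \<noteq> v \<and> parcs (H u) \<noteq> {} \<and> parcs (H v) \<noteq> {}))))
       \<or> (strongly_connected (with_proj T) \<and>
            (\<forall>u \<in> pverts T. strongly_connected (with_proj (H u)) \<and> n u \<ge> 2))"
  shows "good_decomposition Q"
proof -
  note T = pair_digraph_parcs[OF assms(4)]
  have t2: "2 \<le> card (pverts T)" using assms(2,5) by simp
  have pH: "finite (pverts (H u))" "parcs (H u) \<subseteq> pverts (H u) \<times> pverts (H u)" "irrefl (parcs (H u))"
    if "u \<in> pverts T" for u
    using pair_digraph_parcs[OF assms(6)[OF that]] by auto
  note B = composition_simps(2)[of T H]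
  obtain u0 where u0: "u0 \<in> pverts T" using t2 by fastforce
  then have ne: "pverts Q \<noteq> {}" using assms(7)[OF u0] unfolding assms(1) composition_simps by auto
  have "good (SIGMA u:pverts T. pverts (H u)) (parcs Q)"
    using assms(8)
  proof (elim disjE)
    assume a: "arc_strong 2 T \<and> semicomplete T \<and> \<not> digraph_iso (with_proj Q) (with_proj S4)"
    have ts: "two_arc_strong (pverts T) (parcs T)" using arc_strong_two_arc_strong assms(4) a by blast
    have sc: "semicomp (pverts T) (parcs T)" using a T unfolding semicomplete_def semicomp_def by blast
    show ?thesis
    proof (cases "is_S4 (pverts T) (parcs T)")
      case False
      then show ?thesis unfolding assms(1)
        using good_blowup_two_arc_strong[OF B ts t2 good_if_two_arc_strong_semicomp[OF sc ts False]] assms(7) by blast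
    next
      case S4: True
      \<comment> \<open>Either some \<open>H u\<close> has two vertices, or all are single vertices
        and \<open>Q\<close> is itself a copy of S4.\<close>
      show ?thesis
      proof (cases "\<exists>u \<in> pverts T. \<exists>x \<in> pverts (H u). \<exists>x' \<in> pverts (H u). x \<noteq> x'")
        case True
        then show ?thesis unfolding assms(1) using good_blowup_S4[OF B ts S4] assms(7) by blast
      next
        case False
        define w where "w = (\<lambda>u. SOME x. x \<in> pverts (H u))"
        have w: "pverts (H u) = {w u}" if "u \<in> pverts T" for u
        proof -
          have "w u \<in> pverts (H u)" using assms(7)[OF that] unfolding w_def by (metis ex_in_conv someI_ex)
          then show ?thesis using False that by blast
        qed
        have no: "parcs (H u) = {}" if "u \<in> pverts T" for u
          using pH(2,3)[OF that] w[OF that] by (auto simp: irrefl_def)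
        have "digraph_iso (with_proj Q) (with_proj S4)" unfolding assms(1) by (rule composition_S4_iso[OF S4, of H w]) (simp_all add: w no)
        then show ?thesis using a by blast
      qed
    qed
  next
    assume b: "hamiltonian T \<and>
            ((even t \<and> (\<forall>u \<in> pverts T. n u \<ge> 2))
           \<or> (odd t \<and> (\<exists>v \<in> pverts T. n v \<ge> 2 \<and> (\<forall>u \<in> pverts T - {v}. n u \<ge> 3)))
           \<or> (odd t \<and> (\<forall>u \<in> pverts T. n u \<ge> 2) \<and>
                (\<exists>u \<in> pverts T. \<exists>v \<in> pverts T.
                   u \<noteq> v \<and> parcs (H u) \<noteq> {} \<and> parcs (H v) \<noteq> {})))"
    obtain L where L: "bij_betw L {..<t} (pverts T)" "\<And>i. i < t \<Longrightarrow> (L i, L (Suc i mod t)) \<in> parcs T"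
      unfolding assms(2) using hamiltonian_levels[of T] b by metis
    interpret hamiltonian_blowup "pverts T" "parcs T" "\<lambda>u. pverts (H u)" "parcs Q" t L
      by unfold_locales (use B assms(5) L in \<open>auto simp: assms(1)\<close>)
    consider (even) "even t" "\<forall>u \<in> pverts T. n u \<ge> 2"
      | (third) v where "odd t" "v \<in> pverts T" "n v \<ge> 2" "\<forall>u \<in> pverts T - {v}. n u \<ge> 3"
      | (arcs) u v where "odd t" "\<forall>u \<in> pverts T. n u \<ge> 2" "u \<in> pverts T" "v \<in> pverts T" "u \<noteq> v"
          "parcs (H u) \<noteq> {}" "parcs (H v) \<noteq> {}"
      using b by blast
    then show ?thesis
    proof cases
      case even
      then show ?thesis using good_even unfolding assms(3) by blast
    next
      case third
      have W: "2 \<le> card (pverts (H u))" if "u \<in> pverts T" for u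
        using third that unfolding assms(3) by (cases "u = v") (auto dest!: bspec[of _ _ u])
      \<comment> \<open>An odd \<open>t\<close> that is at least 2 is at least 3, so two vertices
        besides \<open>v\<close> remain.\<close>
      have "card (pverts T - {v}) = t - 1" using third(2) T(1) unfolding assms(2) by simp
      moreover have "t \<noteq> 2" using third(1) by auto
      ultimately have "2 \<le> card (pverts T - {v})" using assms(5) by simp
      then obtain x y where xy: "x \<in> pverts T - {v}" "y \<in> pverts T - {v}" "x \<noteq> y"
        using T(1) by (metis card_le_Suc0_iff_eq finite_Diff not_less_eq_eq numeral_2_eq_2)
      show ?thesis by (rule good_odd_third[of x y]) (use third xy W in \<open>auto simp: assms(3)\<close>)
    next
      case arcs
      obtain x y where xy: "(x, y) \<in> parcs (H u)" using arcs(6) by auto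
      obtain x' y' where xy': "(x', y') \<in> parcs (H v)" using arcs(7) by auto
      show ?thesis
      proof (rule good_odd_arcs[of u x y v x' y'])
        show "((u, x), (u, y)) \<in> parcs Q" "((v, x'), (v, y')) \<in> parcs Q"
          unfolding assms(1) by (intro composition_simps(3) arcs(3,4) xy xy')+
        show "x \<noteq> y" "x' \<noteq> y'" using xy xy' pH(3)[OF arcs(3)] pH(3)[OF arcs(4)] by (auto simp: irrefl_def)
      qed (use arcs xy xy' pH(2)[OF arcs(3)] pH(2)[OF arcs(4)] in \<open>auto simp: assms(3)\<close>)
    qed
  next
    assume c: "strongly_connected (with_proj T) \<and>
            (\<forall>u \<in> pverts T. strongly_connected (with_proj (H u)) \<and> n u \<ge> 2)"
    show ?thesis unfolding assms(1)
    proof (rule good_blowup_strong[OF B, where I = "\<lambda>u. parcs (H u)"])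
      show "strong_on (pverts T) (parcs T)"
        using strong_on_if_strongly_connected[OF T(3)] c by simp
      show "parcs (H u) \<subseteq> pverts (H u) \<times> pverts (H u) \<and> strong_on (pverts (H u)) (parcs (H u))" if "u \<in> pverts T" for u
        using strong_on_if_strongly_connected[OF pH(2)[OF that]] c that pH(2)[OF that] by simp
    qed (use T t2 c composition_simps(3) in \<open>auto simp: assms(3)\<close>)
  qed
  then show ?thesis using ne by (intro good_decompositionI) (simp_all add: assms(1) composition_simps(1))
qed

end
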